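(* Assume that there exists $\delta>0$ such that $\mathbb{E}[|Z_{ij}|^{4+\delta}]<+\infty$ for all $i,j$, and that there exists $\gamma_{\max}>0$ such that $\sup_{n\ge 1}\max_{1\le i\le n,\,1\le j\le p}|\gamma_{ij}^{(n)}|<\gamma_{\max}$. Then for every $z\in\mathbb{C}\setminus\mathbb{R}^+$, as $n,p\to\infty$ with $p/n\to c$, one has the equivalences of matrix families $$\bigl(\Delta[Q_p(z)]\bigr)_{p\ge1}\sim\bigl(T_p(z)\bigr)_{p\ge1},\qquad \bigl(\Delta[Q_p'(z)]\bigr)_{p\ge1}\sim\bigl(T_p'(z)\bigr)_{p\ge1},$$ $$\bigl(\Delta[\widetilde Q_n(z)]\bigr)_{n\ge1}\sim\bigl(\widetilde T_n(z)\bigr)_{n\ge1},\qquad \bigl(\Delta[\widetilde Q_n'(z)]\bigr)_{n\ge1}\sim\bigl(\widetilde T_n'(z)\bigr)_{n\ge1},$$ where $'$ denotes the derivative with respect to $z$.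
   Context: Asymptotic regime: $p=p(n)$, $n\to\infty$ and $p/n\to c$ for some $c\in(0,\infty)$. $\mathbb{R}^+=[0,\infty)$. Design: $X_n=\Upsilon_n\circ Z_n\in\mathbb{R}^{n\times p}$, where $\circ$ is the entrywise product, $\Upsilon_n=(\gamma_{ij}^{(n)})$ is a deterministic real $n\times p$ matrix, and $Z_n=(Z_{ij})$ is a real random matrix with i.i.d. centered entries of variance one (common law not depending on $n$). Write $\gamma_{ij}=\gamma_{ij}^{(n)}$, $\widehat\Sigma_n=\frac1nX_n^\top X_n$, $\widetilde\Sigma_n=\frac1nX_nX_n^\top$, and for $z\in\mathbb{C}\setminus\mathbb{R}^+$ let $Q_p(z)=(\widehat\Sigma_n-zI_p)^{-1}$ and $\widetilde Q_n(z)=(\widetilde\Sigma_n-zI_n)^{-1}$. For a square matrix $A$, $\Delta[A]$ is the diagonal matrix with the same diagonal entries as $A$. Let $D_i=\operatorname{diag}(\gamma_{i1}^2,\dots,\gamma_{ip}^2)$ and $\widetilde D_j=\operatorname{diag}(\gamma_{1j}^2,\dots,\gamma_{nj}^2)$. For $z\in\mathbb{C}\setminus\mathbb{R}^+$, the diagonal matrices $T_p(z)=\operatorname{diag}(T_p^{(j)}(z))_{1\le j\le p}$ and $\widetilde T_n(z)=\operatorname{diag}(\widetilde T_n^{(i)}(z))_{1\le i\le n}$ are the unique solution of $$T_p^{(j)}(z)=\frac{-1}{z\bigl(1+\frac1n\operatorname{Tr}[\widetilde D_j\widetilde T_n(z)]\bigr)},\qquad \widetilde T_n^{(i)}(z)=\frac{-1}{z\bigl(1+\frac1n\operatorname{Tr}[D_iT_p(z)]\bigr)},$$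 in the class where every entry is the Stieltjes transform $z\mapsto\int\frac{\mu(dt)}{t-z}$ of a probability measure $\mu$ on $[0,\infty)$. Equivalence: two families $(A_p)_{p\ge1}$, $(B_p)_{p\ge1}$ of random complex matrices with $A_p,B_p\in\mathbb{C}^{p\times p}$ satisfy $(A_p)\sim(B_p)$ if, for every family of deterministic matrices $(U_p)_{p\ge1}$ with $U_p\in\mathbb{R}^{p\times p}$ whose diagonal entries $U_p^{(i)}$ satisfy $\sup_{p\ge1}\max_{1\le i\le p}|U_p^{(i)}|\le K$ for some $K>0$, one has almost surely $$\lim_{n\to\infty,\ p/n\to c}\Bigl|\tfrac1p\operatorname{Tr}[A_pU_p]-\tfrac1p\operatorname{Tr}[B_pU_p]\Bigr|=0.$$ For families of $n\times n$ matrices indexed by $n$ the definition is the same with $p$ replaced by $n$. *)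

theory Defs
  imports
    "HOL-Probability.Probability"
    "Jordan_Normal_Form.Gauss_Jordan_Elimination"
begin

text \<open>
  Matrices are those of \<open>Jordan_Normal_Form\<close>, so that dimensions are natural numbers that may vary
  with \<open>n\<close>.  Row and column indices start at 0: the entry in row \<open>i + 1\<close> and column \<open>j + 1\<close> of the
  usual notation has index \<open>(i, j)\<close>.
\<close>

definition mat_trace :: "'a::comm_monoid_add mat \<Rightarrow> 'a" where
  "mat_trace A = (\<Sum>i<dim_row A. A $$ (i, i))"

definition diag_part :: "'a::zero mat \<Rightarrow> 'a mat" where
  "diag_part A = mat_diag (dim_row A) (\<lambda>i. A $$ (i, i))"

definition entrywise_prod :: "'a::times mat \<Rightarrow> 'a mat \<Rightarrow> 'a mat" where
  "entrywise_prod A B = Matrix.mat (dim_row A) (dim_col A) (\<lambda>(i, j). A $$ (i, j) * B $$ (i, j))"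

definition mat_deriv :: "(complex \<Rightarrow> complex mat) \<Rightarrow> complex \<Rightarrow> complex mat" where
  "mat_deriv F z =
     Matrix.mat (dim_row (F z)) (dim_col (F z)) (\<lambda>(i, j). deriv (\<lambda>w. F w $$ (i, j)) z)"

text \<open>
  \<open>mat_inverse\<close> is optional-valued.  Below, \<open>S\<close> is positive semidefinite and \<open>z\<close> lies outside
  \<open>[0, \<infinity>)\<close>, so the inverse exists.
\<close>

definition resolvent :: "real mat \<Rightarrow> complex \<Rightarrow> complex mat" where
  "resolvent S z =
     the (mat_inverse (map_mat complex_of_real S - z \<cdot>\<^sub>m 1\<^sub>m (dim_row S)))"

text \<open>
  The random design matrix, its resolvent \<open>Q\<close> (of size \<open>p\<close>) and co-resolvent \<open>Q_tilde\<close> (of size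
  \<open>n\<close>), for one sample point: \<open>\<gamma> i j\<close> and \<open>\<zeta> i j\<close> are the entries of the variance profile and of the
  realized noise matrix.
\<close>

definition design :: "nat \<Rightarrow> nat \<Rightarrow> (nat \<Rightarrow> nat \<Rightarrow> real) \<Rightarrow> (nat \<Rightarrow> nat \<Rightarrow> real) \<Rightarrow> real mat" where
  "design n p \<gamma> \<zeta> =
     entrywise_prod (Matrix.mat n p (\<lambda>(i, j). \<gamma> i j)) (Matrix.mat n p (\<lambda>(i, j). \<zeta> i j))"

definition Q :: "nat \<Rightarrow> nat \<Rightarrow> (nat \<Rightarrow> nat \<Rightarrow> real) \<Rightarrow> (nat \<Rightarrow> nat \<Rightarrow> real) \<Rightarrow> complex \<Rightarrow> complex mat" where
  "Q n p \<gamma> \<zeta> =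
     resolvent ((1 / real n) \<cdot>\<^sub>m (transpose_mat (design n p \<gamma> \<zeta>) * design n p \<gamma> \<zeta>))"

definition Q_tilde :: "nat \<Rightarrow> nat \<Rightarrow> (nat \<Rightarrow> nat \<Rightarrow> real) \<Rightarrow> (nat \<Rightarrow> nat \<Rightarrow> real) \<Rightarrow> complex \<Rightarrow> complex mat" where
  "Q_tilde n p \<gamma> \<zeta> =
     resolvent ((1 / real n) \<cdot>\<^sub>m (design n p \<gamma> \<zeta> * transpose_mat (design n p \<gamma> \<zeta>)))"

definition D_row :: "nat \<Rightarrow> (nat \<Rightarrow> nat \<Rightarrow> real) \<Rightarrow> nat \<Rightarrow> complex mat" where
  "D_row p \<gamma> i = mat_diag p (\<lambda>j. complex_of_real ((\<gamma> i j)\<^sup>2))"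

definition D_col :: "nat \<Rightarrow> (nat \<Rightarrow> nat \<Rightarrow> real) \<Rightarrow> nat \<Rightarrow> complex mat" where
  "D_col n \<gamma> j = mat_diag n (\<lambda>i. complex_of_real ((\<gamma> i j)\<^sup>2))"

definition stieltjes_class :: "(complex \<Rightarrow> complex) \<Rightarrow> bool" where
  "stieltjes_class f \<longleftrightarrow>
     (\<exists>\<mu> :: real measure. prob_space \<mu> \<and> sets \<mu> = sets borel \<and> measure \<mu> {0..} = 1 \<and>
        (\<forall>z. z \<notin> \<real>\<^sub>\<ge>\<^sub>0 \<longrightarrow> f z = (\<integral>t. 1 / (complex_of_real t - z) \<partial>\<mu>)))"

text \<open>
  \<open>T\<close> and \<open>Tt\<close> give the diagonal entries, as functions of \<open>z\<close>, of the diagonal matrices of size \<open>p\<close>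
  and \<open>n\<close> that solve the system in the Stieltjes class.  Entries are constrained (and, by the
  uniqueness of the solution, determined) only on the complement of the half-line \<open>[0, \<infinity>)\<close>.
\<close>

definition diag_equiv_solution ::
  "nat \<Rightarrow> nat \<Rightarrow> (nat \<Rightarrow> nat \<Rightarrow> real) \<Rightarrow> (nat \<Rightarrow> complex \<Rightarrow> complex) \<Rightarrow> (nat \<Rightarrow> complex \<Rightarrow> complex) \<Rightarrow> bool"
  where
  "diag_equiv_solution n p \<gamma> T Tt \<longleftrightarrow>
     (\<forall>j<p. stieltjes_class (T j)) \<and> (\<forall>i<n. stieltjes_class (Tt i)) \<and>
     (\<forall>z. z \<notin> \<real>\<^sub>\<ge>\<^sub>0 \<longrightarrow>
        (\<forall>j<p. T j z =
           -1 / (z * (1 + (1 / of_nat n) * mat_trace (D_col n \<gamma> j * mat_diag n (\<lambda>i. Tt i z))))) \<and>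
        (\<forall>i<n. Tt i z =
           -1 / (z * (1 + (1 / of_nat n) * mat_trace (D_row p \<gamma> i * mat_diag p (\<lambda>j. T j z))))))"

text \<open>
  Equivalence of two families of random complex matrices, the \<open>n\<close>-th members being of size \<open>d n\<close>.
  The families, and the deterministic test matrices, are indexed by \<open>n\<close> rather than by the
  dimension, since \<open>d\<close> need not be injective.  Test families \<open>V\<close> indexed by the dimension are the
  instances \<open>U n = V (d n)\<close>.
\<close>

definition mat_family_equiv ::
  "'w measure \<Rightarrow> (nat \<Rightarrow> nat) \<Rightarrow> (nat \<Rightarrow> 'w \<Rightarrow> complex mat) \<Rightarrow> (nat \<Rightarrow> 'w \<Rightarrow> complex mat) \<Rightarrow> bool"
  where
  "mat_family_equiv M d A B \<longleftrightarrow>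
     (\<forall>U :: nat \<Rightarrow> real mat.
        (\<forall>n\<ge>1. U n \<in> carrier_mat (d n) (d n)) \<longrightarrow>
        (\<exists>K>0. \<forall>n\<ge>1. \<forall>i<d n. \<bar>U n $$ (i, i)\<bar> \<le> K) \<longrightarrow>
        (AE \<omega> in M.
           (\<lambda>n. cmod ((1 / of_nat (d n)) * mat_trace (A n \<omega> * map_mat complex_of_real (U n))
                     - (1 / of_nat (d n)) * mat_trace (B n \<omega> * map_mat complex_of_real (U n))))
           \<longlonglongrightarrow> 0))"

end

theory Submission
  imports
    Defs
    "HOL-Complex_Analysis.Complex_Analysis"
    "Jordan_Normal_Form.Determinant"
begin

text \<open>
  At a real point \<open>z = -x\<close>, Schur's formula writes a diagonal entry of \<open>Q\<close> as
  \<open>1 / (x (1 + n\<^sup>-\<^sup>1 y\<^sup>T Q' y))\<close>, where \<open>y\<close> is a column of the design and \<open>Q'\<close> is the co-resolvent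
  of the design without that column.  Since \<open>y\<close> and \<open>Q'\<close> are independent, the quadratic form is close in
  \<open>L\<^sup>2\<close> to \<open>n\<^sup>-\<^sup>1 Tr[D Q']\<close>; a rank-one bound replaces \<open>Q'\<close> by the co-resolvent itself, and bounded
  differences (changing one column moves \<open>Tr[D Q]\<close> by a bounded amount) replace the trace by its mean.  Hence the
  means of the diagonal entries of the two resolvents solve the system of \<open>T\<close> up to \<open>O(n\<^sup>-\<^sup>1\<^sup>/\<^sup>2)\<close>, and for \<open>x\<close> large
  the system is a contraction, so these means are close to \<open>T\<close>.  Bounded differences also give fourth moments of order
  \<open>n\<^sup>-\<^sup>2\<close> for the normalized traces, hence almost sure convergence at each large \<open>x\<close>.  Everything is
  holomorphic and locally bounded off \<open>[0, \<infinity>)\<close>, so Vitali's theorem carries the convergence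
  to all \<open>z\<close> and to the derivatives; no stability analysis near the half-line is needed.
\<close>

section \<open>Resolvents at negative reals\<close>

text \<open>The points \<open>z = -x\<close> are chosen because \<open>k X X^T + x I\<close> is
  positive definite there: diagonal entries of both resolvents lie in \<open>[0, 1/x]\<close> and
  every denominator \<open>1 + s\<close> is at least 1, so Schur's formula can be perturbed freely.
  "Large" means \<open>x > 2 * \<Gamma> * L\<close> with \<open>\<Gamma>\<close> the bound on the
  squared profile and \<open>L = max 1 (2 * c)\<close>: the row and column sums of
  \<open>\<gamma>^2 / n\<close> are eventually at most \<open>\<Gamma> * L\<close>, hence below
  \<open>x / 2\<close>.

  Changing one column may move a single diagonal entry by order one, so bounded differences say
  nothing useful about it. Entries are therefore compared with \<open>T\<close> in mean, and
  fluctuations are controlled for weighted traces. Nothing relates the noise arrays for different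
  \<open>n\<close>, and second moments of order \<open>1/n\<close> are not summable; this is why
  fourth moments of the traces are taken.

  Inverses are written through cofactors: a quotient of polynomials in the matrix entries gives
  measurability in the noise and holomorphy in \<open>z\<close> by the same formula. Both resolvents
  are instances of one construction, applied to the array and to its transpose.\<close>

lemma inverse_by_cofactors:
  fixes a :: "nat \<Rightarrow> nat \<Rightarrow> 'a::field"
  assumes ker: "\<forall>v. (\<forall>i<m. (\<Sum>l<m. a i l * v l) = 0) \<longrightarrow> (\<forall>i<m. v i = 0)"
  defines "A \<equiv> Matrix.mat m m (\<lambda>(i, l). a i l)"
  shows "Determinant.det A \<noteq> 0"
    and "the (mat_inverse A) \<in> carrier_mat m m"
    and "\<And>i e. i < m \<Longrightarrow> e < m \<Longrightarrow> the (mat_inverse A) $$ (i, e) = cofactor A e i / Determinant.det A"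
    and "\<And>i e. i < m \<Longrightarrow> e < m \<Longrightarrow>
           (\<Sum>l<m. a i l * (cofactor A e l / Determinant.det A)) = (if i = e then 1 else 0)"
proof -
  have A: "A \<in> carrier_mat m m"
    by (simp add: A_def)
  show d: "Determinant.det A \<noteq> 0"
  proof
    assume "Determinant.det A = 0"
    then obtain v where v: "v \<in> carrier_vec m" "v \<noteq> 0\<^sub>v m" "A *\<^sub>v v = 0\<^sub>v m"
      using det_0_iff_vec_prod_zero_field[OF A] by auto
    have "(\<Sum>l<m. a i l * vec_index v l) = 0" if "i < m" for i
    proof -
      have "vec_index (A *\<^sub>v v) i = (\<Sum>l<m. a i l * vec_index v l)"
        using that v(1) by (simp add: A_def scalar_prod_def atLeast0LessThan)
      then show ?thesis
        using v(3) that by simp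
    qed
    then have "vec_index v i = 0" if "i < m" for i
      using ker that by blast
    then have "v = 0\<^sub>v m"
      using v(1) by (intro eq_vecI) auto
    then show False
      using v(2) by simp
  qed
  \<comment> \<open>\<open>mat_inverse\<close> runs Gauss-Jordan elimination, which hides how the
    entries depend on the matrix. Uniqueness of the inverse identifies its result with the
    normalized adjugate.\<close>
  define B where "B = (1 / Determinant.det A) \<cdot>\<^sub>m adj_mat A"
  have B: "B \<in> carrier_mat m m"
    using adj_mat(1)[OF A] by (simp add: B_def)
  have dd: "(1 / Determinant.det A) \<cdot>\<^sub>m (Determinant.det A \<cdot>\<^sub>m 1\<^sub>m m) = 1\<^sub>m m"
    using d by (intro eq_matI) auto
  have AB: "A * B = 1\<^sub>m m"
    using adj_mat[OF A] d by (simp add: B_def mult_smult_distrib[OF A] dd)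
  have BA: "B * A = 1\<^sub>m m"
    using adj_mat[OF A] d by (simp add: B_def mult_smult_assoc_mat[OF _ A] dd)
  have "A \<in> Units (ring_mat TYPE('a) m ())"
    using A B AB BA by (auto simp: Units_def ring_mat_def)
  then obtain C where C: "mat_inverse A = Some C"
    using mat_inverse(1)[OF A] by fastforce
  have C': "A * C = 1\<^sub>m m" "C * A = 1\<^sub>m m" "C \<in> carrier_mat m m"
    using mat_inverse(2)[OF A C] by auto
  have "C = C * (A * B)"
    using C' AB by simp
  also have "\<dots> = (C * A) * B"
    using assoc_mult_mat[OF C'(3) A B] by simp
  also have "\<dots> = B"
    using C' B by simp
  finally have CB: "C = B" .
  show "the (mat_inverse A) \<in> carrier_mat m m"
    using C C' by simp
  have Bent: "B $$ (i, e) = cofactor A e i / Determinant.det A" if "i < m" "e < m" for i e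
    using that A by (simp add: B_def adj_mat_def)
  then show "the (mat_inverse A) $$ (i, e) = cofactor A e i / Determinant.det A"
    if "i < m" "e < m" for i e
    using that C CB by simp
  show "(\<Sum>l<m. a i l * (cofactor A e l / Determinant.det A)) = (if i = e then 1 else 0)"
    if "i < m" "e < m" for i e
  proof -
    have "(A * B) $$ (i, e) = (\<Sum>l<m. a i l * B $$ (l, e))"
      using that A B by (simp add: A_def scalar_prod_def atLeast0LessThan)
    also have "\<dots> = (\<Sum>l<m. a i l * (cofactor A e l / Determinant.det A))"
      using that by (intro sum.cong) (auto simp: Bent)
    finally show ?thesis
      using that AB by simp
  qed
qed

text \<open>
  A matrix with \<open>m\<close> rows and \<open>q\<close> columns is a function of two indices, read only at \<open>i < m\<close> and \<open>j < q\<close>.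
  \<open>gram_op k x m q X\<close> is the action of \<open>k X X\<^sup>T + x I\<close> on vectors and \<open>green k x m q X\<close> is its inverse.
  Deleting a column is zeroing it, which leaves \<open>X X\<^sup>T\<close> of the same size.
\<close>

definition gram_op :: "real \<Rightarrow> real \<Rightarrow> nat \<Rightarrow> nat \<Rightarrow> (nat \<Rightarrow> nat \<Rightarrow> real) \<Rightarrow> (nat \<Rightarrow> real) \<Rightarrow> nat \<Rightarrow> real" where
  "gram_op k x m q X v i = k * (\<Sum>j<q. X i j * (\<Sum>l<m. X l j * v l)) + x * v i"

definition shifted_gram :: "real \<Rightarrow> real \<Rightarrow> nat \<Rightarrow> nat \<Rightarrow> (nat \<Rightarrow> nat \<Rightarrow> real) \<Rightarrow> real mat" where
  "shifted_gram k x m q X =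
     Matrix.mat m m (\<lambda>(i, l). k * (\<Sum>j<q. X i j * X l j) + (if i = l then x else 0))"

definition green :: "real \<Rightarrow> real \<Rightarrow> nat \<Rightarrow> nat \<Rightarrow> (nat \<Rightarrow> nat \<Rightarrow> real) \<Rightarrow> nat \<Rightarrow> nat \<Rightarrow> real" where
  "green k x m q X i e = cofactor (shifted_gram k x m q X) e i / Determinant.det (shifted_gram k x m q X)"

definition zero_col :: "nat \<Rightarrow> (nat \<Rightarrow> nat \<Rightarrow> real) \<Rightarrow> nat \<Rightarrow> nat \<Rightarrow> real" where
  "zero_col j0 X = (\<lambda>i j. if j = j0 then 0 else X i j)"

section \<open>The positive definite operator \<open>k X X^T + x I\<close>\<close>

lemma gram_op_eq_sum:
  assumes "i < m"
  shows "gram_op k x m q X v i =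
    (\<Sum>l<m. (k * (\<Sum>j<q. X i j * X l j) + (if i = l then x else 0)) * v l)"
proof -
  have "(\<Sum>l<m. (if i = l then x else 0) * v l) = x * v i"
    using assms by (simp add: if_distrib[of "\<lambda>y. y * _"] cong: if_cong)
  moreover have "(\<Sum>l<m. k * (\<Sum>j<q. X i j * X l j) * v l) = k * (\<Sum>j<q. X i j * (\<Sum>l<m. X l j * v l))"
    by (simp add: sum_distrib_left sum_distrib_right mult_ac) (rule sum.swap)
  ultimately show ?thesis
    by (simp add: gram_op_def ring_distribs sum.distrib)
qed

lemma sum_mult_adjoint:
  fixes u c :: "nat \<Rightarrow> real"
  shows "(\<Sum>i<m. u i * (\<Sum>j<q. X i j * c j)) = (\<Sum>j<q. (\<Sum>i<m. X i j * u i) * c j)"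
  by (simp add: sum_distrib_left sum_distrib_right mult_ac) (rule sum.swap)

text \<open>Moving \<open>X\<close> to the other side of the inner product gives the bilinear form
  \<open>k <X^T u, X^T v> + x <u, v>\<close>, from which symmetry and coercivity are read
  off.\<close>

lemma gram_op_form:
  "(\<Sum>i<m. u i * gram_op k x m q X v i) =
     k * (\<Sum>j<q. (\<Sum>l<m. X l j * u l) * (\<Sum>l<m. X l j * v l)) + x * (\<Sum>i<m. u i * v i)"
proof -
  have "(\<Sum>i<m. u i * (\<Sum>j<q. X i j * (\<Sum>l<m. X l j * v l))) =
      (\<Sum>j<q. (\<Sum>l<m. X l j * u l) * (\<Sum>l<m. X l j * v l))"
    by (rule sum_mult_adjoint)
  moreover have "(\<Sum>i<m. u i * gram_op k x m q X v i) =
      k * (\<Sum>i<m. u i * (\<Sum>j<q. X i j * (\<Sum>l<m. X l j * v l))) + x * (\<Sum>i<m. u i * v i)"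
    by (simp add: gram_op_def ring_distribs sum.distrib) (simp add: sum_distrib_left mult_ac)
  ultimately show ?thesis
    by simp
qed

lemma gram_op_sym:
  "(\<Sum>i<m. u i * gram_op k x m q X v i) = (\<Sum>i<m. v i * gram_op k x m q X u i)"
  unfolding gram_op_form by (simp add: mult.commute)

lemma gram_op_coercive:
  assumes "k \<ge> 0"
  shows "x * (\<Sum>i<m. (v i)\<^sup>2) \<le> (\<Sum>i<m. v i * gram_op k x m q X v i)"
  unfolding gram_op_form using assms
  by (simp add: power2_eq_square sum_nonneg)

lemma gram_op_diff: "gram_op k x m q X (\<lambda>l. v l - w l) i = gram_op k x m q X v i - gram_op k x m q X w i"
  by (simp add: gram_op_def ring_distribs sum_subtractf)

lemma gram_op_add: "gram_op k x m q X (\<lambda>l. v l + w l) i = gram_op k x m q X v i + gram_op k x m q X w i"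
  by (simp add: gram_op_def ring_distribs sum.distrib)

lemma gram_op_scale: "gram_op k x m q X (\<lambda>l. c * v l) i = c * gram_op k x m q X v i"
  by (simp add: gram_op_def ring_distribs sum_distrib_left mult_ac)

text \<open>Coercivity at \<open>v - w\<close>. Identities for resolvents are obtained from it by
  checking that two vectors have the same image.\<close>

lemma gram_op_inj:
  assumes "k \<ge> 0" "x > 0" and eq: "\<And>i. i < m \<Longrightarrow> gram_op k x m q X v i = gram_op k x m q X w i" and "i < m"
  shows "v i = w i"
proof -
  have "x * (\<Sum>i<m. (v i - w i)\<^sup>2) \<le> (\<Sum>i<m. (v i - w i) * gram_op k x m q X (\<lambda>l. v l - w l) i)"
    by (rule gram_op_coercive) fact
  also have "\<dots> = 0"
    by (intro sum.neutral) (auto simp: gram_op_diff eq)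
  finally have "(\<Sum>i<m. (v i - w i)\<^sup>2) \<le> 0"
    using \<open>x > 0\<close> by (simp add: mult_le_0_iff)
  then have "(\<Sum>i<m. (v i - w i)\<^sup>2) = 0"
    by (intro antisym sum_nonneg) auto
  then have "(v i - w i)\<^sup>2 = 0"
    using \<open>i < m\<close> by (subst (asm) sum_nonneg_eq_0_iff) auto
  then show ?thesis
    by simp
qed

section \<open>Entries and quadratic forms of the inverse\<close>

context
  fixes k x :: real
  assumes k: "k \<ge> 0" and x: "x > 0"
begin

lemma green_rop:
  assumes "i < m" "e < m"
  shows "gram_op k x m q X (\<lambda>l. green k x m q X l e) i = (if i = e then 1 else 0)"
proof -
  have "v i = 0" if *: "\<forall>i<m. (\<Sum>l<m. (k * (\<Sum>j<q. X i j * X l j) + (if i = l then x else 0)) * v l) = 0" and "i < m" for v i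
  proof (rule gram_op_inj[OF k x _ that(2)])
    show "gram_op k x m q X v i = gram_op k x m q X (\<lambda>_. 0) i" if "i < m" for i
      using * that gram_op_eq_sum[OF that, of k x q X v] by (simp add: gram_op_def)
  qed
  from inverse_by_cofactors(4)[of m "\<lambda>i l. k * (\<Sum>j<q. X i j * X l j) + (if i = l then x else 0)",
      OF _ assms, folded shifted_gram_def] this
  show ?thesis
    using assms by (simp add: gram_op_eq_sum green_def)
qed

text \<open>The device behind Schur's formula and the rank-one update: guess a vector, compute its
  image, and recognize a multiple of a column of the inverse.\<close>

lemma green_unique:
  assumes "\<And>i. i < m \<Longrightarrow> gram_op k x m q X v i = (if i = e then c else 0)" "e < m" "l < m"
  shows "v l = c * green k x m q X l e"
  by (rule gram_op_inj[OF k x _ assms(3), where q = q and X = X]) (use assms(1,2) in \<open>simp add: gram_op_scale green_rop\<close>)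

lemma sum_green_rop:
  assumes "e < m"
  shows "(\<Sum>i<m. v i * gram_op k x m q X (\<lambda>l. green k x m q X l e) i) = v e"
proof -
  have "(\<Sum>i<m. v i * gram_op k x m q X (\<lambda>l. green k x m q X l e) i) = (\<Sum>i<m. if i = e then v i else 0)"
    by (intro sum.cong refl) (use assms in \<open>auto simp: green_rop\<close>)
  then show ?thesis
    using assms by simp
qed

lemma green_sym:
  assumes "e < m" "l < m"
  shows "green k x m q X l e = green k x m q X e l"
  using gram_op_sym[where m = m and k = k and x = x and q = q and X = X and u = "\<lambda>i. green k x m q X i e" and v = "\<lambda>i. green k x m q X i l"] assms
  by (simp add: sum_green_rop)

text \<open>Coercivity at column \<open>e\<close> of the inverse, where the quadratic form collapses
  to the diagonal entry. The bounds on entries and columns both come from this inequality.\<close>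

lemma green_col:
  assumes "e < m"
  shows "x * (\<Sum>l<m. (green k x m q X l e)\<^sup>2) \<le> green k x m q X e e"
  using gram_op_coercive[OF k, where x = x and m = m and q = q and X = X and v = "\<lambda>l. green k x m q X l e"] assms by (simp add: sum_green_rop)

lemma green_diag_bounds:
  assumes "e < m"
  shows "0 \<le> green k x m q X e e" "green k x m q X e e \<le> 1 / x"
    "(\<Sum>l<m. (green k x m q X l e)\<^sup>2) \<le> 1 / x\<^sup>2"
proof -
  let ?g = "green k x m q X e e"
  have "0 \<le> x * (\<Sum>l<m. (green k x m q X l e)\<^sup>2)"
    using x by (intro mult_nonneg_nonneg sum_nonneg) auto
  then show "0 \<le> ?g"
    using green_col[OF assms] by (rule order_trans)
  \<comment> \<open>Self-improvement: the diagonal entry is one term of its column norm, so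
    \<open>x g^2 \<le> g\<close> and \<open>g \<le> 1/x\<close>; inserted back into
    \<open>green_col\<close>, this bounds the whole column.\<close>
  have "?g\<^sup>2 \<le> (\<Sum>l<m. (green k x m q X l e)\<^sup>2)"
    using assms by (intro member_le_sum) auto
  then have "x * ?g\<^sup>2 \<le> ?g"
    using green_col[OF assms, of q X] x by (smt (verit) mult_left_mono)
  then show b: "?g \<le> 1 / x"
    using x \<open>0 \<le> ?g\<close> by (cases "?g = 0") (auto simp: power2_eq_square field_simps)
  have "x * (\<Sum>l<m. (green k x m q X l e)\<^sup>2) \<le> 1 / x"
    using green_col[OF assms] b by (rule order_trans)
  then show "(\<Sum>l<m. (green k x m q X l e)\<^sup>2) \<le> 1 / x\<^sup>2"
    using x by (simp add: field_simps power2_eq_square)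
qed

text \<open>\<open>X X^T\<close> is the sum of the outer products of its columns, so zeroing one
  column subtracts a single rank-one term.\<close>

lemma gram_op_zero_col:
  assumes "j0 < q"
  shows "gram_op k x m q X v i =
    gram_op k x m q (zero_col j0 X) v i + k * (X i j0 * (\<Sum>l<m. X l j0 * v l))"
proof -
  have "(\<Sum>j<q. X i j * (\<Sum>l<m. X l j * v l)) =
      (\<Sum>j<q. zero_col j0 X i j * (\<Sum>l<m. zero_col j0 X l j * v l) +
         (if j = j0 then X i j0 * (\<Sum>l<m. X l j0 * v l) else 0))"
    by (intro sum.cong refl) (auto simp: zero_col_def)
  also have "\<dots> = (\<Sum>j<q. zero_col j0 X i j * (\<Sum>l<m. zero_col j0 X l j * v l)) +
      X i j0 * (\<Sum>l<m. X l j0 * v l)"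
    using assms by (simp add: sum.distrib)
  finally show ?thesis
    by (simp add: gram_op_def ring_distribs)
qed

lemma gram_op_green_apply:
  assumes "i < m"
  shows "gram_op k x m q X (\<lambda>i. \<Sum>l<m. a l * green k x m q X i l) i = a i"
proof -
  have "gram_op k x m q X (\<lambda>i. \<Sum>l<m. a l * green k x m q X i l) i =
      (\<Sum>l<m. a l * gram_op k x m q X (\<lambda>i. green k x m q X i l) i)"
    unfolding gram_op_eq_sum[OF assms]
    by (simp only: sum_distrib_left) (subst sum.swap, simp add: mult_ac)
  also have "\<dots> = (\<Sum>l<m. if i = l then a l else 0)"
    by (intro sum.cong refl) (use assms in \<open>auto simp: green_rop\<close>)
  finally show ?thesis
    using assms by simp
qed

text \<open>Coercivity at \<open>v = G a\<close>, with \<open>G\<close> the inverse: the form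
  becomes \<open>a^T G a\<close>. Thus \<open>|G a|^2\<close> is controlled by
  \<open>a^T G a / x\<close>, which is what makes the rank-one bound independent of the size of
  column \<open>j0\<close>.\<close>

lemma green_form_coercive:
  "x * (\<Sum>i<m. (\<Sum>l<m. a l * green k x m q X i l)\<^sup>2) \<le> (\<Sum>i<m. \<Sum>l<m. a i * a l * green k x m q X i l)"
proof -
  have "(\<Sum>i<m. (\<Sum>l<m. a l * green k x m q X i l) * gram_op k x m q X (\<lambda>i. \<Sum>l<m. a l * green k x m q X i l) i)
      = (\<Sum>i<m. \<Sum>l<m. a i * a l * green k x m q X i l)"
    by (intro sum.cong refl) (simp add: gram_op_green_apply sum_distrib_right sum_distrib_left mult_ac)
  then show ?thesis
    using gram_op_coercive[OF k, where x = x and m = m and q = q and X = X and v = "\<lambda>i. \<Sum>l<m. a l * green k x m q X i l"] by simp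
qed

lemma green_form_nonneg: "0 \<le> (\<Sum>i<m. \<Sum>l<m. a i * a l * green k x m q X i l)"
  by (rule order_trans[OF _ green_form_coercive]) (use x in \<open>auto intro!: mult_nonneg_nonneg sum_nonneg\<close>)

text \<open>
  With \<open>b\<close> the resolvent of the matrix without column \<open>j0\<close> applied to column \<open>j0\<close>, the vector
  \<open>e\<^sub>j - k X\<^sub>0\<^sup>T b\<close> is an explicit multiple of column \<open>j0\<close> of the co-resolvent.
\<close>

lemma green_transpose_diag:
  assumes j0: "j0 < q"
  shows "green k x q m (\<lambda>j i. X i j) j0 j0 =
    1 / (x * (1 + k * (\<Sum>i<m. \<Sum>l<m. X i j0 * X l j0 * green k x m q (zero_col j0 X) i l)))"
proof -
  define b where "b i = (\<Sum>l<m. X l j0 * green k x m q (zero_col j0 X) i l)" for i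
  define s where "s = k * (\<Sum>i<m. \<Sum>l<m. X i j0 * X l j0 * green k x m q (zero_col j0 X) i l)"
  define v where "v j = (if j = j0 then 1 else 0) - k * (\<Sum>l<m. zero_col j0 X l j * b l)" for j
  have s0: "s \<ge> 0"
    unfolding s_def using k by (intro mult_nonneg_nonneg green_form_nonneg)
  have sb: "s = k * (\<Sum>i<m. X i j0 * b i)"
    by (simp add: s_def b_def sum_distrib_left mult_ac)
  \<comment> \<open>Column \<open>j0\<close> of \<open>X\<close> meets the unit vector alone, since
    that column of \<open>X_0\<close> is zero. What remains is \<open>X_j0 - k X_0 X_0^T b\<close>,
    and this is \<open>x b\<close> by the equation that defines \<open>b\<close>.\<close>
  have Xv: "(\<Sum>j<q. X i j * v j) = x * b i" if "i < m" for i
  proof -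
    have "(\<Sum>j<q. X i j * v j) = X i j0 - k * (\<Sum>j<q. X i j * (\<Sum>l<m. zero_col j0 X l j * b l))"
      using j0 by (simp add: v_def ring_distribs sum_subtractf if_distrib[of "\<lambda>y. _ * y"] sum_distrib_left
          mult_ac cong: if_cong)
    also have "(\<Sum>j<q. X i j * (\<Sum>l<m. zero_col j0 X l j * b l)) =
        (\<Sum>j<q. zero_col j0 X i j * (\<Sum>l<m. zero_col j0 X l j * b l))"
      by (intro sum.cong) (auto simp: zero_col_def)
    also have "k * \<dots> = gram_op k x m q (zero_col j0 X) b i - x * b i"
      by (simp add: gram_op_def)
    also have "gram_op k x m q (zero_col j0 X) b i = X i j0"
      unfolding b_def using gram_op_green_apply[OF that] by simp
    finally show ?thesis by simp
  qed
  \<comment> \<open>After substituting \<open>X v = x b\<close>, the terms with \<open>X\<close> and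
    \<open>X_0\<close> cancel in every column except \<open>j0\<close>, which retains
    \<open>x (1 + s)\<close>.\<close>
  have "gram_op k x q m (\<lambda>j i. X i j) v j = (if j = j0 then x * (1 + s) else 0)" if "j < q" for j
  proof -
    have "gram_op k x q m (\<lambda>j i. X i j) v j = k * (\<Sum>i<m. X i j * (x * b i)) + x * v j"
      by (simp add: gram_op_def Xv)
    also have "\<dots> = x * ((if j = j0 then 1 else 0) +
        k * ((\<Sum>i<m. X i j * b i) - (\<Sum>l<m. zero_col j0 X l j * b l)))"
      by (simp add: v_def ring_distribs sum_distrib_left mult_ac)
    also have "\<dots> = (if j = j0 then x * (1 + s) else 0)"
      by (simp add: zero_col_def sb)
    finally show ?thesis .
  qed
  from green_unique[OF this j0 j0]
  have "v j0 = x * (1 + s) * green k x q m (\<lambda>j i. X i j) j0 j0" .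
  moreover have "v j0 = 1"
    by (simp add: v_def zero_col_def)
  ultimately show ?thesis
    using x s0 unfolding s_def[symmetric] by (simp add: field_simps add_nonneg_eq_0_iff)
qed

text \<open>By the Sherman-Morrison formula the inverses differ by \<open>k b b^T / (1 + s)\<close>,
  where \<open>b = G X_j0\<close> and \<open>s = k X_j0^T b\<close>. Since
  \<open>k |b|^2 \<le> s / x\<close> and \<open>s / (1 + s) \<le> 1\<close>, the weighted trace
  moves by at most \<open>K / x\<close>, whatever the column and the dimension.\<close>

lemma green_zero_col_diff:
  assumes j0: "j0 < q" and K: "K \<ge> 0" and u: "\<And>i. i < m \<Longrightarrow> \<bar>u i\<bar> \<le> K"
  shows "\<bar>(\<Sum>i<m. u i * green k x m q (zero_col j0 X) i i) - (\<Sum>i<m. u i * green k x m q X i i)\<bar> \<le> K / x"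
proof -
  define G where "G = green k x m q (zero_col j0 X)"
  define b where "b i = (\<Sum>l<m. X l j0 * G i l)" for i
  define s where "s = k * (\<Sum>i<m. \<Sum>l<m. X i j0 * X l j0 * G i l)"
  have s0: "s \<ge> 0"
    unfolding s_def G_def using k by (intro mult_nonneg_nonneg green_form_nonneg)
  have sb: "s = k * (\<Sum>i<m. X i j0 * b i)"
    by (simp add: s_def b_def sum_distrib_left mult_ac)
  have diag: "green k x m q X e e = G e e - k * (b e)\<^sup>2 / (1 + s)" if e: "e < m" for e
  proof -
    have bG: "(\<Sum>l<m. X l j0 * G l e) = b e"
      unfolding b_def by (intro sum.cong refl) (use green_sym[OF _ e] in \<open>simp add: G_def\<close>)
    \<comment> \<open>The candidate for column \<open>e\<close> of the updated inverse, taken from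
      the Sherman-Morrison formula.\<close>
    define v where "v l = G l e + (- (k * b e / (1 + s))) * b l" for l
    have "gram_op k x m q X v i = (if i = e then 1 else 0)" if "i < m" for i
    proof -
      have "gram_op k x m q (zero_col j0 X) v i = (if i = e then 1 else 0) - k * b e / (1 + s) * X i j0"
        unfolding v_def gram_op_add gram_op_scale G_def b_def
        using gram_op_green_apply[OF that, of q "zero_col j0 X" "\<lambda>l. X l j0"] that e by (simp add: green_rop)
      moreover have "(\<Sum>l<m. X l j0 * v l) = (\<Sum>l<m. X l j0 * G l e) - k * b e / (1 + s) * (\<Sum>l<m. X l j0 * b l)"
        by (simp add: v_def ring_distribs sum_subtractf sum_distrib_left mult_ac)
      ultimately have "gram_op k x m q X v i = (if i = e then 1 else 0) - k * b e / (1 + s) * X i j0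
          + k * (X i j0 * (b e - b e / (1 + s) * s))"
        using sb by (simp add: gram_op_zero_col[OF j0, where X = X] bG divide_simps)
      then have "gram_op k x m q X v i = (if i = e then 1 else 0)
          + k * X i j0 * b e * (1 - 1 / (1 + s) - s / (1 + s))"
        by (simp add: algebra_simps)
      moreover have "1 - 1 / (1 + s) - s / (1 + s) = 0"
        using s0 by (simp add: field_simps)
      ultimately show ?thesis
        by simp
    qed
    from green_unique[OF this e e] show ?thesis
      by (simp add: v_def power2_eq_square)
  qed
  have "\<bar>(\<Sum>i<m. u i * G i i) - (\<Sum>i<m. u i * green k x m q X i i)\<bar> = \<bar>\<Sum>i<m. u i * (k * (b i)\<^sup>2 / (1 + s))\<bar>"
    by (simp add: sum_subtractf[symmetric] diag ring_distribs)
  also have "\<dots> \<le> (\<Sum>i<m. K * (k * (b i)\<^sup>2 / (1 + s)))"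
    by (intro order_trans[OF sum_abs] sum_mono)
       (use u k s0 in \<open>auto simp: abs_mult intro!: mult_right_mono divide_right_mono\<close>)
  also have "\<dots> = K * (k / (1 + s)) * (\<Sum>i<m. (b i)\<^sup>2)"
    by (simp add: sum_distrib_left mult_ac)
  also have "\<dots> \<le> K * (k / (1 + s)) * ((\<Sum>i<m. \<Sum>l<m. X i j0 * X l j0 * G i l) / x)"
    using green_form_coercive[where m = m and a = "\<lambda>l. X l j0" and q = q and X = "zero_col j0 X"] K k s0 x
    by (intro mult_left_mono) (auto simp: b_def G_def field_simps)
  also have "\<dots> = K / x * (s / (1 + s))"
    by (simp add: s_def mult_ac)
  also have "\<dots> \<le> K / x * 1"
    using s0 K x by (intro mult_left_mono) (auto simp: field_simps)
  finally show ?thesis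
    by (simp add: G_def)
qed

end

section \<open>Resolvents and Stieltjes transforms off the half-line\<close>

abbreviation slit :: "complex set" where
  "slit \<equiv> - \<real>\<^sub>\<ge>\<^sub>0"

lemma open_slit: "open slit"
  by (simp add: open_Compl closed_nonneg_Reals_complex)

lemma connected_slit: "connected slit"
proof -
  have "slit = - complex_of_real ` {0..}"
    by (auto simp: nonneg_Reals_def)
  then show ?thesis
    using starlike_slotted_complex_plane_right[of 0] starlike_imp_connected by metis
qed

lemma minus_of_real_in_slit: "x > 0 \<Longrightarrow> - complex_of_real x \<in> slit"
  by (auto simp: complex_nonneg_Reals_iff)

lemma infdist_slit_pos: "w \<in> slit \<Longrightarrow> 0 < infdist w \<real>\<^sub>\<ge>\<^sub>0"
  by (rule infdist_pos_not_in_closed[OF closed_nonneg_Reals_complex]) (auto simp: nonneg_Reals_def)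

lemma infdist_le_cmod_diff:
  assumes "t \<ge> 0"
  shows "infdist w \<real>\<^sub>\<ge>\<^sub>0 \<le> cmod (complex_of_real t - w)"
  using infdist_le[of "complex_of_real t" "\<real>\<^sub>\<ge>\<^sub>0" w] assms by (simp add: dist_norm norm_minus_commute)

text \<open>The distance bound in homogeneous form, to be used with \<open>r = <v, S v>\<close> and
  \<open>t = |v|^2\<close> for a positive semidefinite \<open>S\<close>; no division by
  \<open>t\<close> is left for the caller.\<close>

lemma infdist_mult_le_cmod_diff:
  assumes "r \<ge> 0" "t \<ge> 0"
  shows "infdist w \<real>\<^sub>\<ge>\<^sub>0 * t \<le> cmod (complex_of_real r - w * complex_of_real t)"
proof (cases "t = 0")
  case False
  then have "complex_of_real r - w * complex_of_real t = complex_of_real t * (complex_of_real (r / t) - w)"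
    by (simp add: field_simps)
  then have "cmod (complex_of_real r - w * complex_of_real t) = t * cmod (complex_of_real (r / t) - w)"
    using assms by (simp add: norm_mult del: of_real_divide)
  then show ?thesis
    using infdist_le_cmod_diff[of "r / t" w] assms by (simp add: mult.commute mult_left_mono)
qed simp

text \<open>Every subsequence has, by Montel, a locally uniformly convergent further subsequence.
  Its limit vanishes on \<open>U\<close>, hence on the connected set \<open>S\<close>, and locally
  uniform convergence carries over to derivatives.\<close>

lemma vitali:
  assumes S: "open S" "connected S"
    and hol: "\<And>n. f n holomorphic_on S"
    and bdd: "\<And>K. compact K \<Longrightarrow> K \<subseteq> S \<Longrightarrow> \<exists>B. \<forall>n. \<forall>w\<in>K. cmod (f n w) \<le> B"
    and U: "U \<subseteq> S" "\<xi> \<in> S" "\<xi> islimpt U" "\<And>u. u \<in> U \<Longrightarrow> (\<lambda>n. f n u) \<longlonglongrightarrow> 0"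
    and z: "z \<in> S"
  shows "(\<lambda>n. f n z) \<longlonglongrightarrow> 0" and "(\<lambda>n. deriv (f n) z) \<longlonglongrightarrow> 0"
proof -
  \<comment> \<open>Adding the two moduli lets one subsequence argument settle values and
    derivatives together.\<close>
  define h where "h n = cmod (f n z) + cmod (deriv (f n) z)" for n
  have "h \<longlonglongrightarrow> 0"
  proof (rule ccontr)
    assume "\<not> h \<longlonglongrightarrow> 0"
    then obtain e where e: "e > 0" "\<not> (\<forall>\<^sub>F n in sequentially. dist (h n) 0 < e)"
      by (auto simp: tendsto_iff)
    then obtain r :: "nat \<Rightarrow> nat" where r: "strict_mono r" "\<And>n. \<not> dist (h (r n)) 0 < e"
      using not_eventually_sequentiallyD by blast
    have *: "\<exists>B. \<forall>h\<in>range (\<lambda>n. f (r n)). \<forall>w\<in>K. cmod (h w) \<le> B" if "compact K" "K \<subseteq> S" for K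
      using bdd[OF that] by auto
    obtain g s where g: "g holomorphic_on S" and s: "strict_mono (s :: nat \<Rightarrow> nat)"
      and lim: "\<And>w. w \<in> S \<Longrightarrow> (\<lambda>n. f (r (s n)) w) \<longlonglongrightarrow> g w"
      and unif: "\<And>K. \<lbrakk>compact K; K \<subseteq> S\<rbrakk> \<Longrightarrow> uniform_limit K ((\<lambda>n. f (r n)) \<circ> s) g sequentially"
      by (rule Montel[of S "range (\<lambda>n. f (r n))" "\<lambda>n. f (r n)"]) (use S(1) hol * in auto)
    have rs: "filterlim (\<lambda>n. r (s n)) at_top sequentially"
      using filterlim_compose[OF filterlim_subseq[OF r(1)] filterlim_subseq[OF s]] .
    have gU: "g u = 0" if "u \<in> U" for u
      using LIMSEQ_unique[OF lim filterlim_compose[OF U(4) rs]] that U(1) by blast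
    then have g0: "g w = 0" if "w \<in> S" for w
      by (rule analytic_continuation[OF g S U(1-3) _ that]) (auto intro: gU)
    have "\<exists>d>0. cball w d \<subseteq> S \<and> uniform_limit (cball w d) (\<lambda>n. f (r (s n))) g sequentially" if "w \<in> S" for w
    proof -
      obtain d where "d > 0" "cball w d \<subseteq> S"
        using S(1) \<open>w \<in> S\<close> unfolding open_contains_cball by meson
      then show ?thesis
        using unif[of "cball w d"] by (auto simp: o_def)
    qed
    from has_complex_derivative_uniform_sequence[OF S(1) holomorphic_derivI[OF hol S(1)] this]
    obtain g' where g': "\<And>w. w \<in> S \<Longrightarrow> (g has_field_derivative g' w) (at w)"
        "\<And>w. w \<in> S \<Longrightarrow> (\<lambda>n. deriv (f (r (s n))) w) \<longlonglongrightarrow> g' w"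
      by auto
    have "(g has_field_derivative 0) (at z)"
      by (rule has_field_derivative_transform_within_open[of "\<lambda>_. 0", OF _ S(1) z]) (auto simp: g0)
    then have "g' z = 0"
      using g'(1)[OF z] DERIV_unique by blast
    then have "(\<lambda>n. h (r (s n))) \<longlonglongrightarrow> 0"
      unfolding h_def using lim[OF z] g'(2)[OF z] g0[OF z] by (auto intro!: tendsto_eq_intros)
    then have "\<forall>\<^sub>F n in sequentially. dist (h (r (s n))) 0 < e"
      using e(1) by (auto simp: tendsto_iff)
    then show False
      using r(2) by simp
  qed
  then show "(\<lambda>n. f n z) \<longlonglongrightarrow> 0" "(\<lambda>n. deriv (f n) z) \<longlonglongrightarrow> 0"
    unfolding h_def by (auto intro: Lim_null_comparison[rotated])
qed

text \<open>Gives the deterministic entries the same holomorphy and the same bound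
  \<open>1 / infdist\<close> as the resolvent entries, and real nonnegative values at negative
  reals, so that the comparison can take place there.\<close>

lemma stieltjes_class_props:
  assumes "stieltjes_class f"
  shows "f holomorphic_on slit"
    and "w \<in> slit \<Longrightarrow> cmod (f w) \<le> 1 / infdist w \<real>\<^sub>\<ge>\<^sub>0"
    and "x > 0 \<Longrightarrow> \<exists>\<tau>\<ge>0. f (- complex_of_real x) = complex_of_real \<tau>"
proof -
  obtain \<mu> :: "real measure" where \<mu>: "prob_space \<mu>" and sets [measurable_cong]: "sets \<mu> = sets borel"
    and m: "measure \<mu> {0..} = 1"
    and f: "\<And>w. w \<in> slit \<Longrightarrow> f w = (\<integral>t. 1 / (complex_of_real t - w) \<partial>\<mu>)"
    using assms by (auto simp: stieltjes_class_def)
  interpret prob_space \<mu> by fact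
  have AE: "AE t in \<mu>. t \<ge> 0"
    using AE_prob_1[of "{0..}"] m by auto
  have bound: "cmod (1 / (complex_of_real t - w) ^ j) \<le> 1 / infdist w \<real>\<^sub>\<ge>\<^sub>0 ^ j"
    if "t \<ge> 0" "w \<in> slit" for t w j
  proof -
    have "infdist w \<real>\<^sub>\<ge>\<^sub>0 ^ j \<le> cmod (complex_of_real t - w) ^ j"
      using infdist_le_cmod_diff[OF that(1), of w] infdist_nonneg by (rule power_mono)
    moreover have "0 < infdist w \<real>\<^sub>\<ge>\<^sub>0 ^ j"
      using infdist_slit_pos[OF that(2)] by (rule zero_less_power)
    ultimately show ?thesis
      by (simp add: norm_divide norm_power frac_le)
  qed
  have int: "integrable \<mu> (\<lambda>t. 1 / (complex_of_real t - w) ^ j)" if "w \<in> slit" for w j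
    by (rule integrable_const_bound[where B = "1 / infdist w \<real>\<^sub>\<ge>\<^sub>0 ^ j"])
       (use AE bound that in auto)
  show "cmod (f w) \<le> 1 / infdist w \<real>\<^sub>\<ge>\<^sub>0" if "w \<in> slit" for w
  proof -
    have "cmod (f w) \<le> (\<integral>t. 1 / infdist w \<real>\<^sub>\<ge>\<^sub>0 \<partial>\<mu>)"
      unfolding f[OF that] using AE bound[of _ w 1] that int[of w 1]
      by (intro integral_norm_bound_integral[THEN order_trans[rotated]] order_refl integral_norm_bound[THEN order_trans] integral_mono_AE) auto
    then show ?thesis
      by (simp add: prob_space)
  qed
  show "\<exists>\<tau>\<ge>0. f (- complex_of_real x) = complex_of_real \<tau>" if "x > 0"
  proof -
    have "- complex_of_real x \<in> slit"
      using that by (auto simp: nonneg_Reals_def)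
    then have "f (- complex_of_real x) = (\<integral>t. complex_of_real (1 / (t + x)) \<partial>\<mu>)"
      by (simp add: f)
    also have "\<dots> = complex_of_real (\<integral>t. 1 / (t + x) \<partial>\<mu>)"
      by (rule integral_complex_of_real)
    finally have "f (- complex_of_real x) = complex_of_real (\<integral>t. 1 / (t + x) \<partial>\<mu>)" .
    moreover have "0 \<le> (\<integral>t. 1 / (t + x) \<partial>\<mu>)"
      using AE that by (intro integral_nonneg_AE) auto
    ultimately show ?thesis
      by blast
  qed
  have "(f has_field_derivative (\<integral>t. 1 / (complex_of_real t - w0)\<^sup>2 \<partial>\<mu>)) (at w0)"
    if w0: "w0 \<in> slit" for w0
  proof -
    define d where "d = infdist w0 \<real>\<^sub>\<ge>\<^sub>0"
    have d: "d > 0"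
      using infdist_slit_pos[OF w0] by (simp add: d_def)
    \<comment> \<open>Differentiation under the integral with an explicit remainder: the integrand's
      error is \<open>(w - w0)^2 / ((t - w) (t - w0)^2)\<close>, and for \<open>w\<close> within
      \<open>d / 2\<close> of \<open>w0\<close> the denominator is at least
      \<open>d^3 / 2\<close>.\<close>
    have ev: "\<forall>\<^sub>F w in at w0. cmod ((f w - f w0) / (w - w0) - (\<integral>t. 1 / (complex_of_real t - w0)\<^sup>2 \<partial>\<mu>))
        \<le> cmod (w - w0) * (2 / d ^ 3)"
    proof -
      have "\<forall>\<^sub>F w in at w0. dist w w0 < d / 2 \<and> w \<noteq> w0"
        using d by (auto simp: eventually_at intro!: exI[of _ "d / 2"])
      then show ?thesis
      proof eventually_elim
        case (elim w)
        have far: "d / 2 \<le> cmod (complex_of_real t - w)" "d \<le> cmod (complex_of_real t - w0)" if "t \<ge> 0" for t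
        proof -
          show 1: "d \<le> cmod (complex_of_real t - w0)"
            unfolding d_def by (rule infdist_le_cmod_diff[OF that])
          show "d / 2 \<le> cmod (complex_of_real t - w)"
            using 1 elim norm_triangle_ineq[of "complex_of_real t - w" "w - w0"] by (simp add: dist_norm)
        qed
        have w: "w \<in> slit"
        proof (rule ccontr)
          assume "w \<notin> slit"
          then obtain r where "w = complex_of_real r" "r \<ge> 0"
            by (auto simp: nonneg_Reals_def)
          then show False
            using far(1)[of r] d by simp
        qed
        have eq: "1 / (complex_of_real t - w) - 1 / (complex_of_real t - w0)
              - (w - w0) * (1 / (complex_of_real t - w0)\<^sup>2)
            = (w - w0)\<^sup>2 / ((complex_of_real t - w) * (complex_of_real t - w0)\<^sup>2)" if "t \<ge> 0" for t
        proof -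
          have "complex_of_real t - w \<noteq> 0" "complex_of_real t - w0 \<noteq> 0"
            using far[OF that] d by auto
          then show ?thesis
            by (simp add: divide_simps) (simp add: power2_eq_square algebra_simps)
        qed
        have "cmod (f w - f w0 - (w - w0) * (\<integral>t. 1 / (complex_of_real t - w0)\<^sup>2 \<partial>\<mu>)) =
          cmod (\<integral>t. 1 / (complex_of_real t - w) - 1 / (complex_of_real t - w0)
              - (w - w0) * (1 / (complex_of_real t - w0)\<^sup>2) \<partial>\<mu>)"
          using int[OF w, of 1] int[OF w0, of 1] int[OF w0, of 2]
          by (simp only: f[OF w] f[OF w0] power_one_right Bochner_Integration.integral_diff
              Bochner_Integration.integrable_diff integral_mult_right_zero integrable_mult_right)
        also have "\<dots> \<le> (\<integral>t. (cmod (w - w0))\<^sup>2 * (2 / d ^ 3) \<partial>\<mu>)"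
        proof (rule integral_norm_bound[THEN order_trans], rule integral_mono_AE)
          show "AE t in \<mu>. cmod (1 / (complex_of_real t - w) - 1 / (complex_of_real t - w0)
              - (w - w0) * (1 / (complex_of_real t - w0)\<^sup>2)) \<le> (cmod (w - w0))\<^sup>2 * (2 / d ^ 3)"
            using AE
          proof eventually_elim
            case (elim t)
            have "d ^ 3 / 2 \<le> cmod (complex_of_real t - w) * (cmod (complex_of_real t - w0))\<^sup>2"
              using mult_mono[OF far(1)[OF elim] power_mono[OF far(2)[OF elim], of 2]] d
              by (simp add: power3_eq_cube power2_eq_square)
            then have "1 / (cmod (complex_of_real t - w) * (cmod (complex_of_real t - w0))\<^sup>2) \<le> 1 / (d ^ 3 / 2)"
              using d by (intro divide_left_mono mult_pos_pos) (auto intro: order.strict_trans2)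
            then show ?case
              unfolding eq[OF elim]
              using mult_left_mono[of _ _ "(cmod (w - w0))\<^sup>2"] by (fastforce simp: norm_divide norm_mult norm_power)
          qed
          show "integrable \<mu> (\<lambda>t. cmod (1 / (complex_of_real t - w) - 1 / (complex_of_real t - w0)
              - (w - w0) * (1 / (complex_of_real t - w0)\<^sup>2)))"
            by (intro integrable_norm Bochner_Integration.integrable_diff integrable_mult_right)
               (use int[OF w, of 1] int[OF w0, of 1] int[OF w0, of 2] in simp_all)
        qed (rule integrable_const)
        finally have "cmod (f w - f w0 - (w - w0) * (\<integral>t. 1 / (complex_of_real t - w0)\<^sup>2 \<partial>\<mu>))
            \<le> (cmod (w - w0))\<^sup>2 * (2 / d ^ 3)"
          by (simp add: prob_space)
        moreover have "cmod (f w - f w0 - (w - w0) * (\<integral>t. 1 / (complex_of_real t - w0)\<^sup>2 \<partial>\<mu>)) =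
            cmod (w - w0) * cmod ((f w - f w0) / (w - w0) - (\<integral>t. 1 / (complex_of_real t - w0)\<^sup>2 \<partial>\<mu>))"
          unfolding norm_mult[symmetric] right_diff_distrib[of "w - w0" "_ / _"] using elim by simp
        ultimately have "cmod (w - w0) * cmod ((f w - f w0) / (w - w0) - (\<integral>t. 1 / (complex_of_real t - w0)\<^sup>2 \<partial>\<mu>))
            \<le> cmod (w - w0) * (cmod (w - w0) * (2 / d ^ 3))"
          by (simp add: power2_eq_square mult_ac)
        then show ?case
          using elim by (simp only: mult_le_cancel_left_pos zero_less_norm_iff right_minus_eq not_False_eq_True)
      qed
    qed
    have "((\<lambda>w. cmod (w - w0) * (2 / d ^ 3)) \<longlongrightarrow> 0) (at w0)"
      using d by (auto intro!: tendsto_eq_intros)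
    from Lim_null_comparison[OF ev this]
    show ?thesis
      unfolding has_field_derivative_iff by (simp add: LIM_zero_iff)
  qed
  then show "f holomorphic_on slit"
    by (meson holomorphic_onI field_differentiable_def field_differentiable_at_within)
qed

section \<open>Resolvent entries as holomorphic functions of the spectral parameter\<close>

lemma det_holomorphic_on:
  assumes "\<And>w. A w \<in> carrier_mat n n"
    and "\<And>i j. i < n \<Longrightarrow> j < n \<Longrightarrow> (\<lambda>w. A w $$ (i, j)) holomorphic_on S"
  shows "(\<lambda>w. Determinant.det (A w)) holomorphic_on S"
proof -
  have "(\<lambda>w. \<Sum>\<pi> | \<pi> permutes {0..<n}. signof \<pi> * (\<Prod>i = 0..<n. A w $$ (i, \<pi> i))) holomorphic_on S"
    by (intro holomorphic_intros assms(2)) (auto dest: permutes_in_image)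
  then show ?thesis
    by (simp add: det_def'[OF assms(1)])
qed

lemma cofactor_holomorphic_on:
  assumes "\<And>w. A w \<in> carrier_mat n n"
    and "\<And>i j. i < n \<Longrightarrow> j < n \<Longrightarrow> (\<lambda>w. A w $$ (i, j)) holomorphic_on S"
  shows "(\<lambda>w. cofactor (A w) a b) holomorphic_on S"
  unfolding cofactor_def
proof (intro holomorphic_intros det_holomorphic_on[where n = "n - 1"])
  have dims: "dim_row (A w) = n" "dim_col (A w) = n" for w
    using assms(1)[of w] by auto
  show "mat_delete (A w) a b \<in> carrier_mat (n - 1) (n - 1)" for w
    by (simp add: mat_delete_def dims)
  show "(\<lambda>w. mat_delete (A w) a b $$ (i, j)) holomorphic_on S" if "i < n - 1" "j < n - 1" for i j
    using that by (simp add: mat_delete_def dims) (auto intro!: assms(2))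
qed

definition gram :: "real \<Rightarrow> nat \<Rightarrow> nat \<Rightarrow> (nat \<Rightarrow> nat \<Rightarrow> real) \<Rightarrow> real mat" where
  "gram k m q X = Matrix.mat m m (\<lambda>(i, l). k * (\<Sum>j<q. X i j * X l j))"

definition cgram_entry :: "real \<Rightarrow> nat \<Rightarrow> nat \<Rightarrow> (nat \<Rightarrow> nat \<Rightarrow> real) \<Rightarrow> complex \<Rightarrow> nat \<Rightarrow> nat \<Rightarrow> complex" where
  "cgram_entry k m q X w i l = complex_of_real (k * (\<Sum>j<q. X i j * X l j)) - (if i = l then w else 0)"

lemma resolvent_gram:
  "resolvent (gram k m q X) w = the (mat_inverse (Matrix.mat m m (\<lambda>(i, l). cgram_entry k m q X w i l)))"
proof -
  have "map_mat complex_of_real (gram k m q X) - w \<cdot>\<^sub>m 1\<^sub>m m = Matrix.mat m m (\<lambda>(i, l). cgram_entry k m q X w i l)"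
    by (intro eq_matI) (auto simp: gram_def cgram_entry_def)
  then show ?thesis
    by (simp add: resolvent_def gram_def)
qed

text \<open>The quadratic form of \<open>k X X^T - w I\<close> equals \<open>r - w t\<close> with
  \<open>r \<ge> 0\<close> and \<open>t = |v|^2\<close>, so the distance of \<open>w\<close> to the
  half-line takes the role that \<open>x\<close> has at real points.\<close>

lemma cgram_entry_coercive:
  assumes k: "k \<ge> 0"
  shows "infdist w \<real>\<^sub>\<ge>\<^sub>0 * (\<Sum>i<m. (cmod (v i))\<^sup>2) \<le>
    cmod (\<Sum>i<m. cnj (v i) * (\<Sum>l<m. cgram_entry k m q X w i l * v l))"
proof -
  define y where "y j = (\<Sum>l<m. complex_of_real (X l j) * v l)" for j
  have inner: "(\<Sum>l<m. cgram_entry k m q X w i l * v l) =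
      complex_of_real k * (\<Sum>j<q. complex_of_real (X i j) * y j) - w * v i" if "i < m" for i
  proof -
    have "(\<Sum>l<m. (if i = l then w else 0) * v l) = w * v i"
      using that by (simp add: if_distrib[of "\<lambda>y. y * _"] cong: if_cong)
    moreover have "(\<Sum>l<m. complex_of_real (k * (\<Sum>j<q. X i j * X l j)) * v l) =
        complex_of_real k * (\<Sum>j<q. complex_of_real (X i j) * y j)"
      by (simp add: y_def sum_distrib_left sum_distrib_right mult_ac) (rule sum.swap)
    ultimately show ?thesis
      by (simp add: cgram_entry_def ring_distribs sum_subtractf)
  qed
  have "(\<Sum>i<m. cnj (v i) * (\<Sum>j<q. complex_of_real (X i j) * y j)) = (\<Sum>j<q. cnj (y j) * y j)"
  proof -
    have "(\<Sum>i<m. cnj (v i) * (\<Sum>j<q. complex_of_real (X i j) * y j)) =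
        (\<Sum>j<q. (\<Sum>i<m. complex_of_real (X i j) * cnj (v i)) * y j)"
      by (simp add: sum_distrib_left sum_distrib_right mult_ac) (rule sum.swap)
    then show ?thesis
      by (simp add: y_def)
  qed
  then have "(\<Sum>i<m. cnj (v i) * (\<Sum>l<m. cgram_entry k m q X w i l * v l)) =
      complex_of_real k * (\<Sum>j<q. cnj (y j) * y j) - w * (\<Sum>i<m. cnj (v i) * v i)"
    by (simp add: inner right_diff_distrib sum_subtractf mult.left_commute flip: sum_distrib_left)
  also have "\<dots> = complex_of_real (k * (\<Sum>j<q. (cmod (y j))\<^sup>2)) - w * complex_of_real (\<Sum>i<m. (cmod (v i))\<^sup>2)"
    by (simp add: complex_norm_square mult.commute del: of_real_power)
  finally show ?thesis
    using infdist_mult_le_cmod_diff[of "k * (\<Sum>j<q. (cmod (y j))\<^sup>2)" "\<Sum>i<m. (cmod (v i))\<^sup>2" w] k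
    by (simp add: sum_nonneg)
qed

context
  fixes k :: real and m q :: nat and X :: "nat \<Rightarrow> nat \<Rightarrow> real"
  assumes k: "k \<ge> 0"
begin

lemma cgram_entry_inj:
  assumes w: "w \<in> slit"
  shows "\<forall>v. (\<forall>i<m. (\<Sum>l<m. cgram_entry k m q X w i l * v l) = 0) \<longrightarrow> (\<forall>i<m. v i = 0)"
proof (intro allI impI)
  fix v i assume *: "\<forall>i<m. (\<Sum>l<m. cgram_entry k m q X w i l * v l) = 0" and i: "i < m"
  then have "infdist w \<real>\<^sub>\<ge>\<^sub>0 * (\<Sum>i<m. (cmod (v i))\<^sup>2) \<le> 0"
    using cgram_entry_coercive[OF k, where w = w and m = m and v = v and q = q and X = X] by simp
  then have "(\<Sum>i<m. (cmod (v i))\<^sup>2) \<le> 0"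
    using infdist_slit_pos[OF w] by (simp add: mult_le_0_iff)
  moreover have "(cmod (v i))\<^sup>2 \<le> (\<Sum>i<m. (cmod (v i))\<^sup>2)"
    using i by (intro member_le_sum) auto
  ultimately show "v i = 0"
    by (simp add: power2_eq_square) (smt (verit) mult_pos_pos norm_le_zero_iff)
qed

lemmas cgram_entry_inverse = inverse_by_cofactors[OF cgram_entry_inj]

lemma resolvent_carrier: "w \<in> slit \<Longrightarrow> resolvent (gram k m q X) w \<in> carrier_mat m m"
  unfolding resolvent_gram by (rule cgram_entry_inverse)

text \<open>The self-improving argument of \<open>green_diag_bounds\<close>, with
  \<open>infdist\<close> in place of \<open>x\<close>. Its independence of the noise and of the
  dimension supplies the local boundedness for Vitali's theorem.\<close>

lemma resolvent_entry_bound: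
  assumes w: "w \<in> slit" and e: "e < m"
  shows "cmod (resolvent (gram k m q X) w $$ (e, e)) \<le> 1 / infdist w \<real>\<^sub>\<ge>\<^sub>0"
proof -
  define v where "v l = resolvent (gram k m q X) w $$ (l, e)" for l
  have "(\<Sum>l<m. cgram_entry k m q X w i l * v l) = (if i = e then 1 else 0)" if "i < m" for i
    using cgram_entry_inverse(4)[OF w that e]
    by (simp add: v_def resolvent_gram cgram_entry_inverse(3)[OF w _ e])
  then have "(\<Sum>i<m. cnj (v i) * (\<Sum>l<m. cgram_entry k m q X w i l * v l)) = (\<Sum>i<m. if i = e then cnj (v i) else 0)"
    by (intro sum.cong refl) auto
  then have 1: "infdist w \<real>\<^sub>\<ge>\<^sub>0 * (\<Sum>i<m. (cmod (v i))\<^sup>2) \<le> cmod (v e)"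
    using cgram_entry_coercive[OF k, where w = w and m = m and v = v and q = q and X = X] e by simp
  have "(cmod (v e))\<^sup>2 \<le> (\<Sum>i<m. (cmod (v i))\<^sup>2)"
    using e by (intro member_le_sum) auto
  then have "infdist w \<real>\<^sub>\<ge>\<^sub>0 * (cmod (v e))\<^sup>2 \<le> cmod (v e)"
    using 1 infdist_slit_pos[OF w] by (smt (verit) mult_left_mono)
  then have "cmod (v e) \<le> 1 / infdist w \<real>\<^sub>\<ge>\<^sub>0"
    using infdist_slit_pos[OF w] by (cases "v e = 0") (auto simp: power2_eq_square field_simps)
  then show ?thesis
    by (simp add: v_def)
qed

lemma resolvent_entry_holomorphic:
  assumes "i < m" "e < m"
  shows "(\<lambda>w. resolvent (gram k m q X) w $$ (i, e)) holomorphic_on slit"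
proof -
  let ?A = "\<lambda>w. Matrix.mat m m (\<lambda>(i, l). cgram_entry k m q X w i l)"
  have "(\<lambda>w. ?A w $$ (a, b)) holomorphic_on slit" if "a < m" "b < m" for a b
    using that by (cases "a = b") (auto simp: cgram_entry_def intro!: holomorphic_intros)
  then have "(\<lambda>w. cofactor (?A w) e i / Determinant.det (?A w)) holomorphic_on slit"
    by (intro holomorphic_on_divide cofactor_holomorphic_on det_holomorphic_on cgram_entry_inverse(1)) auto
  then show ?thesis
    by (rule holomorphic_transform) (simp add: resolvent_gram cgram_entry_inverse(3) assms)
qed

text \<open>The bridge from the complex resolvent to the real estimates: the columns of both solve
  the same linear system, which is injective at \<open>w = -x\<close>.\<close>

lemma resolvent_eq_green:
  assumes "x > 0" and ie: "i < m" "e < m"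
  shows "resolvent (gram k m q X) (- complex_of_real x) $$ (i, e) = complex_of_real (green k x m q X i e)"
proof -
  let ?A = "Matrix.mat m m (\<lambda>(i, l). cgram_entry k m q X (- complex_of_real x) i l)"
  let ?v = "\<lambda>l. cofactor ?A e l / Determinant.det ?A - complex_of_real (green k x m q X l e)"
  have "(\<Sum>l<m. cgram_entry k m q X (- complex_of_real x) a l * complex_of_real (green k x m q X l e)) =
      complex_of_real (gram_op k x m q X (\<lambda>l. green k x m q X l e) a)" if "a < m" for a
    unfolding gram_op_eq_sum[OF that] of_real_sum of_real_mult
    by (intro sum.cong refl) (simp add: cgram_entry_def)
  then have "\<forall>a<m. (\<Sum>l<m. cgram_entry k m q X (- complex_of_real x) a l * ?v l) = 0"
    using cgram_entry_inverse(4)[OF minus_of_real_in_slit[OF \<open>x > 0\<close>] _ ie(2)]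
    by (simp add: right_diff_distrib sum_subtractf green_rop[OF k \<open>x > 0\<close> _ ie(2)])
  then have "?v i = 0"
    using cgram_entry_inj[OF minus_of_real_in_slit[OF \<open>x > 0\<close>], rule_format, of ?v i] ie(1) by blast
  then show ?thesis
    unfolding resolvent_gram cgram_entry_inverse(3)[OF minus_of_real_in_slit[OF \<open>x > 0\<close>] ie] by simp
qed

end

text \<open>As \<open>gram\<close> forms \<open>X X^T\<close>, the matrix \<open>Q\<close>
  corresponds to the transposed array. Later results are proved once for \<open>gram\<close> and
  used for both orientations.\<close>

lemma Q_eq_resolvent_gram:
  "Q n p \<gamma> \<zeta> = resolvent (gram (1 / real n) p n (\<lambda>j i. \<gamma> i j * \<zeta> i j))"
proof -
  have "(1 / real n) \<cdot>\<^sub>m (transpose_mat (design n p \<gamma> \<zeta>) * design n p \<gamma> \<zeta>) =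
      gram (1 / real n) p n (\<lambda>j i. \<gamma> i j * \<zeta> i j)"
    by (intro eq_matI)
       (auto simp: gram_def design_def entrywise_prod_def scalar_prod_def atLeast0LessThan)
  then show ?thesis
    by (simp add: Q_def)
qed

lemma Q_tilde_eq_resolvent_gram:
  "Q_tilde n p \<gamma> \<zeta> = resolvent (gram (1 / real n) n p (\<lambda>i j. \<gamma> i j * \<zeta> i j))"
proof -
  have "(1 / real n) \<cdot>\<^sub>m (design n p \<gamma> \<zeta> * transpose_mat (design n p \<gamma> \<zeta>)) =
      gram (1 / real n) n p (\<lambda>i j. \<gamma> i j * \<zeta> i j)"
    by (intro eq_matI)
       (auto simp: gram_def design_def entrywise_prod_def scalar_prod_def atLeast0LessThan)
  then show ?thesis
    by (simp add: Q_tilde_def)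
qed

section \<open>Concentration by bounded differences\<close>

text \<open>Grouping into singleton blocks \<open>{f l}\<close> renames the indices. Needed to
  single out one column of the array and to transpose it.\<close>

lemma (in prob_space) indep_vars_reindex:
  assumes "indep_vars (\<lambda>_. borel) X I" "inj_on f L" "f ` L \<subseteq> I"
  shows "indep_vars (\<lambda>_. borel) (\<lambda>l. X (f l)) L"
proof -
  have "indep_vars (\<lambda>l. PiM {f l} (\<lambda>_. borel)) (\<lambda>l \<omega>. restrict (\<lambda>i. X i \<omega>) {f l}) L"
    using assms by (intro indep_vars_restrict[OF assms(1)]) (auto simp: disjoint_family_on_def inj_on_def)
  from indep_vars_compose2[OF this, of "\<lambda>l x. x (f l)" "\<lambda>_. borel"]
  show ?thesis
    by simp
qed

text \<open>
  The bounded difference inequality, proved one coordinate at a time: conditionally on the other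
  coordinates, Hoeffding's lemma applies to the last one.
\<close>

lemma bounded_differences_mgf:
  fixes M :: "'i \<Rightarrow> 'a measure" and g :: "('i \<Rightarrow> 'a) \<Rightarrow> real"
  assumes M: "\<And>i. prob_space (M i)" and "finite I" and c: "c > 0" and s: "s > 0"
    and "g \<in> borel_measurable (PiM I M)"
    and "\<And>x. x \<in> space (PiM I M) \<Longrightarrow> \<bar>g x\<bar> \<le> B"
    and "\<And>x i y. x \<in> space (PiM I M) \<Longrightarrow> i \<in> I \<Longrightarrow> y \<in> space (M i) \<Longrightarrow> \<bar>g (x(i := y)) - g x\<bar> \<le> c"
  shows "(\<integral>\<^sup>+x. ennreal (exp (s * (g x - integral\<^sup>L (PiM I M) g))) \<partial>PiM I M)
    \<le> ennreal (exp (s\<^sup>2 * c\<^sup>2 / 2 * real (card I)))"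
  using assms(2,5-)
proof (induction I arbitrary: g rule: finite_induct)
  case empty
  show ?case
    by (simp add: PiM_empty nn_integral_count_space_finite lebesgue_integral_count_space_finite)
next
  case (insert i I)
  interpret M: prob_space "M j" for j
    by (rule M)
  interpret product_prob_space M "insert i I"
    by unfold_locales
  interpret PI: prob_space "PiM I M"
    by (rule prob_space_PiM) (rule M)
  note [measurable] = insert.prems(1)
  have upd [simp]: "x(i := y) \<in> space (PiM (insert i I) M)" if "x \<in> space (PiM I M)" "y \<in> space (M i)" for x y
    using that by (auto simp: space_PiM PiE_iff extensional_def)
  have gm [measurable]: "(\<lambda>(x, y). g (x(i := y))) \<in> borel_measurable (PiM I M \<Otimes>\<^sub>M M i)"
    using measurable_compose[OF measurable_add_dim insert.prems(1)] by (simp add: case_prod_unfold)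
  have gmx [measurable]: "(\<lambda>y. g (x(i := y))) \<in> borel_measurable (M i)" if "x \<in> space (PiM I M)" for x
    using measurable_compose[OF measurable_Pair1'[OF that] gm] by simp
  have gb: "\<bar>g (x(i := y))\<bar> \<le> B" if "x \<in> space (PiM I M)" "y \<in> space (M i)" for x y
    by (rule insert.prems(2)) (rule upd[OF that])
  have gint: "integrable (M i) (\<lambda>y. g (x(i := y)))" if "x \<in> space (PiM I M)" for x
    by (rule M.integrable_const_bound[of _ B]) (use gb[OF that] gmx[OF that] in auto)
  \<comment> \<open>Integrating out coordinate \<open>i\<close> keeps measurability, the bound
    \<open>B\<close> and the differences \<open>c\<close>, so the induction hypothesis applies to
    \<open>g1\<close>, which moreover has the same mean as \<open>g\<close>.\<close>
  define g1 where "g1 x = (\<integral>y. g (x(i := y)) \<partial>M i)" for x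
  have g1m [measurable]: "g1 \<in> borel_measurable (PiM I M)"
    unfolding g1_def by (rule M.borel_measurable_lebesgue_integral) measurable
  have g1b: "\<bar>g1 x\<bar> \<le> B" if "x \<in> space (PiM I M)" for x
  proof -
    have "norm (g1 x) \<le> (\<integral>y. B \<partial>M i)"
      unfolding g1_def using gint[OF that] gb[OF that]
      by (intro order_trans[OF integral_norm_bound] integral_mono) auto
    then show ?thesis
      by (simp add: M.prob_space)
  qed
  have g1d: "\<bar>g1 (x(j := y)) - g1 x\<bar> \<le> c" if x: "x \<in> space (PiM I M)" and j: "j \<in> I" and y: "y \<in> space (M j)" for x j y
  proof -
    have ij: "i \<noteq> j"
      using j insert.hyps by auto
    have x': "x(j := y) \<in> space (PiM I M)"
      using x y j by (auto simp: space_PiM PiE_iff extensional_def)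
    have "norm (g1 (x(j := y)) - g1 x) = norm (\<integral>t. g (x(j := y, i := t)) - g (x(i := t)) \<partial>M i)"
      unfolding g1_def using gint[OF x] gint[OF x'] by simp
    also have "\<dots> \<le> (\<integral>t. c \<partial>M i)"
    proof (rule order_trans[OF integral_norm_bound], rule integral_mono)
      fix t assume t: "t \<in> space (M i)"
      have "x(j := y, i := t) = x(i := t, j := y)"
        using ij by auto
      then show "norm (g (x(j := y, i := t)) - g (x(i := t))) \<le> c"
        unfolding real_norm_def by (simp only:) (rule insert.prems(3)[OF upd[OF x t] _ y], use j in simp)
    qed (use gint[OF x] gint[OF x'] in auto)
    finally show ?thesis
      by (simp add: M.prob_space)
  qed
  have "integrable (PiM (insert i I) M) g"
    by (rule P.integrable_const_bound[of _ B]) (use insert.prems in auto)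
  then have E: "integral\<^sup>L (PiM (insert i I) M) g = integral\<^sup>L (PiM I M) g1"
    unfolding g1_def using insert.hyps by (intro product_integral_insert) auto
  let ?E = "integral\<^sup>L (PiM I M) g1"
  have "(\<integral>\<^sup>+x. ennreal (exp (s * (g x - ?E))) \<partial>PiM (insert i I) M) =
      (\<integral>\<^sup>+x. (\<integral>\<^sup>+y. ennreal (exp (s * (g (x(i := y)) - ?E))) \<partial>M i) \<partial>PiM I M)"
    using insert.hyps by (intro product_nn_integral_insert) auto
  also have "\<dots> \<le> (\<integral>\<^sup>+x. ennreal (exp (s * (g1 x - ?E))) * ennreal (exp (s\<^sup>2 * c\<^sup>2 / 2)) \<partial>PiM I M)"
  proof (rule nn_integral_mono)
    fix x assume x: "x \<in> space (PiM I M)"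
    obtain y0 where y0: "y0 \<in> space (M i)"
      using M.not_empty by blast
    \<comment> \<open>A point \<open>x\<close> of the smaller product has no coordinate
      \<open>i\<close>, so a reference value \<open>y0\<close> is inserted. All values lie within
      \<open>c\<close> of that one; the interval has length \<open>2 * c\<close>, and Hoeffding's
      exponent \<open>s^2 (2c)^2 / 8\<close> is \<open>s^2 c^2 / 2\<close>.\<close>
    interpret h: interval_bounded_random_variable "M i" "\<lambda>y. g (x(i := y))" "g (x(i := y0)) - c" "g (x(i := y0)) + c"
    proof
      show "AE y in M i. g (x(i := y)) \<in> {g (x(i := y0)) - c..g (x(i := y0)) + c}"
      proof (rule AE_I2)
        fix y assume "y \<in> space (M i)"
        then have "\<bar>g (x(i := y0, i := y)) - g (x(i := y0))\<bar> \<le> c"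
          by (intro insert.prems(3) upd x y0) auto
        then show "g (x(i := y)) \<in> {g (x(i := y0)) - c..g (x(i := y0)) + c}"
          by (auto simp: abs_le_iff)
      qed
    qed (use x in measurable)
    have "(\<integral>\<^sup>+y. ennreal (exp (s * (g (x(i := y)) - ?E))) \<partial>M i) =
        (\<integral>\<^sup>+y. ennreal (exp (s * (g1 x - ?E))) * ennreal (exp (s * (g (x(i := y)) - g1 x))) \<partial>M i)"
      by (intro nn_integral_cong) (simp add: ennreal_mult[symmetric] exp_add[symmetric] algebra_simps)
    also have "\<dots> = ennreal (exp (s * (g1 x - ?E))) * (\<integral>\<^sup>+y. ennreal (exp (s * (g (x(i := y)) - g1 x))) \<partial>M i)"
      using gmx[OF x] by (intro nn_integral_cmult) measurable
    also have "(\<integral>\<^sup>+y. ennreal (exp (s * (g (x(i := y)) - g1 x))) \<partial>M i) \<le> ennreal (exp (s\<^sup>2 * c\<^sup>2 / 2))"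
      using h.Hoeffdings_lemma_nn_integral[OF s] by (simp add: g1_def power2_eq_square mult_ac)
    finally show "(\<integral>\<^sup>+y. ennreal (exp (s * (g (x(i := y)) - ?E))) \<partial>M i)
        \<le> ennreal (exp (s * (g1 x - ?E))) * ennreal (exp (s\<^sup>2 * c\<^sup>2 / 2))"
      by (simp add: mult_left_mono)
  qed
  also have "\<dots> = (\<integral>\<^sup>+x. ennreal (exp (s * (g1 x - ?E))) \<partial>PiM I M) * ennreal (exp (s\<^sup>2 * c\<^sup>2 / 2))"
    by (rule nn_integral_multc) measurable
  also have "\<dots> \<le> ennreal (exp (s\<^sup>2 * c\<^sup>2 / 2 * real (card I))) * ennreal (exp (s\<^sup>2 * c\<^sup>2 / 2))"
    by (intro mult_right_mono insert.IH g1m g1b g1d) auto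
  also have "\<dots> = ennreal (exp (s\<^sup>2 * c\<^sup>2 / 2 * real (card (insert i I))))"
    using insert.hyps by (simp add: ennreal_mult[symmetric] exp_add[symmetric] ring_distribs)
  finally show ?case
    by (simp add: E)
qed

text \<open>The constant is the square of the 8 in \<open>y^2 / 8 \<le> exp (y / 2)\<close>; the two
  exponentials cover both signs.\<close>

lemma power4_le_exp: "(y::real) ^ 4 \<le> 64 * (exp y + exp (- y))"
proof -
  have *: "y ^ 4 \<le> 64 * exp y" if "y \<ge> 0" for y :: real
  proof -
    have "y\<^sup>2 / 8 \<le> exp (y / 2)"
      using exp_lower_Taylor_quadratic[of "y / 2"] that by (simp add: power_divide)
    then have "(y\<^sup>2 / 8)\<^sup>2 \<le> (exp (y / 2))\<^sup>2"
      by (intro power_mono) auto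
    also have "(exp (y / 2))\<^sup>2 = exp y"
      by (simp add: power2_eq_square exp_add[symmetric])
    finally show ?thesis
      by (simp add: power_divide)
  qed
  show ?thesis
    using *[of y] *[of "- y"] by (cases "y \<ge> 0") (auto intro: order_trans)
qed

lemma power2_le_exp: "(y::real)\<^sup>2 \<le> 2 * (exp y + exp (- y))"
proof -
  have *: "y\<^sup>2 \<le> 2 * exp y" if "y \<ge> 0" for y :: real
    using exp_lower_Taylor_quadratic[OF that] that by simp
  show ?thesis
    using *[of y] *[of "- y"] by (cases "y \<ge> 0") (auto intro: order_trans)
qed

text \<open>Converts exponential moments at \<open>1 / a\<close> and \<open>-1 / a\<close> into
  polynomial ones; the value 3 is a convenient majorant of \<open>exp (1 / 2)\<close>.\<close>

lemma nn_integral_le_of_exp: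
  assumes h [measurable]: "h \<in> borel_measurable N" and "a > 0" "b \<ge> 0"
    and f: "\<And>y. f y \<le> b * (exp y + exp (- y))"
    and pos: "(\<integral>\<^sup>+x. ennreal (exp (h x / a)) \<partial>N) \<le> 3"
    and neg: "(\<integral>\<^sup>+x. ennreal (exp (- (h x / a))) \<partial>N) \<le> 3"
  shows "(\<integral>\<^sup>+x. ennreal (f (h x / a)) \<partial>N) \<le> ennreal (6 * b)"
proof -
  have "(\<integral>\<^sup>+x. ennreal (f (h x / a)) \<partial>N) \<le>
      (\<integral>\<^sup>+x. ennreal b * (ennreal (exp (h x / a)) + ennreal (exp (- (h x / a)))) \<partial>N)"
    using f \<open>b \<ge> 0\<close> by (intro nn_integral_mono) (auto simp: ennreal_mult[symmetric] ennreal_plus[symmetric] intro!: ennreal_leI simp del: ennreal_plus)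
  also have "\<dots> = ennreal b * ((\<integral>\<^sup>+x. ennreal (exp (h x / a)) \<partial>N) + (\<integral>\<^sup>+x. ennreal (exp (- (h x / a))) \<partial>N))"
    by (subst nn_integral_cmult) (auto simp: nn_integral_add)
  also have "\<dots> \<le> ennreal b * (3 + 3)"
    by (intro mult_left_mono add_mono pos neg) auto
  also have "\<dots> = ennreal (6 * b)"
    using \<open>b \<ge> 0\<close> by (simp add: ennreal_mult mult.commute)
  finally show ?thesis .
qed

section \<open>Measurability of resolvent entries in the noise\<close>

lemma det_borel_measurable:
  fixes A :: "'b \<Rightarrow> real mat"
  assumes "\<And>w. A w \<in> carrier_mat n n"
    and "\<And>i j. i < n \<Longrightarrow> j < n \<Longrightarrow> (\<lambda>w. A w $$ (i, j)) \<in> borel_measurable N"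
  shows "(\<lambda>w. Determinant.det (A w)) \<in> borel_measurable N"
proof -
  have "(\<lambda>w. \<Sum>\<pi> | \<pi> permutes {0..<n}. signof \<pi> * (\<Prod>i = 0..<n. A w $$ (i, \<pi> i))) \<in> borel_measurable N"
    by (intro borel_measurable_sum borel_measurable_times borel_measurable_const borel_measurable_prod assms(2))
       (auto dest: permutes_in_image)
  then show ?thesis
    by (simp add: det_def'[OF assms(1)])
qed

lemma shifted_gram_carrier: "shifted_gram k x m q X \<in> carrier_mat m m"
  by (simp add: shifted_gram_def)

lemma green_borel_measurable:
  assumes X: "\<And>i j. i < m \<Longrightarrow> j < q \<Longrightarrow> (\<lambda>w. X w i j) \<in> borel_measurable N"
  shows "(\<lambda>w. green k x m q (X w) i e) \<in> borel_measurable N"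
proof -
  have ent: "(\<lambda>w. shifted_gram k x m q (X w) $$ (a, b)) \<in> borel_measurable N" if "a < m" "b < m" for a b
  proof -
    have "(\<lambda>w. k * (\<Sum>j<q. X w a j * X w b j) + (if a = b then x else 0)) \<in> borel_measurable N"
      using that by (intro borel_measurable_add borel_measurable_times borel_measurable_sum borel_measurable_const X) auto
    then show ?thesis
      using that by (simp add: shifted_gram_def)
  qed
  have "(\<lambda>w. Determinant.det (shifted_gram k x m q (X w))) \<in> borel_measurable N"
    by (rule det_borel_measurable[OF shifted_gram_carrier ent])
  moreover have "(\<lambda>w. Determinant.det (mat_delete (shifted_gram k x m q (X w)) e i)) \<in> borel_measurable N"
  proof (rule det_borel_measurable[of _ "m - 1"])
    show "mat_delete (shifted_gram k x m q (X w)) e i \<in> carrier_mat (m - 1) (m - 1)" for w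
      by (simp add: mat_delete_def shifted_gram_def)
    show "(\<lambda>w. mat_delete (shifted_gram k x m q (X w)) e i $$ (a, b)) \<in> borel_measurable N"
      if "a < m - 1" "b < m - 1" for a b
    proof -
      have "mat_delete (shifted_gram k x m q (X w)) e i $$ (a, b) =
          shifted_gram k x m q (X w) $$ (if a < e then a else Suc a, if b < i then b else Suc b)" for w
        using that carrier_matD[OF shifted_gram_carrier] by (simp add: mat_delete_def)
      then show ?thesis
        using that ent[of "if a < e then a else Suc a" "if b < i then b else Suc b"]
        by (cases "a < e"; cases "b < i") auto
    qed
  qed
  ultimately show ?thesis
    unfolding green_def cofactor_def by measurable
qed

lemma green_cong:
  assumes "\<And>i j. i < m \<Longrightarrow> j < q \<Longrightarrow> X i j = Y i j"
  shows "green k x m q X = green k x m q Y"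
proof -
  have "shifted_gram k x m q X = shifted_gram k x m q Y"
    unfolding shifted_gram_def using assms by (intro cong_mat) auto
  then show ?thesis
    by (simp add: green_def fun_eq_iff)
qed

text \<open>Independence suffices for the concentration of traces, so moment assumptions are left to
  the extension \<open>random_array_moments\<close>.\<close>

locale random_array = prob_space M for M :: "'w measure" +
  fixes m q :: nat and W :: "nat \<Rightarrow> nat \<Rightarrow> 'w \<Rightarrow> real"
  assumes indep: "indep_vars (\<lambda>_. borel) (\<lambda>(i, j). W i j) ({..<m} \<times> {..<q})"
begin

lemma W_measurable [measurable]:
  assumes "i < m" "j < q"
  shows "W i j \<in> borel_measurable M"
proof -
  have "random_variable borel (case (i, j) of (i, j) \<Rightarrow> W i j)"
    using indep assms unfolding indep_vars_def by blast
  then show ?thesis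
    by simp
qed

text \<open>A whole column is one coordinate, so that the rank-one bound is the difference bound.
  The factor measures must be probability measures for every natural \<open>j\<close>; indices
  \<open>j \<ge> q\<close> therefore fall back to column 0, which exists because
  \<open>q > 0\<close>.\<close>

lemma column_bounded_differences_mgf:
  fixes h :: "(nat \<Rightarrow> nat \<Rightarrow> real) \<Rightarrow> real"
  assumes q: "q > 0" and c: "c > 0" and s: "s > 0"
    and hm: "(\<lambda>y. h (\<lambda>i j. y j (i, j))) \<in> borel_measurable
      (PiM {..<q} (\<lambda>j. PiM ({..<m} \<times> {if j < q then j else 0}) (\<lambda>_. borel)))"
    and cong: "\<And>X Y. (\<And>i j. i < m \<Longrightarrow> j < q \<Longrightarrow> X i j = Y i j) \<Longrightarrow> h X = h Y"
    and bdd: "\<And>X. \<bar>h X\<bar> \<le> B"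
    and diff: "\<And>X Y j. j < q \<Longrightarrow> (\<And>i j'. i < m \<Longrightarrow> j' < q \<Longrightarrow> j' \<noteq> j \<Longrightarrow> X i j' = Y i j') \<Longrightarrow> \<bar>h X - h Y\<bar> \<le> c"
  shows "(\<integral>\<^sup>+\<omega>. ennreal (exp (s * (h (\<lambda>i j. W i j \<omega>) - expectation (\<lambda>\<omega>. h (\<lambda>i j. W i j \<omega>))))) \<partial>M)
    \<le> ennreal (exp (s\<^sup>2 * c\<^sup>2 / 2 * real q))"
proof -
  define N where "N j = PiM ({..<m} \<times> {if j < q then j else 0}) (\<lambda>_. borel :: real measure)" for j
  define V where "V j = (\<lambda>\<omega>. restrict (\<lambda>(i, j). W i j \<omega>) ({..<m} \<times> {if j < q then j else 0}))" for j
  have Vm [measurable]: "V j \<in> measurable M (N j)" for j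
    unfolding V_def N_def using q by (intro measurable_restrict) auto
  have "indep_vars N V {..<q}"
    unfolding N_def V_def
    using indep_vars_restrict[OF indep, of "{..<q}" "\<lambda>j. {..<m} \<times> {if j < q then j else 0}"] q
    by (auto simp: disjoint_family_on_def case_prod_unfold)
  then have d: "distr M (PiM {..<q} N) (\<lambda>\<omega>. \<lambda>j\<in>{..<q}. V j \<omega>) = PiM {..<q} (\<lambda>j. distr M (N j) (V j))"
    using indep_vars_iff_distr_eq_PiM[where I = "{..<q}" and M' = N and X = V] q by auto
  define g where "g y = h (\<lambda>i j. y j (i, j))" for y
  have gm [measurable]: "g \<in> borel_measurable (PiM {..<q} N)"
    using hm unfolding g_def N_def .
  have gV: "g (\<lambda>j\<in>{..<q}. V j \<omega>) = h (\<lambda>i j. W i j \<omega>)" for \<omega>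
    unfolding g_def by (rule cong) (simp add: V_def)
  have sets: "sets (PiM {..<q} (\<lambda>j. distr M (N j) (V j))) = sets (PiM {..<q} N)"
    by (intro sets_PiM_cong) auto
  have mgf: "(\<integral>\<^sup>+y. ennreal (exp (s * (g y - integral\<^sup>L (PiM {..<q} (\<lambda>j. distr M (N j) (V j))) g))) \<partial>PiM {..<q} (\<lambda>j. distr M (N j) (V j)))
    \<le> ennreal (exp (s\<^sup>2 * c\<^sup>2 / 2 * real (card {..<q})))"
  proof (rule bounded_differences_mgf[OF _ _ c s])
    show "prob_space (distr M (N j) (V j))" for j
      by (rule prob_space_distr) measurable
    show "g \<in> borel_measurable (PiM {..<q} (\<lambda>j. distr M (N j) (V j)))"
      using gm measurable_cong_sets[OF sets refl] by blast
    show "\<bar>g y\<bar> \<le> B" for y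
      by (simp add: g_def bdd)
    show "\<bar>g (y(j := t)) - g y\<bar> \<le> c" if "j \<in> {..<q}" for y j t
      unfolding g_def by (rule diff[of j]) (use that in auto)
  qed simp
  have "integral\<^sup>L (PiM {..<q} (\<lambda>j. distr M (N j) (V j))) g = expectation (\<lambda>\<omega>. h (\<lambda>i j. W i j \<omega>))"
    unfolding d[symmetric] by (subst integral_distr) (auto simp: gV)
  then show ?thesis
    using mgf unfolding d[symmetric] by (subst (asm) nn_integral_distr) (auto simp: gV)
qed

lemma column_bounded_differences_moments:
  fixes h :: "(nat \<Rightarrow> nat \<Rightarrow> real) \<Rightarrow> real"
  assumes q: "q > 0" and c: "c > 0"
    and hm: "(\<lambda>y. h (\<lambda>i j. y j (i, j))) \<in> borel_measurable
      (PiM {..<q} (\<lambda>j. PiM ({..<m} \<times> {if j < q then j else 0}) (\<lambda>_. borel)))"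
    and hW [measurable]: "(\<lambda>\<omega>. h (\<lambda>i j. W i j \<omega>)) \<in> borel_measurable M"
    and cong: "\<And>X Y. (\<And>i j. i < m \<Longrightarrow> j < q \<Longrightarrow> X i j = Y i j) \<Longrightarrow> h X = h Y"
    and bdd: "\<And>X. \<bar>h X\<bar> \<le> B"
    and diff: "\<And>X Y j. j < q \<Longrightarrow> (\<And>i j'. i < m \<Longrightarrow> j' < q \<Longrightarrow> j' \<noteq> j \<Longrightarrow> X i j' = Y i j') \<Longrightarrow> \<bar>h X - h Y\<bar> \<le> c"
  defines "D \<equiv> (\<lambda>\<omega>. h (\<lambda>i j. W i j \<omega>) - expectation (\<lambda>\<omega>. h (\<lambda>i j. W i j \<omega>)))"
  shows "(\<integral>\<^sup>+\<omega>. ennreal (D \<omega> ^ 4) \<partial>M) \<le> ennreal (384 * (c ^ 4 * (real q)\<^sup>2))"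
    and "(\<integral>\<^sup>+\<omega>. ennreal ((D \<omega>)\<^sup>2) \<partial>M) \<le> ennreal (12 * (c\<^sup>2 * real q))"
proof -
  \<comment> \<open>The scale at which the exponent \<open>a^(-2) c^2 q / 2\<close> equals
    \<open>1 / 2\<close>. The constants in the conclusion are \<open>384 = 6 * 64\<close> and
    \<open>12 = 6 * 2\<close>.\<close>
  define a where "a = c * sqrt (real q)"
  have a: "a > 0" "a\<^sup>2 = c\<^sup>2 * real q"
    using c q by (auto simp: a_def power_mult_distrib)
  then have a4: "a ^ 4 = c ^ 4 * (real q)\<^sup>2"
    by (metis (no_types, lifting) mult_2 numeral_Bit0 power_add power_mult_distrib power2_eq_square)
  have [measurable]: "D \<in> borel_measurable M"
    unfolding D_def by measurable
  have e: "exp ((1 / a)\<^sup>2 * c\<^sup>2 / 2 * real q) \<le> 3"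
  proof -
    have "(1 / a)\<^sup>2 * c\<^sup>2 / 2 * real q = 1 / 2"
      using c q by (simp add: power_divide a(2))
    moreover have "exp (1 / 2 :: real) \<le> 3"
      using exp_le by (rule order_trans[rotated]) simp
    ultimately show ?thesis
      by simp
  qed
  have "(\<integral>\<^sup>+\<omega>. ennreal (exp (D \<omega> / a)) \<partial>M) \<le> ennreal (exp ((1 / a)\<^sup>2 * c\<^sup>2 / 2 * real q))"
  proof -
    have "(\<integral>\<^sup>+\<omega>. ennreal (exp (1 / a * (h (\<lambda>i j. W i j \<omega>) - expectation (\<lambda>\<omega>. h (\<lambda>i j. W i j \<omega>))))) \<partial>M)
        \<le> ennreal (exp ((1 / a)\<^sup>2 * c\<^sup>2 / 2 * real q))"
    proof (rule column_bounded_differences_mgf[where h = h and B = B])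
      show "h X = h Y" if "\<And>i j. i < m \<Longrightarrow> j < q \<Longrightarrow> X i j = Y i j" for X Y
        by (rule cong) (rule that)
      show "\<bar>h X - h Y\<bar> \<le> c"
        if "j < q" "\<And>i j'. i < m \<Longrightarrow> j' < q \<Longrightarrow> j' \<noteq> j \<Longrightarrow> X i j' = Y i j'" for X Y j
        by (rule diff[OF that(1)]) (rule that(2))
    qed (use q c a hm bdd in simp_all)
    then show ?thesis
      by (simp add: D_def)
  qed
  also have "\<dots> \<le> 3"
    using e by (simp add: ennreal_le_iff2 flip: ennreal_numeral)
  finally have pos: "(\<integral>\<^sup>+\<omega>. ennreal (exp (D \<omega> / a)) \<partial>M) \<le> 3" .
  \<comment> \<open>The exponential bound is available for positive \<open>s\<close>, so the other
    tail is obtained from \<open>-h\<close>.\<close>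
  have "(\<integral>\<^sup>+\<omega>. ennreal (exp (- (D \<omega> / a))) \<partial>M) \<le> ennreal (exp ((1 / a)\<^sup>2 * c\<^sup>2 / 2 * real q))"
  proof -
    have "(\<integral>\<^sup>+\<omega>. ennreal (exp (1 / a * (- h (\<lambda>i j. W i j \<omega>) - expectation (\<lambda>\<omega>. - h (\<lambda>i j. W i j \<omega>))))) \<partial>M)
        \<le> ennreal (exp ((1 / a)\<^sup>2 * c\<^sup>2 / 2 * real q))"
    proof (rule column_bounded_differences_mgf[where h = "\<lambda>X. - h X" and B = B])
      show "- h X = - h Y" if "\<And>i j. i < m \<Longrightarrow> j < q \<Longrightarrow> X i j = Y i j" for X Y
        using cong[of X Y] that by simp
      show "\<bar>- h X - - h Y\<bar> \<le> c"
        if "j < q" "\<And>i j'. i < m \<Longrightarrow> j' < q \<Longrightarrow> j' \<noteq> j \<Longrightarrow> X i j' = Y i j'" for X Y j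
        using diff[of j X Y, OF that] by (simp add: abs_minus_commute)
      show "(\<lambda>y. - h (\<lambda>i j. y j (i, j))) \<in> borel_measurable
          (PiM {..<q} (\<lambda>j. PiM ({..<m} \<times> {if j < q then j else 0}) (\<lambda>_. borel)))"
        using hm by (rule borel_measurable_uminus)
    qed (use q c a bdd in simp_all)
    moreover have "1 / a * (- h (\<lambda>i j. W i j \<omega>) - expectation (\<lambda>\<omega>. - h (\<lambda>i j. W i j \<omega>))) = - (D \<omega> / a)" for \<omega>
      by (simp add: D_def minus_divide_left)
    ultimately show ?thesis
      by simp
  qed
  also have "\<dots> \<le> 3"
    using e by (simp add: ennreal_le_iff2 flip: ennreal_numeral)
  finally have neg: "(\<integral>\<^sup>+\<omega>. ennreal (exp (- (D \<omega> / a))) \<partial>M) \<le> 3" .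
  have "(\<integral>\<^sup>+\<omega>. ennreal (D \<omega> ^ 4) \<partial>M) = (\<integral>\<^sup>+\<omega>. ennreal (a ^ 4) * ennreal ((D \<omega> / a) ^ 4) \<partial>M)"
    using a(1) by (intro nn_integral_cong) (simp add: ennreal_mult[symmetric] power_divide)
  also have "\<dots> = ennreal (a ^ 4) * (\<integral>\<^sup>+\<omega>. ennreal ((D \<omega> / a) ^ 4) \<partial>M)"
    by (rule nn_integral_cmult) measurable
  also have "\<dots> \<le> ennreal (a ^ 4) * ennreal (6 * 64)"
    by (intro mult_left_mono nn_integral_le_of_exp[OF _ a(1) _ power4_le_exp pos neg]) auto
  finally show "(\<integral>\<^sup>+\<omega>. ennreal (D \<omega> ^ 4) \<partial>M) \<le> ennreal (384 * (c ^ 4 * (real q)\<^sup>2))"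
    by (simp add: ennreal_mult[symmetric] a4 mult.commute del: ennreal_numeral flip: ennreal_numeral)
  have "(\<integral>\<^sup>+\<omega>. ennreal ((D \<omega>)\<^sup>2) \<partial>M) = (\<integral>\<^sup>+\<omega>. ennreal (a\<^sup>2) * ennreal ((D \<omega> / a)\<^sup>2) \<partial>M)"
    using a(1) by (intro nn_integral_cong) (simp add: ennreal_mult[symmetric] power_divide)
  also have "\<dots> = ennreal (a\<^sup>2) * (\<integral>\<^sup>+\<omega>. ennreal ((D \<omega> / a)\<^sup>2) \<partial>M)"
    by (rule nn_integral_cmult) measurable
  also have "\<dots> \<le> ennreal (a\<^sup>2) * ennreal (6 * 2)"
    by (intro mult_left_mono nn_integral_le_of_exp[OF _ a(1) _ power2_le_exp pos neg]) auto
  finally show "(\<integral>\<^sup>+\<omega>. ennreal ((D \<omega>)\<^sup>2) \<partial>M) \<le> ennreal (12 * (c\<^sup>2 * real q))"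
    by (simp add: ennreal_mult[symmetric] a(2) mult.commute del: ennreal_numeral flip: ennreal_numeral)
qed

context
  fixes k x K :: real and \<gamma> :: "nat \<Rightarrow> nat \<Rightarrow> real" and u :: "nat \<Rightarrow> real"
  assumes q: "q > 0" and k: "k \<ge> 0" and x: "x > 0" and K: "K > 0" and u: "\<And>i. i < m \<Longrightarrow> \<bar>u i\<bar> \<le> K"
begin

lemma green_trace_borel_measurable:
  "(\<lambda>\<omega>. \<Sum>i<m. u i * green k x m q (\<lambda>i j. \<gamma> i j * W i j \<omega>) i i) \<in> borel_measurable M"
  by (intro borel_measurable_sum borel_measurable_times borel_measurable_const green_borel_measurable) measurable

lemma green_trace_bound: "\<bar>\<Sum>i<m. u i * green k x m q X i i\<bar> \<le> real m * (K / x)"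
proof -
  have "\<bar>\<Sum>i<m. u i * green k x m q X i i\<bar> \<le> (\<Sum>i<m. K * (1 / x))"
    using u green_diag_bounds[OF k x] K
    by (intro order_trans[OF sum_abs] sum_mono) (auto simp: abs_mult simp del: times_divide_eq_right intro!: mult_mono)
  then show ?thesis
    by simp
qed

text \<open>If two arrays differ in one column, both traces are within \<open>K / x\<close> of the
  trace for their common array with that column zeroed. Hence the difference bound
  \<open>2 * K / x\<close>.\<close>

lemma green_trace_moments:
  defines "D \<equiv> (\<lambda>\<omega>. (\<Sum>i<m. u i * green k x m q (\<lambda>i j. \<gamma> i j * W i j \<omega>) i i)
    - expectation (\<lambda>\<omega>. \<Sum>i<m. u i * green k x m q (\<lambda>i j. \<gamma> i j * W i j \<omega>) i i))"
  shows "(\<integral>\<^sup>+\<omega>. ennreal (D \<omega> ^ 4) \<partial>M) \<le> ennreal (384 * ((2 * K / x) ^ 4 * (real q)\<^sup>2))"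
    and "(\<integral>\<^sup>+\<omega>. ennreal ((D \<omega>)\<^sup>2) \<partial>M) \<le> ennreal (12 * ((2 * K / x)\<^sup>2 * real q))"
proof -
  define h where "h X = (\<Sum>i<m. u i * green k x m q (\<lambda>i j. \<gamma> i j * X i j) i i)" for X
  have c: "2 * K / x > 0"
    using K x by simp
  have hm: "(\<lambda>y. h (\<lambda>i j. y j (i, j))) \<in> borel_measurable
      (PiM {..<q} (\<lambda>j. PiM ({..<m} \<times> {if j < q then j else 0}) (\<lambda>_. borel)))"
  proof -
    have "(\<lambda>y. y j (i, j)) \<in> borel_measurable (PiM {..<q} (\<lambda>j. PiM ({..<m} \<times> {if j < q then j else 0}) (\<lambda>_. borel)))"
      if "i < m" "j < q" for i j
    proof -
      have "(\<lambda>y. y j) \<in> measurable (PiM {..<q} (\<lambda>j. PiM ({..<m} \<times> {if j < q then j else 0}) (\<lambda>_. borel)))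
          (PiM ({..<m} \<times> {if j < q then j else 0}) (\<lambda>_. borel))"
        using that by (intro measurable_component_singleton) auto
      from measurable_compose[OF this measurable_component_singleton[of "(i, j)"]]
      show ?thesis
        using that by simp
    qed
    then show ?thesis
      unfolding h_def
      by (intro borel_measurable_sum borel_measurable_times borel_measurable_const green_borel_measurable)
  qed
  have cong: "h X = h Y" if "\<And>i j. i < m \<Longrightarrow> j < q \<Longrightarrow> X i j = Y i j" for X Y
    unfolding h_def using that by (subst green_cong[of m q _ "\<lambda>i j. \<gamma> i j * Y i j"]) auto
  have diff: "\<bar>h X - h Y\<bar> \<le> 2 * K / x"
    if j: "j < q" and eq: "\<And>i j'. i < m \<Longrightarrow> j' < q \<Longrightarrow> j' \<noteq> j \<Longrightarrow> X i j' = Y i j'" for X Y j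
  proof -
    define A B where "A = (\<lambda>i j. \<gamma> i j * X i j)" and "B = (\<lambda>i j. \<gamma> i j * Y i j)"
    have "green k x m q (zero_col j A) = green k x m q (zero_col j B)"
      by (rule green_cong) (use eq in \<open>auto simp: zero_col_def A_def B_def\<close>)
    then show ?thesis
      using green_zero_col_diff[OF k x j less_imp_le[OF K], where m = m and u = u and X = A, OF u]
        green_zero_col_diff[OF k x j less_imp_le[OF K], where m = m and u = u and X = B, OF u]
      by (simp add: h_def A_def[symmetric] B_def[symmetric] abs_le_iff)
  qed
  have m: "(\<lambda>\<omega>. h (\<lambda>i j. W i j \<omega>)) \<in> borel_measurable M"
    unfolding h_def by (rule green_trace_borel_measurable)
  have b: "\<bar>h X\<bar> \<le> real m * (K / x)" for X
    unfolding h_def by (rule green_trace_bound)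
  show "(\<integral>\<^sup>+\<omega>. ennreal (D \<omega> ^ 4) \<partial>M) \<le> ennreal (384 * ((2 * K / x) ^ 4 * (real q)\<^sup>2))"
    unfolding D_def h_def[symmetric]
    by (rule column_bounded_differences_moments(1)[where h = h, OF q c hm m])
       (blast intro: cong b diff)+
  show "(\<integral>\<^sup>+\<omega>. ennreal ((D \<omega>)\<^sup>2) \<partial>M) \<le> ennreal (12 * ((2 * K / x)\<^sup>2 * real q))"
    unfolding D_def h_def[symmetric]
    by (rule column_bounded_differences_moments(2)[where h = h, OF q c hm m])
       (blast intro: cong b diff)+
qed

end

end

section \<open>Quadratic forms and the mean of a diagonal entry\<close>

context prob_space
begin

section \<open>Second moments of quadratic forms in independent variables\<close>

definition square_int :: "('a \<Rightarrow> real) \<Rightarrow> bool" where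
  "square_int X \<longleftrightarrow> X \<in> borel_measurable M \<and> integrable M (\<lambda>\<omega>. (X \<omega>)\<^sup>2)"

lemma square_int_mult:
  assumes "square_int X" "square_int Y"
  shows "integrable M (\<lambda>\<omega>. X \<omega> * Y \<omega>)"
proof (rule Bochner_Integration.integrable_bound)
  show "integrable M (\<lambda>\<omega>. (X \<omega>)\<^sup>2 + (Y \<omega>)\<^sup>2)"
    using assms by (auto simp: square_int_def)
  show "(\<lambda>\<omega>. X \<omega> * Y \<omega>) \<in> borel_measurable M"
    using assms by (auto simp: square_int_def)
  show "AE \<omega> in M. norm (X \<omega> * Y \<omega>) \<le> norm ((X \<omega>)\<^sup>2 + (Y \<omega>)\<^sup>2)"
  proof (rule AE_I2)
    fix \<omega>
    have "2 * \<bar>X \<omega>\<bar> * \<bar>Y \<omega>\<bar> \<le> \<bar>X \<omega>\<bar>\<^sup>2 + \<bar>Y \<omega>\<bar>\<^sup>2"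
      by (rule sum_squares_bound)
    moreover have "0 \<le> \<bar>X \<omega>\<bar> * \<bar>Y \<omega>\<bar>"
      by simp
    ultimately show "norm (X \<omega> * Y \<omega>) \<le> norm ((X \<omega>)\<^sup>2 + (Y \<omega>)\<^sup>2)"
      unfolding real_norm_def abs_mult power2_abs by linarith
  qed
qed

lemma square_int_const: "square_int (\<lambda>_. c)"
  by (simp add: square_int_def)

lemma square_int_add:
  assumes "square_int X" "square_int Y"
  shows "square_int (\<lambda>\<omega>. X \<omega> + Y \<omega>)"
  using assms square_int_mult[OF assms] by (auto simp: square_int_def power2_sum mult.assoc)

lemma square_int_scale: "square_int X \<Longrightarrow> square_int (\<lambda>\<omega>. c * X \<omega>)"
  by (auto simp: square_int_def power_mult_distrib)

lemma square_int_diff: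
  assumes "square_int X" "square_int Y"
  shows "square_int (\<lambda>\<omega>. X \<omega> - Y \<omega>)"
  using square_int_add[OF assms(1) square_int_scale[OF assms(2), of "-1"]] by simp

lemma square_int_sum: "(\<And>i. i \<in> I \<Longrightarrow> square_int (X i)) \<Longrightarrow> square_int (\<lambda>\<omega>. \<Sum>i\<in>I. X i \<omega>)"
  by (induction I rule: infinite_finite_induct) (auto intro: square_int_add square_int_const)

lemma square_int_integrable: "square_int X \<Longrightarrow> integrable M X"
  using square_int_mult[OF _ square_int_const[of 1]] by simp

lemma square_int_prodI:
  assumes [measurable]: "X \<in> borel_measurable M" "Y \<in> borel_measurable M"
    and "integrable M (\<lambda>\<omega>. X \<omega> ^ 4)" "integrable M (\<lambda>\<omega>. Y \<omega> ^ 4)"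
  shows "square_int (\<lambda>\<omega>. X \<omega> * Y \<omega>)"
proof -
  have "square_int (\<lambda>\<omega>. (X \<omega>)\<^sup>2)" "square_int (\<lambda>\<omega>. (Y \<omega>)\<^sup>2)"
    using assms by (auto simp: square_int_def power_mult[symmetric])
  from square_int_mult[OF this] show ?thesis
    by (auto simp: square_int_def power_mult_distrib)
qed

lemma square_expectation_le:
  assumes "square_int X"
  shows "(expectation (\<lambda>\<omega>. \<bar>X \<omega>\<bar>))\<^sup>2 \<le> expectation (\<lambda>\<omega>. (X \<omega>)\<^sup>2)"
proof -
  have "variance (\<lambda>\<omega>. \<bar>X \<omega>\<bar>) = expectation (\<lambda>\<omega>. \<bar>X \<omega>\<bar>\<^sup>2) - (expectation (\<lambda>\<omega>. \<bar>X \<omega>\<bar>))\<^sup>2"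
    using assms square_int_integrable[OF assms] by (intro variance_eq) (auto simp: square_int_def)
  with variance_positive[of "\<lambda>\<omega>. \<bar>X \<omega>\<bar>"] show ?thesis
    unfolding power2_abs by linarith
qed

lemma expectation_abs_le_sqrt:
  assumes [measurable]: "X \<in> borel_measurable M"
    and le: "(\<integral>\<^sup>+\<omega>. ennreal ((X \<omega>)\<^sup>2) \<partial>M) \<le> ennreal C" and C: "C \<ge> 0"
  shows "integrable M (\<lambda>\<omega>. \<bar>X \<omega>\<bar>)" "expectation (\<lambda>\<omega>. \<bar>X \<omega>\<bar>) \<le> sqrt C"
proof -
  have fin: "(\<integral>\<^sup>+\<omega>. ennreal ((X \<omega>)\<^sup>2) \<partial>M) < \<infinity>"
    using le by (rule order.strict_trans1) simp
  then have sq: "square_int X"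
    unfolding square_int_def by (intro conjI integrableI_nonneg) auto
  then show "integrable M (\<lambda>\<omega>. \<bar>X \<omega>\<bar>)"
    using square_int_integrable by auto
  have "ennreal (expectation (\<lambda>\<omega>. (X \<omega>)\<^sup>2)) \<le> ennreal C"
    using le sq by (subst (asm) nn_integral_eq_integral) (auto simp: square_int_def)
  then have "expectation (\<lambda>\<omega>. (X \<omega>)\<^sup>2) \<le> C"
    using C by simp
  then have "(expectation (\<lambda>\<omega>. \<bar>X \<omega>\<bar>))\<^sup>2 \<le> C"
    using square_expectation_le[OF sq] by linarith
  then show "expectation (\<lambda>\<omega>. \<bar>X \<omega>\<bar>) \<le> sqrt C"
    by (rule real_le_rsqrt)
qed

context
  fixes \<xi> :: "nat \<Rightarrow> 'a \<Rightarrow> real" and m :: nat and \<kappa> :: real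
  assumes indep: "indep_vars (\<lambda>_. borel) \<xi> {..<m}"
    and int4: "\<And>i. i < m \<Longrightarrow> integrable M (\<lambda>\<omega>. \<xi> i \<omega> ^ 4)"
    and mean: "\<And>i. i < m \<Longrightarrow> expectation (\<xi> i) = 0"
    and var: "\<And>i. i < m \<Longrightarrow> expectation (\<lambda>\<omega>. (\<xi> i \<omega>)\<^sup>2) = 1"
    and fourth: "\<And>i. i < m \<Longrightarrow> expectation (\<lambda>\<omega>. \<xi> i \<omega> ^ 4) \<le> \<kappa>"
begin

lemma xi_measurable [measurable]: "i < m \<Longrightarrow> \<xi> i \<in> borel_measurable M"
  using indep by (auto simp: indep_vars_def)

lemma square_int_xi_prod: "i < m \<Longrightarrow> l < m \<Longrightarrow> square_int (\<lambda>\<omega>. \<xi> i \<omega> * \<xi> l \<omega>)"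
  by (intro square_int_prodI int4) auto

lemma square_int_xi: "i < m \<Longrightarrow> square_int (\<xi> i)"
  using square_int_integrable[OF square_int_xi_prod[of i i]] by (simp add: square_int_def power2_eq_square)

text \<open>The blocks \<open>{..<r}\<close> and \<open>{r}\<close> are disjoint. This is the
  martingale structure that kills the cross terms when quadratic forms are built up one index at a
  time.\<close>

lemma past_indep:
  fixes f :: "(nat \<Rightarrow> real) \<Rightarrow> real" and g :: "real \<Rightarrow> real"
  assumes r: "r < m" and f: "f \<in> borel_measurable (PiM {..<r} (\<lambda>_. borel))" and g: "g \<in> borel_measurable borel"
    and F: "\<And>\<omega>. F \<omega> = f (restrict (\<lambda>i. \<xi> i \<omega>) {..<r})"
    and "integrable M F" "integrable M (\<lambda>\<omega>. g (\<xi> r \<omega>))"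
  shows "expectation (\<lambda>\<omega>. F \<omega> * g (\<xi> r \<omega>)) = expectation F * expectation (\<lambda>\<omega>. g (\<xi> r \<omega>))" (is ?eq)
    and "integrable M (\<lambda>\<omega>. F \<omega> * g (\<xi> r \<omega>))" (is ?int)
proof -
  have "indep_var (PiM {..<r} (\<lambda>_. borel)) (\<lambda>\<omega>. restrict (\<lambda>i. \<xi> i \<omega>) {..<r})
      (PiM {r} (\<lambda>_. borel)) (\<lambda>\<omega>. restrict (\<lambda>i. \<xi> i \<omega>) {r})"
    by (rule indep_var_restrict[OF indep]) (use r in auto)
  moreover have "(\<lambda>y. g (y r)) \<in> borel_measurable (PiM {r} (\<lambda>_. borel))"
    by (rule measurable_compose[OF _ g], rule measurable_component_singleton) simp
  ultimately have "indep_var borel (f \<circ> (\<lambda>\<omega>. restrict (\<lambda>i. \<xi> i \<omega>) {..<r}))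
      borel ((\<lambda>y. g (y r)) \<circ> (\<lambda>\<omega>. restrict (\<lambda>i. \<xi> i \<omega>) {r}))"
    using f by (intro indep_var_compose)
  moreover have "f \<circ> (\<lambda>\<omega>. restrict (\<lambda>i. \<xi> i \<omega>) {..<r}) = F"
    "(\<lambda>y. g (y r)) \<circ> (\<lambda>\<omega>. restrict (\<lambda>i. \<xi> i \<omega>) {r}) = (\<lambda>\<omega>. g (\<xi> r \<omega>))"
    by (auto simp: F fun_eq_iff)
  ultimately have "indep_var borel F borel (\<lambda>\<omega>. g (\<xi> r \<omega>))"
    by simp
  from indep_var_lebesgue_integral[OF this assms(5,6)] indep_var_integrable[OF this assms(5,6)]
  show ?eq ?int
    by auto
qed

lemma square_expectation_linear:
  assumes "r \<le> m"
  shows "expectation (\<lambda>\<omega>. (\<Sum>i<r. b i * \<xi> i \<omega>)\<^sup>2) = (\<Sum>i<r. (b i)\<^sup>2)"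
  using assms
proof (induction r)
  case (Suc r)
  define L where "L \<omega> = (\<Sum>i<r. b i * \<xi> i \<omega>)" for \<omega>
  have r: "r < m"
    using Suc by simp
  have L: "square_int L"
    unfolding L_def using r by (intro square_int_sum square_int_scale square_int_xi) auto
  have "expectation (\<lambda>\<omega>. L \<omega> * \<xi> r \<omega>) = expectation L * expectation (\<lambda>\<omega>. \<xi> r \<omega>)"
  proof (rule past_indep(1)[OF r, where g = "\<lambda>t. t" and f = "\<lambda>y. \<Sum>i<r. b i * y i"])
    show "(\<lambda>y. \<Sum>i<r. b i * y i) \<in> borel_measurable (PiM {..<r} (\<lambda>_. borel))"
      by (intro borel_measurable_sum borel_measurable_times borel_measurable_const measurable_component_singleton)
    show "L \<omega> = (\<Sum>i<r. b i * restrict (\<lambda>i. \<xi> i \<omega>) {..<r} i)" for \<omega>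
      by (simp add: L_def)
  qed (use square_int_integrable[OF L] square_int_integrable[OF square_int_xi[OF r]] in auto)
  then have cross: "expectation (\<lambda>\<omega>. L \<omega> * \<xi> r \<omega>) = 0"
    by (simp add: mean[OF r])
  have int: "integrable M (\<lambda>\<omega>. (L \<omega>)\<^sup>2)" "integrable M (\<lambda>\<omega>. (\<xi> r \<omega>)\<^sup>2)" "integrable M (\<lambda>\<omega>. L \<omega> * \<xi> r \<omega>)"
    using L square_int_xi[OF r] square_int_mult[OF L square_int_xi[OF r]] by (auto simp: square_int_def)
  have "expectation (\<lambda>\<omega>. (\<Sum>i<Suc r. b i * \<xi> i \<omega>)\<^sup>2) =
      expectation (\<lambda>\<omega>. (L \<omega>)\<^sup>2 + (b r)\<^sup>2 * (\<xi> r \<omega>)\<^sup>2 + 2 * b r * (L \<omega> * \<xi> r \<omega>))"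
    by (simp add: L_def power2_sum power_mult_distrib mult_ac)
  also have "\<dots> = expectation (\<lambda>\<omega>. (L \<omega>)\<^sup>2) + (b r)\<^sup>2"
    using int by (simp add: cross var[OF r])
  finally show ?case
    using Suc by (simp add: L_def)
qed simp

text \<open>Index \<open>r\<close> contributes the increment
  \<open>2 \<xi>_r L + B_rr (\<xi>_r^2 - 1)\<close>, with \<open>L\<close> linear in the past. It is
  orthogonal to the past, so second moments add. From \<open>(a + b)^2 \<le> 2 a^2 + 2 b^2\<close>,
  its second moment is at most \<open>8 * (\<Sum>i<r. (B r i)^2) + 2 * \<kappa> * (B r r)^2\<close>,
  and \<open>8 + 2 * \<kappa>\<close> covers both terms.\<close>

lemma quadratic_form_variance:
  assumes sym: "\<And>i l. i < m \<Longrightarrow> l < m \<Longrightarrow> B i l = B l i" and "r \<le> m"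
  defines "S \<equiv> (\<lambda>r \<omega>. (\<Sum>i<r. \<Sum>l<r. B i l * (\<xi> i \<omega> * \<xi> l \<omega>)) - (\<Sum>i<r. B i i))"
  shows "square_int (S r) \<and> expectation (\<lambda>\<omega>. (S r \<omega>)\<^sup>2) \<le> (8 + 2 * \<kappa>) * (\<Sum>i<r. \<Sum>l<r. (B i l)\<^sup>2)"
proof -
  have sq: "square_int (S r)" if "r \<le> m" for r
    unfolding S_def using that
    by (intro square_int_diff square_int_sum square_int_scale square_int_xi_prod square_int_const) auto
  have "expectation (\<lambda>\<omega>. (S r \<omega>)\<^sup>2) \<le> (8 + 2 * \<kappa>) * (\<Sum>i<r. \<Sum>l<r. (B i l)\<^sup>2)"
    using \<open>r \<le> m\<close>
  proof (induction r)
    case 0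
    then show ?case
      by (simp add: S_def)
  next
    case (Suc r)
    then have r: "r < m"
      by simp
    have \<kappa>: "\<kappa> \<ge> 0"
      using fourth[OF r] by (rule order_trans[rotated]) (simp add: integral_nonneg_AE)
    define L where "L \<omega> = (\<Sum>i<r. B r i * \<xi> i \<omega>)" for \<omega>
    define E where "E \<omega> = (\<xi> r \<omega>)\<^sup>2 - 1" for \<omega>
    define D where "D \<omega> = 2 * (\<xi> r \<omega> * L \<omega>) + B r r * E \<omega>" for \<omega>
    have Sr: "S (Suc r) \<omega> = S r \<omega> + D \<omega>" for \<omega>
    proof -
      \<comment> \<open>Symmetry of \<open>B\<close> makes the new row and the new column contribute
        equally, whence the factor 2 in \<open>D\<close>.\<close>
      have "(\<Sum>i<r. B i r * (\<xi> i \<omega> * \<xi> r \<omega>)) = \<xi> r \<omega> * L \<omega>"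
        unfolding L_def sum_distrib_left using r sym by (intro sum.cong) auto
      moreover have "(\<Sum>i<r. B r i * (\<xi> r \<omega> * \<xi> i \<omega>)) = \<xi> r \<omega> * L \<omega>"
        unfolding L_def sum_distrib_left by (intro sum.cong) auto
      ultimately show ?thesis
        by (simp add: S_def D_def E_def sum.distrib algebra_simps power2_eq_square)
    qed
    have sqL: "square_int L"
      unfolding L_def using r by (intro square_int_sum square_int_scale square_int_xi) auto
    have sqxL: "square_int (\<lambda>\<omega>. \<xi> r \<omega> * L \<omega>)"
      unfolding L_def sum_distrib_left mult.left_commute[of "\<xi> r _"]
      using r by (intro square_int_sum square_int_scale square_int_xi_prod) auto
    have sqE: "square_int E"
      unfolding E_def power2_eq_square using r by (intro square_int_diff square_int_xi_prod square_int_const) auto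
    have sqD: "square_int D"
      unfolding D_def by (intro square_int_add square_int_scale sqxL sqE)
    note sqS = sq[of r]
    have Lm: "(\<lambda>y. \<Sum>i<r. B r i * y i) \<in> borel_measurable (PiM {..<r} (\<lambda>_. borel))"
      by (intro borel_measurable_sum borel_measurable_times borel_measurable_const measurable_component_singleton)
    have Sm: "(\<lambda>y. (\<Sum>i<r. \<Sum>l<r. B i l * (y i * y l)) - (\<Sum>i<r. B i i)) \<in> borel_measurable (PiM {..<r} (\<lambda>_. borel))"
      by (intro borel_measurable_diff borel_measurable_sum borel_measurable_times borel_measurable_const
          measurable_component_singleton)
    have ES: "expectation E = 0"
      unfolding E_def using square_int_integrable[OF square_int_xi_prod[OF r r]] var[OF r]
      by (simp add: power2_eq_square prob_space)
    have c1: "expectation (\<lambda>\<omega>. S r \<omega> * L \<omega> * \<xi> r \<omega>) = 0" "integrable M (\<lambda>\<omega>. S r \<omega> * L \<omega> * \<xi> r \<omega>)"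
      using past_indep[OF r borel_measurable_times[OF Sm Lm], of "\<lambda>t. t" "\<lambda>\<omega>. S r \<omega> * L \<omega>"]
        square_int_mult[OF sqS sqL] square_int_integrable[OF square_int_xi[OF r]] r mean[OF r]
      by (simp_all add: S_def L_def)
    have c2: "expectation (\<lambda>\<omega>. S r \<omega> * E \<omega>) = 0" "integrable M (\<lambda>\<omega>. S r \<omega> * E \<omega>)"
      using past_indep[OF r Sm, of "\<lambda>t. t\<^sup>2 - 1" "S r"]
        square_int_integrable[OF sqS] square_int_integrable[OF sqE] r ES
      by (simp_all add: S_def E_def[abs_def])
    have c3: "expectation (\<lambda>\<omega>. (L \<omega>)\<^sup>2 * (\<xi> r \<omega>)\<^sup>2) = (\<Sum>i<r. (B r i)\<^sup>2)" "integrable M (\<lambda>\<omega>. (L \<omega>)\<^sup>2 * (\<xi> r \<omega>)\<^sup>2)"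
      using past_indep[OF r borel_measurable_power[OF Lm, of 2], of "\<lambda>t. t\<^sup>2" "\<lambda>\<omega>. (L \<omega>)\<^sup>2"]
        sqL square_int_xi[OF r] r var[OF r] square_expectation_linear[of r "B r"]
      by (simp_all add: L_def square_int_def)
    have c4: "expectation (\<lambda>\<omega>. (E \<omega>)\<^sup>2) \<le> \<kappa>" "integrable M (\<lambda>\<omega>. (E \<omega>)\<^sup>2)"
    proof -
      show "integrable M (\<lambda>\<omega>. (E \<omega>)\<^sup>2)"
        using sqE by (simp add: square_int_def)
      have "expectation (\<lambda>\<omega>. (E \<omega>)\<^sup>2) = expectation (\<lambda>\<omega>. \<xi> r \<omega> ^ 4 - 2 * (\<xi> r \<omega>)\<^sup>2 + 1)"
        unfolding E_def by (intro Bochner_Integration.integral_cong) (auto simp: power2_eq_square power4_eq_xxxx algebra_simps)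
      also have "\<dots> = expectation (\<lambda>\<omega>. \<xi> r \<omega> ^ 4) - 1"
        using int4[OF r] square_int_xi[OF r] var[OF r] by (simp add: square_int_def prob_space)
      finally show "expectation (\<lambda>\<omega>. (E \<omega>)\<^sup>2) \<le> \<kappa>"
        using fourth[OF r] by simp
    qed
    have iS: "integrable M (\<lambda>\<omega>. (S r \<omega>)\<^sup>2)"
      using sqS r by (simp add: square_int_def)
    have "expectation (\<lambda>\<omega>. (S (Suc r) \<omega>)\<^sup>2) \<le> expectation (\<lambda>\<omega>. (S r \<omega>)\<^sup>2
        + 4 * (S r \<omega> * L \<omega> * \<xi> r \<omega>) + 2 * B r r * (S r \<omega> * E \<omega>)
        + (8 * ((L \<omega>)\<^sup>2 * (\<xi> r \<omega>)\<^sup>2) + 2 * (B r r)\<^sup>2 * (E \<omega>)\<^sup>2))"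
    proof (rule integral_mono)
      show "integrable M (\<lambda>\<omega>. (S (Suc r) \<omega>)\<^sup>2)"
        using sq[of "Suc r"] r by (simp add: square_int_def)
      fix \<omega>
      have "(D \<omega>)\<^sup>2 \<le> 2 * (2 * (\<xi> r \<omega> * L \<omega>))\<^sup>2 + 2 * (B r r * E \<omega>)\<^sup>2"
        unfolding D_def using sum_squares_bound[of "2 * (\<xi> r \<omega> * L \<omega>)" "B r r * E \<omega>"]
        by (simp add: power2_sum)
      then have "(D \<omega>)\<^sup>2 \<le> 8 * ((L \<omega>)\<^sup>2 * (\<xi> r \<omega>)\<^sup>2) + 2 * (B r r)\<^sup>2 * (E \<omega>)\<^sup>2"
        by (simp add: power_mult_distrib mult_ac)
      moreover have "(S (Suc r) \<omega>)\<^sup>2 = (S r \<omega>)\<^sup>2 + 4 * (S r \<omega> * L \<omega> * \<xi> r \<omega>) + 2 * B r r * (S r \<omega> * E \<omega>) + (D \<omega>)\<^sup>2"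
        unfolding Sr power2_sum by (simp add: D_def algebra_simps)
      ultimately show "(S (Suc r) \<omega>)\<^sup>2 \<le> (S r \<omega>)\<^sup>2
        + 4 * (S r \<omega> * L \<omega> * \<xi> r \<omega>) + 2 * B r r * (S r \<omega> * E \<omega>)
        + (8 * ((L \<omega>)\<^sup>2 * (\<xi> r \<omega>)\<^sup>2) + 2 * (B r r)\<^sup>2 * (E \<omega>)\<^sup>2)"
        by linarith
    qed (use iS c1 c2 c3 c4 in simp)
    also have "\<dots> = expectation (\<lambda>\<omega>. (S r \<omega>)\<^sup>2) + 8 * (\<Sum>i<r. (B r i)\<^sup>2) + 2 * (B r r)\<^sup>2 * expectation (\<lambda>\<omega>. (E \<omega>)\<^sup>2)"
      using iS c1 c2 c3 c4 by simp
    also have "\<dots> \<le> (8 + 2 * \<kappa>) * (\<Sum>i<r. \<Sum>l<r. (B i l)\<^sup>2) + (8 + 2 * \<kappa>) * (\<Sum>i<r. (B r i)\<^sup>2)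
        + (8 + 2 * \<kappa>) * (B r r)\<^sup>2"
    proof -
      have "8 * (\<Sum>i<r. (B r i)\<^sup>2) \<le> (8 + 2 * \<kappa>) * (\<Sum>i<r. (B r i)\<^sup>2)"
        using \<kappa> by (intro mult_right_mono sum_nonneg) auto
      moreover have "2 * (B r r)\<^sup>2 * expectation (\<lambda>\<omega>. (E \<omega>)\<^sup>2) \<le> 2 * (B r r)\<^sup>2 * \<kappa>"
        using c4(1) by (intro mult_left_mono) auto
      moreover have "2 * (B r r)\<^sup>2 * \<kappa> \<le> (8 + 2 * \<kappa>) * (B r r)\<^sup>2"
        by (simp add: algebra_simps)
      ultimately show ?thesis
        using Suc by simp
    qed
    also have "\<dots> \<le> (8 + 2 * \<kappa>) * (\<Sum>i<Suc r. \<Sum>l<Suc r. (B i l)\<^sup>2)"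
      using \<kappa> by (simp add: sum.distrib sum_nonneg ring_distribs)
    finally show ?case .
  qed
  then show ?thesis
    using sq[OF \<open>r \<le> m\<close>] by simp
qed

end

text \<open>Fubini for the joint law of independent variables: a bound that is uniform over frozen
  values of \<open>Y\<close> survives integration. It allows the resolvent without column
  \<open>j0\<close> to be treated as a deterministic matrix.\<close>

lemma indep_var_nn_integral_le:
  assumes ind: "indep_var S X T Y" and F [measurable]: "F \<in> borel_measurable (S \<Otimes>\<^sub>M T)"
    and le: "\<And>y. y \<in> space T \<Longrightarrow> (\<integral>\<^sup>+\<omega>. F (X \<omega>, y) \<partial>M) \<le> C"
  shows "(\<integral>\<^sup>+\<omega>. F (X \<omega>, Y \<omega>) \<partial>M) \<le> C"
proof -
  have X [measurable]: "X \<in> measurable M S" and Y [measurable]: "Y \<in> measurable M T"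
    and d: "distr M S X \<Otimes>\<^sub>M distr M T Y = distr M (S \<Otimes>\<^sub>M T) (\<lambda>\<omega>. (X \<omega>, Y \<omega>))"
    using ind by (auto simp: indep_var_distribution_eq)
  interpret X: prob_space "distr M S X"
    by (rule prob_space_distr) fact
  interpret Y: prob_space "distr M T Y"
    by (rule prob_space_distr) fact
  interpret pair_sigma_finite "distr M S X" "distr M T Y" ..
  have "(\<integral>\<^sup>+\<omega>. F (X \<omega>, Y \<omega>) \<partial>M) = (\<integral>\<^sup>+z. F z \<partial>(distr M S X \<Otimes>\<^sub>M distr M T Y))"
    unfolding d by (subst nn_integral_distr) auto
  also have "\<dots> = (\<integral>\<^sup>+y. (\<integral>\<^sup>+x. F (x, y) \<partial>distr M S X) \<partial>distr M T Y)"
    by (rule nn_integral_snd[symmetric]) (simp cong: measurable_cong_sets)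
  also have "\<dots> \<le> (\<integral>\<^sup>+y. C \<partial>distr M T Y)"
  proof (rule nn_integral_mono)
    fix y assume "y \<in> space (distr M T Y)"
    then have y: "y \<in> space T"
      by simp
    have "(\<integral>\<^sup>+x. F (x, y) \<partial>distr M S X) = (\<integral>\<^sup>+\<omega>. F (X \<omega>, y) \<partial>M)"
      by (rule nn_integral_distr) (use y in measurable)
    then show "(\<integral>\<^sup>+x. F (x, y) \<partial>distr M S X) \<le> C"
      using le[OF y] by simp
  qed
  also have "\<dots> = C"
    by (simp add: Y.emeasure_space_1 del: space_distr emeasure_distr)
  finally show ?thesis .
qed

end

section \<open>The mean of a diagonal entry through Schur's formula\<close>

locale random_array_moments = random_array +
  fixes \<kappa> :: real
  assumes W_mean: "\<And>i j. i < m \<Longrightarrow> j < q \<Longrightarrow> expectation (W i j) = 0"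
    and W_var: "\<And>i j. i < m \<Longrightarrow> j < q \<Longrightarrow> expectation (\<lambda>\<omega>. (W i j \<omega>)\<^sup>2) = 1"
    and W_int4: "\<And>i j. i < m \<Longrightarrow> j < q \<Longrightarrow> integrable M (\<lambda>\<omega>. W i j \<omega> ^ 4)"
    and W_fourth: "\<And>i j. i < m \<Longrightarrow> j < q \<Longrightarrow> expectation (\<lambda>\<omega>. W i j \<omega> ^ 4) \<le> \<kappa>"
begin

context
  fixes k x \<Gamma> :: real and \<gamma> :: "nat \<Rightarrow> nat \<Rightarrow> real" and j0 :: nat
  assumes k: "k \<ge> 0" and x: "x > 0" and \<Gamma>: "\<Gamma> > 0" and j0: "j0 < q"
    and \<gamma>: "\<And>i j. i < m \<Longrightarrow> j < q \<Longrightarrow> (\<gamma> i j)\<^sup>2 \<le> \<Gamma>"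
begin

abbreviation "Xm \<omega> \<equiv> (\<lambda>i j. \<gamma> i j * W i j \<omega>)"

definition "schur \<omega> = k * (\<Sum>i<m. \<Sum>l<m. Xm \<omega> i j0 * Xm \<omega> l j0 * green k x m q (zero_col j0 (Xm \<omega>)) i l)"
text \<open>The conditional mean of \<open>schur\<close> given the other columns, because the
  entries of column \<open>j0\<close> are independent, centered and of variance one.\<close>

definition "schur_diag \<omega> = k * (\<Sum>i<m. (\<gamma> i j0)\<^sup>2 * green k x m q (zero_col j0 (Xm \<omega>)) i i)"

text \<open>With the other columns frozen, \<open>quadratic_form_variance\<close> applies to column
  \<open>j0\<close>. Taking \<open>k = 1/n\<close> and \<open>m\<close> of order \<open>n\<close>
  makes the bound of order \<open>1/n\<close>.\<close>

lemma schur_concentration: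
  "(\<integral>\<^sup>+\<omega>. ennreal ((schur \<omega> - schur_diag \<omega>)\<^sup>2) \<partial>M) \<le> ennreal ((8 + 2 * \<kappa>) * (k\<^sup>2 * \<Gamma>\<^sup>2 * (real m / x\<^sup>2)))"
proof (cases "m = 0")
  case True
  then have "schur \<omega> = 0" "schur_diag \<omega> = 0" for \<omega>
    unfolding schur_def schur_diag_def by simp_all
  then show ?thesis
    by simp
next
  case False
  define A B where "A = {..<m} \<times> {j0}" and "B = {..<m} \<times> ({..<q} - {j0})"
  define V where "V \<omega> = restrict (\<lambda>(i, j). W i j \<omega>) A" for \<omega>
  define V' where "V' \<omega> = restrict (\<lambda>(i, j). W i j \<omega>) B" for \<omega>
  \<comment> \<open>Zeroing column \<open>j0\<close> makes this depend on the block \<open>B\<close>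
    alone, so the integrand becomes a function of the independent pair \<open>V\<close>,
    \<open>V'\<close>.\<close>
  define G where "G y i l = green k x m q (zero_col j0 (\<lambda>i j. \<gamma> i j * y (i, j))) i l" for y i l
  define F where "F z = ennreal (((\<Sum>i<m. \<Sum>l<m. k * \<gamma> i j0 * \<gamma> l j0 * G (snd z) i l * (fst z (i, j0) * fst z (l, j0)))
      - (\<Sum>i<m. k * \<gamma> i j0 * \<gamma> i j0 * G (snd z) i i))\<^sup>2)" for z :: "(nat \<times> nat \<Rightarrow> real) \<times> (nat \<times> nat \<Rightarrow> real)"
  have ind: "indep_var (PiM A (\<lambda>_. borel :: real measure)) V (PiM B (\<lambda>_. borel :: real measure)) V'"
    using indep_var_restrict[OF indep, of A B] j0
    by (auto simp: V_def[abs_def] V'_def[abs_def] A_def B_def case_prod_unfold)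
  have m1 [measurable]: "(\<lambda>z. fst z (i, j0)) \<in> borel_measurable (PiM A (\<lambda>_. borel :: real measure) \<Otimes>\<^sub>M PiM B (\<lambda>_. borel :: real measure))" if "i < m" for i
    by (rule measurable_compose[OF measurable_fst], rule measurable_component_singleton) (use that in \<open>simp add: A_def\<close>)
  have m2 [measurable]: "(\<lambda>z. G (snd z) i l) \<in> borel_measurable (PiM A (\<lambda>_. borel :: real measure) \<Otimes>\<^sub>M PiM B (\<lambda>_. borel :: real measure))" for i l
    unfolding G_def
  proof (rule green_borel_measurable)
    fix a b assume ab: "a < m" "b < q"
    show "(\<lambda>w. zero_col j0 (\<lambda>i j. \<gamma> i j * snd w (i, j)) a b) \<in> borel_measurable (PiM A (\<lambda>_. borel :: real measure) \<Otimes>\<^sub>M PiM B (\<lambda>_. borel :: real measure))"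
    proof (cases "b = j0")
      case False
      have "(\<lambda>w. snd w (a, b)) \<in> borel_measurable (PiM A (\<lambda>_. borel :: real measure) \<Otimes>\<^sub>M PiM B (\<lambda>_. borel :: real measure))"
        by (rule measurable_compose[OF measurable_snd], rule measurable_component_singleton)
           (use ab False in \<open>simp add: B_def\<close>)
      then show ?thesis
        using False by (simp add: zero_col_def borel_measurable_times)
    qed (simp add: zero_col_def)
  qed
  have F: "F \<in> borel_measurable (PiM A (\<lambda>_. borel :: real measure) \<Otimes>\<^sub>M PiM B (\<lambda>_. borel :: real measure))"
    unfolding F_def by measurable
  have \<kappa>: "\<kappa> \<ge> 0"
    using W_fourth[of 0 j0] False j0 by (auto intro: order_trans[rotated] integral_nonneg_AE)
  have FV: "F (V \<omega>, V' \<omega>) = ennreal ((schur \<omega> - schur_diag \<omega>)\<^sup>2)" for \<omega>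
  proof -
    have G: "G (V' \<omega>) i l = green k x m q (zero_col j0 (Xm \<omega>)) i l" for i l
      unfolding G_def by (rule fun_cong[OF fun_cong[OF green_cong]]) (auto simp: zero_col_def V'_def B_def)
    have VA: "V \<omega> (i, j0) = W i j0 \<omega>" if "i < m" for i
      using that by (simp add: V_def A_def)
    show ?thesis
      by (simp add: F_def schur_def schur_diag_def G VA sum_distrib_left power2_eq_square mult_ac)
  qed
  have "(\<integral>\<^sup>+\<omega>. F (V \<omega>, V' \<omega>) \<partial>M) \<le> ennreal ((8 + 2 * \<kappa>) * (k\<^sup>2 * \<Gamma>\<^sup>2 * (real m / x\<^sup>2)))"
  proof (rule indep_var_nn_integral_le[OF ind F])
    fix y
    define C where "C i l = k * \<gamma> i j0 * \<gamma> l j0 * G y i l" for i l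
    define S where "S \<omega> = (\<Sum>i<m. \<Sum>l<m. C i l * (W i j0 \<omega> * W l j0 \<omega>)) - (\<Sum>i<m. C i i)" for \<omega>
    have col: "indep_vars (\<lambda>_. borel) (\<lambda>i. W i j0) {..<m}"
      using indep_vars_reindex[OF indep, of "\<lambda>i. (i, j0)" "{..<m}"] j0 by (auto simp: inj_on_def)
    have "square_int S \<and> expectation (\<lambda>\<omega>. (S \<omega>)\<^sup>2) \<le> (8 + 2 * \<kappa>) * (\<Sum>i<m. \<Sum>l<m. (C i l)\<^sup>2)"
      unfolding S_def
      by (rule quadratic_form_variance[OF col])
         (auto simp: W_int4 W_mean W_var W_fourth j0 C_def G_def green_sym[OF k x])
    then have S: "integrable M (\<lambda>\<omega>. (S \<omega>)\<^sup>2)" "expectation (\<lambda>\<omega>. (S \<omega>)\<^sup>2) \<le> (8 + 2 * \<kappa>) * (\<Sum>i<m. \<Sum>l<m. (C i l)\<^sup>2)"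
      by (auto simp: square_int_def)
    have "(C i l)\<^sup>2 \<le> k\<^sup>2 * \<Gamma>\<^sup>2 * (G y i l)\<^sup>2" if "i < m" "l < m" for i l
    proof -
      have "(\<gamma> i j0)\<^sup>2 * (\<gamma> l j0)\<^sup>2 \<le> \<Gamma> * \<Gamma>"
        using \<gamma> that j0 \<Gamma> by (intro mult_mono) auto
      then have "k\<^sup>2 * ((\<gamma> i j0)\<^sup>2 * (\<gamma> l j0)\<^sup>2) * (G y i l)\<^sup>2 \<le> k\<^sup>2 * (\<Gamma> * \<Gamma>) * (G y i l)\<^sup>2"
        by (intro mult_right_mono mult_left_mono) auto
      then show ?thesis
        by (simp add: C_def power_mult_distrib power2_eq_square mult_ac)
    qed
    then have "(\<Sum>i<m. \<Sum>l<m. (C i l)\<^sup>2) \<le> (\<Sum>i<m. \<Sum>l<m. k\<^sup>2 * \<Gamma>\<^sup>2 * (G y i l)\<^sup>2)"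
      by (intro sum_mono) auto
    also have "\<dots> = k\<^sup>2 * \<Gamma>\<^sup>2 * (\<Sum>l<m. \<Sum>i<m. (G y i l)\<^sup>2)"
      by (subst sum.swap) (simp add: sum_distrib_left)
    \<comment> \<open>Each column of the inverse has squared norm at most \<open>1 / x^2\<close>;
      the squared Frobenius norm thus grows like \<open>m\<close> instead of
      \<open>m^2\<close>.\<close>
    also have "\<dots> \<le> k\<^sup>2 * \<Gamma>\<^sup>2 * (\<Sum>l<m. 1 / x\<^sup>2)"
      unfolding G_def by (intro mult_left_mono sum_mono green_diag_bounds(3)[OF k x]) auto
    also have "\<dots> = k\<^sup>2 * \<Gamma>\<^sup>2 * (real m / x\<^sup>2)"
      by simp
    finally have "expectation (\<lambda>\<omega>. (S \<omega>)\<^sup>2) \<le> (8 + 2 * \<kappa>) * (k\<^sup>2 * \<Gamma>\<^sup>2 * (real m / x\<^sup>2))"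
      using \<kappa> by (intro order_trans[OF S(2)] mult_left_mono) auto
    moreover have "(\<integral>\<^sup>+\<omega>. F (V \<omega>, y) \<partial>M) = (\<integral>\<^sup>+\<omega>. ennreal ((S \<omega>)\<^sup>2) \<partial>M)"
      by (intro nn_integral_cong) (simp add: F_def S_def C_def V_def A_def)
    ultimately show "(\<integral>\<^sup>+\<omega>. F (V \<omega>, y) \<partial>M) \<le> ennreal ((8 + 2 * \<kappa>) * (k\<^sup>2 * \<Gamma>\<^sup>2 * (real m / x\<^sup>2)))"
      using S(1) by (simp add: nn_integral_eq_integral ennreal_leI)
  qed
  then show ?thesis
    by (simp add: FV)
qed

lemma schur_measurable [measurable]:
  "schur \<in> borel_measurable M" "schur_diag \<in> borel_measurable M"
proof -
  have [measurable]: "(\<lambda>\<omega>. green k x m q (zero_col j0 (Xm \<omega>)) i l) \<in> borel_measurable M" for i l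
    by (rule green_borel_measurable) (auto simp: zero_col_def)
  have [measurable]: "(\<lambda>\<omega>. Xm \<omega> i j0) \<in> borel_measurable M" if "i < m" for i
    using that j0 by measurable
  show "schur \<in> borel_measurable M" "schur_diag \<in> borel_measurable M"
    unfolding schur_def[abs_def] schur_diag_def[abs_def] by measurable
qed

text \<open>The three terms are the fluctuation of the quadratic form, the cost of restoring column
  \<open>j0\<close>, and the fluctuation of the trace. They pass through
  \<open>1 / (x * (1 + s))\<close>, which is Lipschitz with constant \<open>1 / x\<close> for
  \<open>s \<ge> 0\<close>. For \<open>k = 1/n\<close> and dimensions of order \<open>n\<close> the
  total is of order \<open>n^(-1/2)\<close>.\<close>

lemma expectation_diag_approx:
  "\<bar>expectation (\<lambda>\<omega>. green k x q m (\<lambda>j i. Xm \<omega> i j) j0 j0) -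
     1 / (x * (1 + k * (\<Sum>i<m. (\<gamma> i j0)\<^sup>2 * expectation (\<lambda>\<omega>. green k x m q (Xm \<omega>) i i))))\<bar>
   \<le> (sqrt ((8 + 2 * \<kappa>) * (k\<^sup>2 * \<Gamma>\<^sup>2 * (real m / x\<^sup>2))) + k * (\<Gamma> / x)
       + k * sqrt (12 * ((2 * \<Gamma> / x)\<^sup>2 * real q))) / x"
\<comment> \<open>Without rows there is no entry from which to deduce
  \<open>\<kappa> \<ge> 0\<close>; in that case both quantities equal \<open>1 / x\<close>.\<close>
proof (cases "m = 0")
  case True
  have "green k x q 0 (\<lambda>j i. Xm \<omega> i j) j0 j0 = 1 / x" for \<omega>
    using green_transpose_diag[OF k x j0, of 0 "Xm \<omega>"] by simp
  then show ?thesis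
    using True k x \<Gamma> by (simp add: prob_space)
next
  case False
  define \<sigma> where "\<sigma> \<omega> = (\<Sum>i<m. (\<gamma> i j0)\<^sup>2 * green k x m q (Xm \<omega>) i i)" for \<omega>
  have q: "q > 0"
    using j0 by simp
  have u: "\<And>i. i < m \<Longrightarrow> \<bar>(\<gamma> i j0)\<^sup>2\<bar> \<le> \<Gamma>"
    using \<gamma> j0 by simp
  have \<kappa>: "\<kappa> \<ge> 0"
    using W_fourth[of 0 j0] False j0 by (auto intro: order_trans[rotated] integral_nonneg_AE)
  have gm [measurable]: "(\<lambda>\<omega>. green k x m q (Xm \<omega>) i l) \<in> borel_measurable M" for i l
    by (rule green_borel_measurable) auto
  have gb: "integrable M (\<lambda>\<omega>. green k x m q (Xm \<omega>) i i)" if "i < m" for i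
    by (rule integrable_const_bound[of _ "1 / x"]) (use green_diag_bounds[OF k x that] in auto)
  have Rm [measurable]: "(\<lambda>\<omega>. green k x q m (\<lambda>j i. Xm \<omega> i j) j0 j0) \<in> borel_measurable M"
    by (rule green_borel_measurable) auto
  have Rint: "integrable M (\<lambda>\<omega>. green k x q m (\<lambda>j i. Xm \<omega> i j) j0 j0)"
    by (rule integrable_const_bound[of _ "1 / x"]) (use green_diag_bounds[OF k x j0] in auto)
  have \<sigma>m [measurable]: "\<sigma> \<in> borel_measurable M"
    unfolding \<sigma>_def by measurable
  have E\<sigma>: "expectation \<sigma> = (\<Sum>i<m. (\<gamma> i j0)\<^sup>2 * expectation (\<lambda>\<omega>. green k x m q (Xm \<omega>) i i))"
    unfolding \<sigma>_def[abs_def] using gb by (simp add: Bochner_Integration.integral_sum)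
  define a where "a = k * expectation \<sigma>"
  have a: "a \<ge> 0"
    unfolding a_def E\<sigma> using k green_diag_bounds(1)[OF k x]
    by (intro mult_nonneg_nonneg sum_nonneg integral_nonneg_AE) auto
  have s0: "schur \<omega> \<ge> 0" for \<omega>
    unfolding schur_def using green_form_nonneg[OF k x] k by (intro mult_nonneg_nonneg) auto
  have R: "green k x q m (\<lambda>j i. Xm \<omega> i j) j0 j0 = 1 / (x * (1 + schur \<omega>))" for \<omega>
    unfolding schur_def by (rule green_transpose_diag[OF k x j0])
  note C1 = expectation_abs_le_sqrt[OF _ schur_concentration]
  have "(\<integral>\<^sup>+\<omega>. ennreal ((\<sigma> \<omega> - expectation \<sigma>)\<^sup>2) \<partial>M) \<le> ennreal (12 * ((2 * \<Gamma> / x)\<^sup>2 * real q))"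
    using green_trace_moments(2)[OF q k x \<Gamma> u, where \<gamma> = \<gamma>] by (simp add: \<sigma>_def[abs_def])
  note C2 = expectation_abs_le_sqrt[OF _ this]
  have i1: "integrable M (\<lambda>\<omega>. \<bar>schur \<omega> - schur_diag \<omega>\<bar>)"
    "expectation (\<lambda>\<omega>. \<bar>schur \<omega> - schur_diag \<omega>\<bar>) \<le> sqrt ((8 + 2 * \<kappa>) * (k\<^sup>2 * \<Gamma>\<^sup>2 * (real m / x\<^sup>2)))"
    by (rule C1; use \<kappa> in simp)+
  have i2: "integrable M (\<lambda>\<omega>. \<bar>\<sigma> \<omega> - expectation \<sigma>\<bar>)"
    "expectation (\<lambda>\<omega>. \<bar>\<sigma> \<omega> - expectation \<sigma>\<bar>) \<le> sqrt (12 * ((2 * \<Gamma> / x)\<^sup>2 * real q))"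
    by (rule C2; simp)+
  have mid: "\<bar>schur_diag \<omega> - k * \<sigma> \<omega>\<bar> \<le> k * (\<Gamma> / x)" for \<omega>
    using green_zero_col_diff[OF k x j0 less_imp_le[OF \<Gamma>], where m = m and u = "\<lambda>i. (\<gamma> i j0)\<^sup>2" and X = "Xm \<omega>", OF u] k
    by (simp add: schur_diag_def \<sigma>_def right_diff_distrib[symmetric] abs_mult mult_left_mono
        del: times_divide_eq_right)
  have pt: "\<bar>1 / (x * (1 + schur \<omega>)) - 1 / (x * (1 + a))\<bar> \<le>
      (\<bar>schur \<omega> - schur_diag \<omega>\<bar> + k * (\<Gamma> / x) + k * \<bar>\<sigma> \<omega> - expectation \<sigma>\<bar>) / x" for \<omega>
  proof -
    let ?s = "schur \<omega>"
    have "1 / (x * (1 + ?s)) - 1 / (x * (1 + a)) = (a - ?s) / ((1 + ?s) * (1 + a)) / x"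
    proof -
      have "x \<noteq> 0" "1 + ?s \<noteq> 0" "1 + a \<noteq> 0"
        using x a s0[of \<omega>] by auto
      then show ?thesis
        by (simp add: divide_simps)
    qed
    then have "\<bar>1 / (x * (1 + ?s)) - 1 / (x * (1 + a))\<bar> = \<bar>a - ?s\<bar> / ((1 + ?s) * (1 + a)) / x"
      using x a s0[of \<omega>] by (simp add: abs_mult)
    also have "\<dots> \<le> \<bar>a - ?s\<bar> / 1 / x"
    proof (intro divide_right_mono divide_left_mono)
      show "1 \<le> (1 + ?s) * (1 + a)"
        using mult_mono[of 1 "1 + ?s" 1 "1 + a"] a s0[of \<omega>] by simp
    qed (use x a s0[of \<omega>] in auto)
    finally have "\<bar>1 / (x * (1 + ?s)) - 1 / (x * (1 + a))\<bar> \<le> \<bar>a - ?s\<bar> / x"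
      by simp
    moreover have "\<bar>a - ?s\<bar> \<le> \<bar>?s - schur_diag \<omega>\<bar> + k * (\<Gamma> / x) + k * \<bar>\<sigma> \<omega> - expectation \<sigma>\<bar>"
    proof -
      have "\<bar>k * \<sigma> \<omega> - k * expectation \<sigma>\<bar> = k * \<bar>\<sigma> \<omega> - expectation \<sigma>\<bar>"
        using k by (simp add: right_diff_distrib[symmetric] abs_mult)
      then show ?thesis
        using mid[of \<omega>] unfolding a_def by linarith
    qed
    ultimately show ?thesis
      using x by (meson divide_right_mono less_imp_le order_trans)
  qed
  have "\<bar>expectation (\<lambda>\<omega>. green k x q m (\<lambda>j i. Xm \<omega> i j) j0 j0) - 1 / (x * (1 + a))\<bar> =
      \<bar>expectation (\<lambda>\<omega>. green k x q m (\<lambda>j i. Xm \<omega> i j) j0 j0 - 1 / (x * (1 + a)))\<bar>"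
    using Rint by (simp add: prob_space)
  also have "\<dots> \<le> expectation (\<lambda>\<omega>. \<bar>green k x q m (\<lambda>j i. Xm \<omega> i j) j0 j0 - 1 / (x * (1 + a))\<bar>)"
    by (rule integral_abs_bound)
  also have "\<dots> \<le> expectation (\<lambda>\<omega>. (\<bar>schur \<omega> - schur_diag \<omega>\<bar> + k * (\<Gamma> / x) + k * \<bar>\<sigma> \<omega> - expectation \<sigma>\<bar>) / x)"
  proof (rule integral_mono)
    show "\<bar>green k x q m (\<lambda>j i. Xm \<omega> i j) j0 j0 - 1 / (x * (1 + a))\<bar> \<le>
        (\<bar>schur \<omega> - schur_diag \<omega>\<bar> + k * (\<Gamma> / x) + k * \<bar>\<sigma> \<omega> - expectation \<sigma>\<bar>) / x" for \<omega>
      unfolding R by (rule pt)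
  qed (use Rint i1(1) i2(1) in auto)
  also have "\<dots> = (expectation (\<lambda>\<omega>. \<bar>schur \<omega> - schur_diag \<omega>\<bar>) + k * (\<Gamma> / x)
      + k * expectation (\<lambda>\<omega>. \<bar>\<sigma> \<omega> - expectation \<sigma>\<bar>)) / x"
    using i1(1) i2(1) by (simp add: prob_space)
  also have "\<dots> \<le> (sqrt ((8 + 2 * \<kappa>) * (k\<^sup>2 * \<Gamma>\<^sup>2 * (real m / x\<^sup>2))) + k * (\<Gamma> / x)
       + k * sqrt (12 * ((2 * \<Gamma> / x)\<^sup>2 * real q))) / x"
    using i1(2) i2(2) k x by (intro divide_right_mono add_mono mult_left_mono) auto
  finally show ?thesis
    by (simp add: a_def E\<sigma>)
qed

end

end

section \<open>From the means to the equivalence\<close>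

text \<open>The expected sum of the fourth powers is finite, so the series converges almost surely
  and its terms vanish in the limit. This suits triangular arrays whose rows are coupled
  arbitrarily.\<close>

lemma (in prob_space) AE_tendsto_zero_fourth_moment:
  assumes Y [measurable]: "\<And>n. Y n \<in> borel_measurable M"
    and le: "\<And>n. (\<integral>\<^sup>+\<omega>. ennreal (Y n \<omega> ^ 4) \<partial>M) \<le> ennreal (B n)"
    and B: "\<And>n. B n \<ge> 0" "summable B"
  shows "AE \<omega> in M. (\<lambda>n. Y n \<omega>) \<longlonglongrightarrow> (0::real)"
proof -
  have "(\<integral>\<^sup>+\<omega>. (\<Sum>n. ennreal (Y n \<omega> ^ 4)) \<partial>M) = (\<Sum>n. \<integral>\<^sup>+\<omega>. ennreal (Y n \<omega> ^ 4) \<partial>M)"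
    by (rule nn_integral_suminf) measurable
  also have "\<dots> \<le> (\<Sum>n. ennreal (B n))"
    by (intro suminf_le le) auto
  also have "\<dots> = ennreal (\<Sum>n. B n)"
    using B by (rule suminf_ennreal2)
  finally have "(\<integral>\<^sup>+\<omega>. (\<Sum>n. ennreal (Y n \<omega> ^ 4)) \<partial>M) \<noteq> \<infinity>"
    by (auto simp: top_unique)
  then have "AE \<omega> in M. (\<Sum>n. ennreal (Y n \<omega> ^ 4)) \<noteq> \<infinity>"
    by (intro nn_integral_PInf_AE) measurable
  then show ?thesis
  proof eventually_elim
    case (elim \<omega>)
    then have "summable (\<lambda>n. Y n \<omega> ^ 4)"
      by (intro summable_suminf_not_top) auto
    then have "(\<lambda>n. Y n \<omega> ^ 4) \<longlonglongrightarrow> 0"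
      by (rule summable_LIMSEQ_zero)
    then show ?case
      by (simp add: power_tendsto_0_iff)
  qed
qed

lemma mat_trace_diag_part_mult:
  assumes "A \<in> carrier_mat m m" "V \<in> carrier_mat m m"
  shows "mat_trace (diag_part A * V) = (\<Sum>i<m. A $$ (i, i) * V $$ (i, i))"
  using assms by (simp add: diag_part_def mat_trace_def mat_diag_mult_left[of _ m m])

lemma mat_trace_mat_diag_mult:
  assumes "V \<in> carrier_mat m m"
  shows "mat_trace (mat_diag m f * V) = (\<Sum>i<m. f i * V $$ (i, i))"
  using assms by (simp add: mat_trace_def mat_diag_mult_left[of _ m m])

text \<open>
  The contraction behind the uniqueness of the deterministic equivalent: for \<open>x\<close> large the
  fixed-point map at \<open>z = -x\<close> is \<open>1/2\<close>-Lipschitz in the supremum norm.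
\<close>

lemma fixed_point_stability:
  fixes a \<tau> b \<theta> :: "nat \<Rightarrow> real"
  assumes x: "x > 0"
    and w: "\<And>i j. i < n \<Longrightarrow> j < p \<Longrightarrow> 0 \<le> w i j"
    and w1: "\<And>j. j < p \<Longrightarrow> (\<Sum>i<n. w i j) \<le> x / 2"
    and w2: "\<And>i. i < n \<Longrightarrow> (\<Sum>j<p. w i j) \<le> x / 2"
    and nonneg: "\<And>j. j < p \<Longrightarrow> 0 \<le> a j" "\<And>j. j < p \<Longrightarrow> 0 \<le> \<tau> j"
      "\<And>i. i < n \<Longrightarrow> 0 \<le> b i" "\<And>i. i < n \<Longrightarrow> 0 \<le> \<theta> i"
    and a: "\<And>j. j < p \<Longrightarrow> \<bar>a j - 1 / (x * (1 + (\<Sum>i<n. w i j * b i)))\<bar> \<le> \<epsilon>"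
    and b: "\<And>i. i < n \<Longrightarrow> \<bar>b i - 1 / (x * (1 + (\<Sum>j<p. w i j * a j)))\<bar> \<le> \<epsilon>"
    and \<tau>: "\<And>j. j < p \<Longrightarrow> \<tau> j = 1 / (x * (1 + (\<Sum>i<n. w i j * \<theta> i)))"
    and \<theta>: "\<And>i. i < n \<Longrightarrow> \<theta> i = 1 / (x * (1 + (\<Sum>j<p. w i j * \<tau> j)))"
    and \<epsilon>: "\<epsilon> \<ge> 0"
  shows "\<And>j. j < p \<Longrightarrow> \<bar>a j - \<tau> j\<bar> \<le> 2 * \<epsilon>" and "\<And>i. i < n \<Longrightarrow> \<bar>b i - \<theta> i\<bar> \<le> 2 * \<epsilon>"
proof -
  \<comment> \<open>Inserting 0 keeps the maximum defined when both index ranges are empty and makes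
    it nonnegative.\<close>
  define S where "S = insert 0 ((\<lambda>j. \<bar>a j - \<tau> j\<bar>) ` {..<p} \<union> (\<lambda>i. \<bar>b i - \<theta> i\<bar>) ` {..<n})"
  define d where "d = Max S"
  have S: "finite S" "S \<noteq> {}"
    by (auto simp: S_def)
  have d0: "d \<ge> 0" and da: "\<And>j. j < p \<Longrightarrow> \<bar>a j - \<tau> j\<bar> \<le> d" and db: "\<And>i. i < n \<Longrightarrow> \<bar>b i - \<theta> i\<bar> \<le> d"
    unfolding d_def by (rule Max_ge[OF S(1)], simp add: S_def)+
  have lip: "\<bar>1 / (x * (1 + s)) - 1 / (x * (1 + t))\<bar> \<le> \<bar>s - t\<bar> / x" if "s \<ge> 0" "t \<ge> 0" for s t
  proof -
    have "1 / (x * (1 + s)) - 1 / (x * (1 + t)) = (t - s) / ((1 + s) * (1 + t)) / x"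
    proof -
      have "x \<noteq> 0" "1 + s \<noteq> 0" "1 + t \<noteq> 0"
        using x that by auto
      then show ?thesis
        by (simp add: divide_simps)
    qed
    then have "\<bar>1 / (x * (1 + s)) - 1 / (x * (1 + t))\<bar> = \<bar>s - t\<bar> / ((1 + s) * (1 + t)) / x"
      using x that by (simp add: abs_mult abs_minus_commute)
    also have "\<dots> \<le> \<bar>s - t\<bar> / 1 / x"
    proof (intro divide_right_mono divide_left_mono)
      show "1 \<le> (1 + s) * (1 + t)"
        using mult_mono[of 1 "1 + s" 1 "1 + t"] that by simp
    qed (use x that in auto)
    finally show ?thesis
      by simp
  qed
  have lin: "\<bar>(\<Sum>i<N. v i * f i) - (\<Sum>i<N. v i * g i)\<bar> \<le> x / 2 * d"
    if "\<And>i. i < N \<Longrightarrow> 0 \<le> v i" "(\<Sum>i<N. v i) \<le> x / 2" "\<And>i. i < N \<Longrightarrow> \<bar>f i - g i\<bar> \<le> d" for N and v f g :: "nat \<Rightarrow> real"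
  proof -
    have "\<bar>(\<Sum>i<N. v i * f i) - (\<Sum>i<N. v i * g i)\<bar> = \<bar>\<Sum>i<N. v i * (f i - g i)\<bar>"
      by (simp add: sum_subtractf right_diff_distrib)
    also have "\<dots> \<le> (\<Sum>i<N. v i * d)"
      by (intro order_trans[OF sum_abs] sum_mono) (auto simp: abs_mult that intro!: mult_left_mono)
    also have "\<dots> = (\<Sum>i<N. v i) * d"
      by (simp add: sum_distrib_right)
    also have "\<dots> \<le> x / 2 * d"
      by (intro mult_right_mono that d0)
    finally show ?thesis .
  qed
  have 1: "\<bar>a j - \<tau> j\<bar> \<le> \<epsilon> + d / 2" if j: "j < p" for j
  proof -
    have "\<bar>1 / (x * (1 + (\<Sum>i<n. w i j * b i))) - \<tau> j\<bar> \<le> \<bar>(\<Sum>i<n. w i j * b i) - (\<Sum>i<n. w i j * \<theta> i)\<bar> / x"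
      unfolding \<tau>[OF j] using nonneg w j by (intro lip sum_nonneg mult_nonneg_nonneg) auto
    also have "\<dots> \<le> (x / 2 * d) / x"
      using x w j w1 db by (intro divide_right_mono lin) auto
    also have "\<dots> = d / 2"
      using x by simp
    finally show ?thesis
      using a[OF j] by linarith
  qed
  have 2: "\<bar>b i - \<theta> i\<bar> \<le> \<epsilon> + d / 2" if i: "i < n" for i
  proof -
    have "\<bar>1 / (x * (1 + (\<Sum>j<p. w i j * a j))) - \<theta> i\<bar> \<le> \<bar>(\<Sum>j<p. w i j * a j) - (\<Sum>j<p. w i j * \<tau> j)\<bar> / x"
      unfolding \<theta>[OF i] using nonneg w i by (intro lip sum_nonneg mult_nonneg_nonneg) auto
    also have "\<dots> \<le> (x / 2 * d) / x"
      using x w i w2 da by (intro divide_right_mono lin) auto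
    also have "\<dots> = d / 2"
      using x by simp
    finally show ?thesis
      using b[OF i] by linarith
  qed
  \<comment> \<open>The Lipschitz constant \<open>1/2\<close> is absorbed on the left:
    \<open>d \<le> \<epsilon> + d / 2\<close> gives \<open>d \<le> 2 * \<epsilon>\<close>.\<close>
  have "Max S \<le> \<epsilon> + d / 2"
    using 1 2 \<epsilon> d0 by (subst Max_le_iff[OF S]) (auto simp: S_def)
  then have "d \<le> 2 * \<epsilon>"
    unfolding d_def[symmetric] by simp
  then show "\<And>j. j < p \<Longrightarrow> \<bar>a j - \<tau> j\<bar> \<le> 2 * \<epsilon>" "\<And>i. i < n \<Longrightarrow> \<bar>b i - \<theta> i\<bar> \<le> 2 * \<epsilon>"
    using da db by (meson order_trans)+
qed

lemma compact_slit_infdist_bound: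
  assumes "compact S" "S \<subseteq> slit"
  shows "\<exists>B. \<forall>w\<in>S. 1 / infdist w \<real>\<^sub>\<ge>\<^sub>0 \<le> B"
proof -
  have "continuous_on S (\<lambda>w. 1 / infdist w \<real>\<^sub>\<ge>\<^sub>0)"
    using assms(2) infdist_slit_pos by (intro continuous_intros) fastforce
  then have "bounded ((\<lambda>w. 1 / infdist w \<real>\<^sub>\<ge>\<^sub>0) ` S)"
    using assms(1) compact_continuous_image compact_imp_bounded by blast
  then obtain B where B: "\<forall>y\<in>(\<lambda>w. 1 / infdist w \<real>\<^sub>\<ge>\<^sub>0) ` S. norm y \<le> B"
    by (auto simp: bounded_iff)
  have "1 / infdist w \<real>\<^sub>\<ge>\<^sub>0 \<le> B" if "w \<in> S" for w
    by (rule abs_le_D1) (use B that in auto)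
  then show ?thesis
    by blast
qed

text \<open>The triangle inequality for an average. An empty average is 0 by total division, which
  \<open>B \<ge> 0\<close> accommodates.\<close>

lemma weighted_mean_le:
  fixes v :: "nat \<Rightarrow> 'b::real_normed_field"
  assumes "\<And>i. i < m \<Longrightarrow> norm (v i) \<le> B" "B \<ge> 0"
  shows "norm (1 / of_nat m * (\<Sum>i<m. v i)) \<le> B"
proof (cases "m = 0")
  case False
  have "norm (\<Sum>i<m. v i) \<le> (\<Sum>i<m. B)"
    using assms by (intro sum_norm_le) auto
  then show ?thesis
    using False by (simp add: norm_mult norm_divide field_simps)
qed (use assms in simp)

text \<open>
  Convergence at countably many negative reals is enough: the normalized traces are holomorphic and
  locally bounded off the half-line, so Vitali's theorem propagates it, also to the derivatives.
\<close>

lemma mat_family_equiv_resolvent: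
  fixes m q :: "nat \<Rightarrow> nat" and W :: "nat \<Rightarrow> nat \<Rightarrow> nat \<Rightarrow> 'w \<Rightarrow> real"
    and t :: "nat \<Rightarrow> nat \<Rightarrow> complex \<Rightarrow> complex"
  assumes arr: "\<And>n. n \<ge> 1 \<Longrightarrow> random_array_moments M (m n) (q n) (W n) \<kappa>"
    and c1: "c1 > 0" and dims: "\<forall>\<^sub>F n in sequentially. c1 * real n \<le> real (m n) \<and> q n > 0 \<and> real (q n) \<le> c2 * real n"
    and st: "\<And>n i. n \<ge> 1 \<Longrightarrow> i < m n \<Longrightarrow> stieltjes_class (t n i)"
    and approx: "\<And>x. x > x0 \<Longrightarrow> \<exists>\<delta>. \<delta> \<longlonglongrightarrow> 0 \<and> (\<forall>\<^sub>F n in sequentially. \<forall>i<m n.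
        cmod (complex_of_real (\<integral>\<omega>. green (1 / real n) x (m n) (q n) (\<lambda>i j. \<gamma> n i j * W n i j \<omega>) i i \<partial>M)
          - t n i (- complex_of_real x)) \<le> \<delta> n)"
    and x0: "x0 > 0" and z: "z \<in> slit"
  defines "R \<equiv> (\<lambda>n \<omega>. resolvent (gram (1 / real n) (m n) (q n) (\<lambda>i j. \<gamma> n i j * W n i j \<omega>)))"
  shows "mat_family_equiv M m (\<lambda>n \<omega>. diag_part (R n \<omega> z)) (\<lambda>n \<omega>. mat_diag (m n) (\<lambda>i. t n i z))"
    and "mat_family_equiv M m (\<lambda>n \<omega>. diag_part (mat_deriv (R n \<omega>) z))
      (\<lambda>n \<omega>. mat_deriv (\<lambda>w. mat_diag (m n) (\<lambda>i. t n i w)) z)"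
proof -
  interpret prob_space M
    using arr[of 1] by (simp add: random_array_moments_def random_array_def)
  have k: "1 / real n \<ge> 0" for n
    by simp
  \<comment> \<open>The common core of both equivalences: \<open>u n\<close> holds the diagonal of
    the test matrix, and \<open>f n \<omega>\<close> is the normalized trace difference as a
    function of the spectral parameter.\<close>
  have main: "AE \<omega> in M. (\<lambda>n. f n \<omega> z) \<longlonglongrightarrow> 0 \<and> (\<lambda>n. deriv (f n \<omega>) z) \<longlonglongrightarrow> 0"
    if u: "\<And>n i. n \<ge> 1 \<Longrightarrow> i < m n \<Longrightarrow> \<bar>u n i\<bar> \<le> K" and K: "K > 0"
      and f: "\<And>n \<omega> w. f n \<omega> w = 1 / of_nat (m n) * (\<Sum>i<m n. complex_of_real (u n i) * (R n \<omega> w $$ (i, i) - t n i w))"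
    for u :: "nat \<Rightarrow> nat \<Rightarrow> real" and K and f :: "nat \<Rightarrow> 'w \<Rightarrow> complex \<Rightarrow> complex"
  proof -
    have pointwise: "AE \<omega> in M. (\<lambda>n. f n \<omega> (- complex_of_real x)) \<longlonglongrightarrow> 0" if x: "x > x0" for x
    proof -
      have xp: "x > 0"
        using x x0 by simp
      define g where "g n i \<omega> = green (1 / real n) x (m n) (q n) (\<lambda>i j. \<gamma> n i j * W n i j \<omega>) i i" for n i \<omega>
      obtain \<delta> where \<delta>: "\<delta> \<longlonglongrightarrow> 0" "\<forall>\<^sub>F n in sequentially. \<forall>i<m n.
          cmod (complex_of_real (expectation (g n i)) - t n i (- complex_of_real x)) \<le> \<delta> n"
        using approx[OF x] unfolding g_def by auto
      define D where "D n \<omega> = (\<Sum>i<m n. u n i * g n i \<omega>) - expectation (\<lambda>\<omega>. \<Sum>i<m n. u n i * g n i \<omega>)" for n \<omega>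
      obtain N where N: "\<And>n. n \<ge> N \<Longrightarrow> c1 * real n \<le> real (m n) \<and> q n > 0 \<and> real (q n) \<le> c2 * real n"
        using dims by (auto simp: eventually_sequentially)
      \<comment> \<open>The successor ensures \<open>n + N' \<ge> 1\<close> besides
        \<open>n + N' \<ge> N\<close>.\<close>
      define N' where "N' = Suc N"
      \<comment> \<open>The trace moment \<open>384 (2K/x)^4 q^2\<close> divided by
        \<open>m^4\<close>, with \<open>q \<le> c2 n\<close> and \<open>m \<ge> c1 n\<close>; the
        remaining factor is the summable \<open>n^(-2)\<close>.\<close>
      define B where "B = 384 * (2 * K / x) ^ 4 * c2\<^sup>2 / c1 ^ 4"
      have gm [measurable]: "g n i \<in> borel_measurable M" if "n \<ge> 1" for n i
      proof -
        interpret random_array_moments M "m n" "q n" "W n" \<kappa>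
          by (rule arr[OF that])
        show ?thesis
          unfolding g_def by (rule green_borel_measurable) measurable
      qed
      have gint: "integrable M (g n i)" if "n \<ge> 1" "i < m n" for n i
      proof (rule integrable_const_bound[of _ "1 / x"])
        show "AE \<omega> in M. norm (g n i \<omega>) \<le> 1 / x"
          using green_diag_bounds(1,2)[OF k xp that(2)] by (intro AE_I2) (simp add: g_def)
        show "g n i \<in> borel_measurable M"
          by (rule gm[OF that(1)])
      qed
      have "AE \<omega> in M. (\<lambda>n. D (n + N') \<omega> / real (m (n + N'))) \<longlonglongrightarrow> 0"
      proof (rule AE_tendsto_zero_fourth_moment[where B = "\<lambda>n. B / (real (n + N'))\<^sup>2"])
        fix n
        define n' where "n' = n + N'"
        have n': "n' \<ge> 1" "n' \<ge> N"
          by (auto simp: n'_def N'_def)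
        interpret A: random_array_moments M "m n'" "q n'" "W n'" \<kappa>
          by (rule arr) fact
        have [measurable]: "D n' \<in> borel_measurable M"
          unfolding D_def using gm[OF n'(1)] by measurable
        show "(\<lambda>\<omega>. D (n + N') \<omega> / real (m (n + N'))) \<in> borel_measurable M"
          unfolding n'_def[symmetric] by measurable
        have q: "q n' > 0" and mn: "c1 * real n' \<le> real (m n')" and qn: "real (q n') \<le> c2 * real n'"
          using N[OF n'(2)] by auto
        have mp: "0 < real (m n')"
          by (rule order.strict_trans2[OF mult_pos_pos[OF c1] mn]) (use n'(1) in simp)
        have "(\<integral>\<^sup>+\<omega>. ennreal (D n' \<omega> ^ 4) \<partial>M) \<le> ennreal (384 * ((2 * K / x) ^ 4 * (real (q n'))\<^sup>2))"
          using A.green_trace_moments(1)[OF q k xp K u[OF n'(1)], where \<gamma> = "\<gamma> n'"]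
          by (simp add: D_def g_def)
        then have "(\<integral>\<^sup>+\<omega>. ennreal (1 / real (m n') ^ 4) * ennreal (D n' \<omega> ^ 4) \<partial>M) \<le>
            ennreal (1 / real (m n') ^ 4) * ennreal (384 * ((2 * K / x) ^ 4 * (real (q n'))\<^sup>2))"
          by (subst nn_integral_cmult) (auto intro: mult_left_mono)
        also have "\<dots> = ennreal (1 / real (m n') ^ 4 * (384 * ((2 * K / x) ^ 4 * (real (q n'))\<^sup>2)))"
          by (rule ennreal_mult[symmetric]) (use K xp in auto)
        also have "1 / real (m n') ^ 4 * (384 * ((2 * K / x) ^ 4 * (real (q n'))\<^sup>2)) \<le>
            1 / (c1 * real n') ^ 4 * (384 * ((2 * K / x) ^ 4 * (c2 * real n')\<^sup>2))"
          using mn qn c1 n'(1) mp K xp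
          by (intro mult_mono divide_left_mono power_mono mult_pos_pos zero_less_power mult_nonneg_nonneg) auto
        also have "\<dots> = B / (real n')\<^sup>2"
          using n'(1) by (simp add: B_def field_simps power2_eq_square power4_eq_xxxx)
        finally show "(\<integral>\<^sup>+\<omega>. ennreal ((D (n + N') \<omega> / real (m (n + N'))) ^ 4) \<partial>M) \<le> ennreal (B / (real (n + N'))\<^sup>2)"
          unfolding n'_def[symmetric] using mp
          by (simp add: ennreal_mult[symmetric] power_divide ennreal_leI)
      next
        show "0 \<le> B / (real (n + N'))\<^sup>2" for n
          by (simp add: B_def)
        have "summable (\<lambda>n. inverse ((real n)\<^sup>2))"
          using inverse_power_summable[of 2] by simp
        then have "summable (\<lambda>n. inverse ((real (n + N'))\<^sup>2))"
          by (subst summable_iff_shift)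
        from summable_mult[OF this, of B] show "summable (\<lambda>n. B / (real (n + N'))\<^sup>2)"
          by (simp add: divide_inverse)
      qed
      then show ?thesis
      proof eventually_elim
        case (elim \<omega>)
        then have lim1: "(\<lambda>n. D n \<omega> / real (m n)) \<longlonglongrightarrow> 0"
          by (rule LIMSEQ_offset)
        \<comment> \<open>The deterministic bias. At \<open>-x\<close>, \<open>f\<close> is the
          centered trace divided by \<open>m n\<close> plus this average of the entrywise errors in
          mean.\<close>
        define r where "r n = 1 / of_nat (m n) * (\<Sum>i<m n. complex_of_real (u n i) *
            (complex_of_real (expectation (g n i)) - t n i (- complex_of_real x)))" for n
        have "(\<lambda>n. K * \<delta> n) \<longlonglongrightarrow> 0"
          using tendsto_mult_left[OF \<delta>(1), of K] by simp
        moreover have "\<forall>\<^sub>F n in sequentially. cmod (r n) \<le> K * \<bar>\<delta> n\<bar>"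
          using \<delta>(2) eventually_ge_at_top[of 1]
        proof eventually_elim
          case (elim n)
          show ?case
            unfolding r_def
          proof (rule weighted_mean_le)
            fix i assume i: "i < m n"
            have "cmod (complex_of_real (expectation (g n i)) - t n i (- complex_of_real x)) \<le> \<bar>\<delta> n\<bar>"
              using elim(1) i by fastforce
            then show "cmod (complex_of_real (u n i) * (complex_of_real (expectation (g n i)) - t n i (- complex_of_real x))) \<le> K * \<bar>\<delta> n\<bar>"
              using u[OF elim(2) i] K by (simp add: norm_mult mult_mono)
          qed (use K in simp)
        qed
        ultimately have lim2: "r \<longlonglongrightarrow> 0"
          using K by (intro Lim_null_comparison[of r "\<lambda>n. K * \<bar>\<delta> n\<bar>"])
            (auto dest: tendsto_rabs simp: abs_mult)
        have "f n \<omega> (- complex_of_real x) = complex_of_real (D n \<omega> / real (m n)) + r n" if n: "n \<ge> 1" for n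
        proof -
          have E: "expectation (\<lambda>\<omega>. \<Sum>i<m n. u n i * g n i \<omega>) = (\<Sum>i<m n. u n i * expectation (g n i))"
            using gint[OF n] by (simp add: Bochner_Integration.integral_sum)
          have "R n \<omega> (- complex_of_real x) $$ (i, i) = complex_of_real (g n i \<omega>)" if "i < m n" for i
            unfolding R_def g_def by (rule resolvent_eq_green[OF k xp that that])
          then have "f n \<omega> (- complex_of_real x) = 1 / of_nat (m n) * (\<Sum>i<m n. complex_of_real (u n i) *
              (complex_of_real (g n i \<omega>) - t n i (- complex_of_real x)))"
            by (simp add: f)
          also have "\<dots> = complex_of_real (D n \<omega> / real (m n)) + r n"
            unfolding r_def D_def E
            by (simp add: right_diff_distrib sum_subtractf diff_divide_distrib add_divide_distrib)
          finally show ?thesis .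
        qed
        then have ev: "\<forall>\<^sub>F n in sequentially. complex_of_real (D n \<omega> / real (m n)) + r n = f n \<omega> (- complex_of_real x)"
          by (intro eventually_sequentiallyI[of 1]) simp
        have "(\<lambda>n. complex_of_real (D n \<omega> / real (m n)) + r n) \<longlonglongrightarrow> 0"
          using tendsto_add[OF tendsto_of_real[OF lim1] lim2] by simp
        then show "(\<lambda>n. f n \<omega> (- complex_of_real x)) \<longlonglongrightarrow> 0"
          by (rule Lim_transform_eventually) (rule ev)
      qed
    qed
    \<comment> \<open>Countably many points, so the exceptional null sets can be united. They exceed
      \<open>x0\<close> and accumulate at \<open>x0 + 1\<close>, whose negative lies inside the slit
      plane as the identity theorem requires.\<close>
    define y where "y l = x0 + 1 + inverse (real (Suc l))" for l :: nat
    have y: "y l > x0" for l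
      by (simp add: y_def add_pos_pos)
    have "AE \<omega> in M. \<forall>l. (\<lambda>n. f n \<omega> (- complex_of_real (y l))) \<longlonglongrightarrow> 0"
      by (subst AE_all_countable) (intro allI pointwise y)
    then show ?thesis
    proof eventually_elim
      case (elim \<omega>)
      \<comment> \<open>The Stieltjes property and the bound on \<open>u\<close> hold for
        \<open>n \<ge> 1\<close>, whereas \<open>vitali\<close> asks for holomorphy and bounds at
        every index; the shift leaves the limits unchanged.\<close>
      define F where "F n = f (Suc n) \<omega>" for n
      define \<xi> where "\<xi> = - complex_of_real (x0 + 1)"
      have entry: "(\<lambda>w. R n \<omega> w $$ (i, i)) holomorphic_on slit" if "i < m n" for n i
        unfolding R_def by (rule resolvent_entry_holomorphic[OF k that that])
      have hol: "F n holomorphic_on slit" for n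
        unfolding F_def f[abs_def]
        by (intro holomorphic_intros entry stieltjes_class_props(1) st) auto
      have bdd: "\<exists>B. \<forall>n. \<forall>w\<in>S. cmod (F n w) \<le> B" if S: "compact S" "S \<subseteq> slit" for S
      proof -
        obtain B where B: "\<forall>w\<in>S. 1 / infdist w \<real>\<^sub>\<ge>\<^sub>0 \<le> B"
          using compact_slit_infdist_bound[OF S] by blast
        have "cmod (F n w) \<le> K * (\<bar>B\<bar> + \<bar>B\<bar>)" if w: "w \<in> S" for n w
          unfolding F_def f
        proof (rule weighted_mean_le)
          fix i assume i: "i < m (Suc n)"
          have ws: "w \<in> slit"
            using w S(2) by blast
          have Bw: "1 / infdist w \<real>\<^sub>\<ge>\<^sub>0 \<le> \<bar>B\<bar>"
            by (rule order_trans[OF _ abs_ge_self]) (use B w in blast)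
          have "cmod (R (Suc n) \<omega> w $$ (i, i)) \<le> \<bar>B\<bar>"
            unfolding R_def by (rule order_trans[OF resolvent_entry_bound[OF k ws i] Bw])
          moreover have "cmod (t (Suc n) i w) \<le> \<bar>B\<bar>"
            by (rule order_trans[OF stieltjes_class_props(2)[OF st[OF _ i] ws] Bw]) simp
          ultimately have "cmod (R (Suc n) \<omega> w $$ (i, i) - t (Suc n) i w) \<le> \<bar>B\<bar> + \<bar>B\<bar>"
            using norm_triangle_ineq4[of "R (Suc n) \<omega> w $$ (i, i)" "t (Suc n) i w"] by linarith
          then show "cmod (complex_of_real (u (Suc n) i) * (R (Suc n) \<omega> w $$ (i, i) - t (Suc n) i w)) \<le> K * (\<bar>B\<bar> + \<bar>B\<bar>)"
            using u[OF _ i] K unfolding norm_mult by (intro mult_mono) auto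
        qed (use K in simp)
        then show ?thesis
          by blast
      qed
      have yp: "y l > 0" for l
        using y[of l] x0 by linarith
      have sub: "range (\<lambda>l. - complex_of_real (y l)) \<subseteq> slit"
        using yp by (auto simp: complex_nonneg_Reals_iff simp flip: not_less)
      have \<xi>: "\<xi> \<in> slit"
        using x0 by (simp add: \<xi>_def complex_nonneg_Reals_iff)
      have lp: "\<xi> islimpt range (\<lambda>l. - complex_of_real (y l))"
        unfolding islimpt_sequential
      proof (intro exI conjI allI)
        show "- complex_of_real (y l) \<in> range (\<lambda>l. - complex_of_real (y l)) - {\<xi>}" for l
          by (simp add: \<xi>_def y_def del: of_real_add of_real_inverse)
        have "y \<longlonglongrightarrow> x0 + 1"
          unfolding y_def[abs_def] using tendsto_add[OF tendsto_const LIMSEQ_inverse_real_of_nat, of "x0 + 1"] by simp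
        then show "(\<lambda>l. - complex_of_real (y l)) \<longlonglongrightarrow> \<xi>"
          unfolding \<xi>_def by (intro tendsto_intros)
      qed
      have conv: "(\<lambda>n. F n v) \<longlonglongrightarrow> 0" if v: "v \<in> range (\<lambda>l. - complex_of_real (y l))" for v
      proof -
        obtain l where "v = - complex_of_real (y l)"
          using v by blast
        then show ?thesis
          unfolding F_def using elim LIMSEQ_Suc[of "\<lambda>n. f n \<omega> v"] by simp
      qed
      note vitali[OF open_slit connected_slit hol bdd sub \<xi> lp conv z]
      then show "(\<lambda>n. f n \<omega> z) \<longlonglongrightarrow> 0 \<and> (\<lambda>n. deriv (f n \<omega>) z) \<longlonglongrightarrow> 0"
        unfolding F_def
        using LIMSEQ_imp_Suc[of "\<lambda>n. f n \<omega> z"] LIMSEQ_imp_Suc[of "\<lambda>n. deriv (f n \<omega>) z"] by blast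
    qed
  qed
  have Rc: "R n \<omega> z \<in> carrier_mat (m n) (m n)" for n \<omega>
    unfolding R_def by (rule resolvent_carrier[OF k z])
  show "mat_family_equiv M m (\<lambda>n \<omega>. diag_part (R n \<omega> z)) (\<lambda>n \<omega>. mat_diag (m n) (\<lambda>i. t n i z))"
    unfolding mat_family_equiv_def
  proof (intro allI impI)
    fix U :: "nat \<Rightarrow> real mat"
    assume U: "\<forall>n\<ge>1. U n \<in> carrier_mat (m n) (m n)" and "\<exists>K>0. \<forall>n\<ge>1. \<forall>i<m n. \<bar>U n $$ (i, i)\<bar> \<le> K"
    then obtain K where K: "K > 0" "\<And>n i. n \<ge> 1 \<Longrightarrow> i < m n \<Longrightarrow> \<bar>U n $$ (i, i)\<bar> \<le> K"
      by blast
    define f where "f n \<omega> w = 1 / of_nat (m n) * (\<Sum>i<m n. complex_of_real (U n $$ (i, i)) * (R n \<omega> w $$ (i, i) - t n i w))" for n \<omega> w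
    have "AE \<omega> in M. (\<lambda>n. f n \<omega> z) \<longlonglongrightarrow> 0 \<and> (\<lambda>n. deriv (f n \<omega>) z) \<longlonglongrightarrow> 0"
      by (rule main[OF K(2) K(1) f_def])
    then show "AE \<omega> in M. (\<lambda>n. cmod (1 / of_nat (m n) * mat_trace (diag_part (R n \<omega> z) * map_mat complex_of_real (U n)) -
        1 / of_nat (m n) * mat_trace (mat_diag (m n) (\<lambda>i. t n i z) * map_mat complex_of_real (U n)))) \<longlonglongrightarrow> 0"
    proof eventually_elim
      case (elim \<omega>)
      then have "(\<lambda>n. cmod (f n \<omega> z)) \<longlonglongrightarrow> 0"
        by (auto intro: tendsto_norm_zero)
      moreover have "\<forall>\<^sub>F n in sequentially. cmod (f n \<omega> z) =
          cmod (1 / of_nat (m n) * mat_trace (diag_part (R n \<omega> z) * map_mat complex_of_real (U n)) -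
            1 / of_nat (m n) * mat_trace (mat_diag (m n) (\<lambda>i. t n i z) * map_mat complex_of_real (U n)))"
        using eventually_ge_at_top[of 1]
      proof eventually_elim
        case (elim n)
        then have Un: "U n \<in> carrier_mat (m n) (m n)" and V: "map_mat complex_of_real (U n) \<in> carrier_mat (m n) (m n)"
          using U by auto
        show ?case
          unfolding mat_trace_diag_part_mult[OF Rc V] mat_trace_mat_diag_mult[OF V] f_def
            right_diff_distrib[symmetric] sum_subtractf[symmetric]
          using Un by (intro arg_cong[where f = cmod] arg_cong2[where f = "(*)"] refl sum.cong) (auto simp: algebra_simps)
      qed
      ultimately show ?case
        by (rule Lim_transform_eventually)
    qed
  qed
  show "mat_family_equiv M m (\<lambda>n \<omega>. diag_part (mat_deriv (R n \<omega>) z))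
      (\<lambda>n \<omega>. mat_deriv (\<lambda>w. mat_diag (m n) (\<lambda>i. t n i w)) z)"
    unfolding mat_family_equiv_def
  proof (intro allI impI)
    fix U :: "nat \<Rightarrow> real mat"
    assume U: "\<forall>n\<ge>1. U n \<in> carrier_mat (m n) (m n)" and "\<exists>K>0. \<forall>n\<ge>1. \<forall>i<m n. \<bar>U n $$ (i, i)\<bar> \<le> K"
    then obtain K where K: "K > 0" "\<And>n i. n \<ge> 1 \<Longrightarrow> i < m n \<Longrightarrow> \<bar>U n $$ (i, i)\<bar> \<le> K"
      by blast
    define f where "f n \<omega> w = 1 / of_nat (m n) * (\<Sum>i<m n. complex_of_real (U n $$ (i, i)) * (R n \<omega> w $$ (i, i) - t n i w))" for n \<omega> w
    have "AE \<omega> in M. (\<lambda>n. f n \<omega> z) \<longlonglongrightarrow> 0 \<and> (\<lambda>n. deriv (f n \<omega>) z) \<longlonglongrightarrow> 0"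
      by (rule main[OF K(2) K(1) f_def])
    then show "AE \<omega> in M. (\<lambda>n. cmod (1 / of_nat (m n) * mat_trace (diag_part (mat_deriv (R n \<omega>) z) * map_mat complex_of_real (U n)) -
        1 / of_nat (m n) * mat_trace (mat_deriv (\<lambda>w. mat_diag (m n) (\<lambda>i. t n i w)) z * map_mat complex_of_real (U n)))) \<longlonglongrightarrow> 0"
    proof eventually_elim
      case (elim \<omega>)
      then have "(\<lambda>n. cmod (deriv (f n \<omega>) z)) \<longlonglongrightarrow> 0"
        by (auto intro: tendsto_norm_zero)
      moreover have "\<forall>\<^sub>F n in sequentially. cmod (deriv (f n \<omega>) z) =
          cmod (1 / of_nat (m n) * mat_trace (diag_part (mat_deriv (R n \<omega>) z) * map_mat complex_of_real (U n)) -
            1 / of_nat (m n) * mat_trace (mat_deriv (\<lambda>w. mat_diag (m n) (\<lambda>i. t n i w)) z * map_mat complex_of_real (U n)))"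
        using eventually_ge_at_top[of 1]
      proof eventually_elim
        case (elim n)
        then have Un: "U n \<in> carrier_mat (m n) (m n)" and V: "map_mat complex_of_real (U n) \<in> carrier_mat (m n) (m n)"
          using U by auto
        have dR: "((\<lambda>w. R n \<omega> w $$ (i, i)) has_field_derivative deriv (\<lambda>w. R n \<omega> w $$ (i, i)) z) (at z)" if "i < m n" for i
          unfolding R_def
          by (rule holomorphic_derivI[OF resolvent_entry_holomorphic[OF k that that] open_slit z])
        have dt: "(t n i has_field_derivative deriv (t n i) z) (at z)" if "i < m n" for i
          by (rule holomorphic_derivI[OF stieltjes_class_props(1)[OF st[OF elim that]] open_slit z])
        have df: "deriv (f n \<omega>) z = 1 / of_nat (m n) * (\<Sum>i<m n. complex_of_real (U n $$ (i, i)) *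
            (deriv (\<lambda>w. R n \<omega> w $$ (i, i)) z - deriv (t n i) z))"
          unfolding f_def[abs_def]
          by (intro DERIV_imp_deriv DERIV_cmult DERIV_sum DERIV_diff dR dt) auto
        have md: "mat_deriv (R n \<omega>) z \<in> carrier_mat (m n) (m n)"
          using Rc[of n \<omega>] by (auto simp: mat_deriv_def)
        have mt: "mat_deriv (\<lambda>w. mat_diag (m n) (\<lambda>i. t n i w)) z = mat_diag (m n) (\<lambda>i. deriv (t n i) z)"
          by (intro eq_matI) (auto simp: mat_deriv_def mat_diag_def)
        show ?case
          unfolding mat_trace_diag_part_mult[OF md V] mt mat_trace_mat_diag_mult[OF V] df
            right_diff_distrib[symmetric] sum_subtractf[symmetric]
          using Un Rc[of n \<omega>]
          by (intro arg_cong[where f = cmod] arg_cong2[where f = "(*)"] refl sum.cong)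
             (auto simp: algebra_simps mat_deriv_def)
      qed
      ultimately show ?case
        by (rule Lim_transform_eventually)
    qed
  qed
qed

section \<open>Comparison of the mean diagonal entries with the deterministic system\<close>

lemma mat_trace_mat_diag: "mat_trace (mat_diag m f) = (\<Sum>i<m. f i)"
  by (simp add: mat_trace_def mat_diag_def)

text \<open>At \<open>-x\<close> Stieltjes transforms of measures on the half-line are nonnegative
  reals, so the system becomes a real one; the sign in \<open>-1 / z\<close> turns into
  \<open>1 / x\<close>.\<close>

lemma diag_equiv_solution_real:
  assumes sol: "diag_equiv_solution n p \<gamma> T Tt" and x: "x > 0"
  obtains \<tau> \<theta> where
    "\<And>j. j < p \<Longrightarrow> 0 \<le> \<tau> j" "\<And>i. i < n \<Longrightarrow> 0 \<le> \<theta> i"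
    "\<And>j. j < p \<Longrightarrow> T j (- complex_of_real x) = complex_of_real (\<tau> j)"
    "\<And>i. i < n \<Longrightarrow> Tt i (- complex_of_real x) = complex_of_real (\<theta> i)"
    "\<And>j. j < p \<Longrightarrow> \<tau> j = 1 / (x * (1 + (\<Sum>i<n. (\<gamma> i j)\<^sup>2 / real n * \<theta> i)))"
    "\<And>i. i < n \<Longrightarrow> \<theta> i = 1 / (x * (1 + (\<Sum>j<p. (\<gamma> i j)\<^sup>2 / real n * \<tau> j)))"
proof -
  define w where "w = - complex_of_real x"
  have w: "w \<notin> \<real>\<^sub>\<ge>\<^sub>0"
    using minus_of_real_in_slit[OF x] by (simp add: w_def)
  define \<tau> \<theta> where "\<tau> j = Re (T j w)" and "\<theta> i = Re (Tt i w)" for i j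
  have T: "T j w = complex_of_real (\<tau> j)" "0 \<le> \<tau> j" if "j < p" for j
    using stieltjes_class_props(3)[OF _ x, of "T j"] sol that
    by (auto simp: diag_equiv_solution_def w_def \<tau>_def)
  have Tt: "Tt i w = complex_of_real (\<theta> i)" "0 \<le> \<theta> i" if "i < n" for i
    using stieltjes_class_props(3)[OF _ x, of "Tt i"] sol that
    by (auto simp: diag_equiv_solution_def w_def \<theta>_def)
  have tr1: "(1 / of_nat n) * mat_trace (D_col n \<gamma> j * mat_diag n (\<lambda>i. Tt i w)) =
      complex_of_real (\<Sum>i<n. (\<gamma> i j)\<^sup>2 / real n * \<theta> i)" for j
    by (simp add: D_col_def mat_diag_diag mat_trace_mat_diag Tt sum_distrib_left)
  have tr2: "(1 / of_nat n) * mat_trace (D_row p \<gamma> i * mat_diag p (\<lambda>j. T j w)) =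
      complex_of_real (\<Sum>j<p. (\<gamma> i j)\<^sup>2 / real n * \<tau> j)" for i
    by (simp add: D_row_def mat_diag_diag mat_trace_mat_diag T sum_distrib_left)
  have eqT: "T j w = -1 / (w * (1 + (1 / of_nat n) * mat_trace (D_col n \<gamma> j * mat_diag n (\<lambda>i. Tt i w))))" if "j < p" for j
    using sol w that unfolding diag_equiv_solution_def by blast
  have eqTt: "Tt i w = -1 / (w * (1 + (1 / of_nat n) * mat_trace (D_row p \<gamma> i * mat_diag p (\<lambda>j. T j w))))" if "i < n" for i
    using sol w that unfolding diag_equiv_solution_def by blast
  have real_eq: "a = 1 / (x * (1 + s))" if "complex_of_real a = -1 / (w * (1 + complex_of_real s))" for a s
  proof -
    have "complex_of_real a = complex_of_real (1 / (x * (1 + s)))"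
      using that by (simp add: w_def)
    then show ?thesis
      by (simp only: of_real_eq_iff)
  qed
  show ?thesis
  proof (rule that[of \<tau> \<theta>])
    show "\<tau> j = 1 / (x * (1 + (\<Sum>i<n. (\<gamma> i j)\<^sup>2 / real n * \<theta> i)))" if "j < p" for j
      using eqT[OF that] unfolding tr1 T(1)[OF that] by (rule real_eq)
    show "\<theta> i = 1 / (x * (1 + (\<Sum>j<p. (\<gamma> i j)\<^sup>2 / real n * \<tau> j)))" if "i < n" for i
      using eqTt[OF that] unfolding tr2 Tt(1)[OF that] by (rule real_eq)
  qed (use T Tt in \<open>auto simp: w_def\<close>)
qed

text \<open>A majorant of the bound in \<open>expectation_diag_approx\<close> for
  \<open>k = 1/n\<close> when both dimensions are at most \<open>L * n\<close>. It is symmetric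
  enough to serve the array and its transpose, and isolating \<open>1/n\<close> makes its limit
  evident.\<close>

definition schur_error :: "real \<Rightarrow> real \<Rightarrow> real \<Rightarrow> real \<Rightarrow> nat \<Rightarrow> real" where
  "schur_error \<kappa> \<Gamma> L x n = (sqrt ((8 + 2 * \<kappa>) * (\<Gamma>\<^sup>2 * L / x\<^sup>2) * (1 / real n)) + \<Gamma> / x * (1 / real n)
     + sqrt (12 * ((2 * \<Gamma> / x)\<^sup>2 * L) * (1 / real n))) / x"

lemma schur_error_tendsto:
  assumes "x > 0"
  shows "schur_error \<kappa> \<Gamma> L x \<longlonglongrightarrow> 0"
proof -
  have "schur_error \<kappa> \<Gamma> L x \<longlonglongrightarrow> (sqrt ((8 + 2 * \<kappa>) * (\<Gamma>\<^sup>2 * L / x\<^sup>2) * 0) + \<Gamma> / x * 0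
     + sqrt (12 * ((2 * \<Gamma> / x)\<^sup>2 * L) * 0)) / x"
    unfolding schur_error_def[abs_def] using \<open>x > 0\<close> by (intro tendsto_intros lim_1_over_n) auto
  then show ?thesis
    by simp
qed

lemma schur_error_bound:
  assumes "\<kappa> \<ge> 0" "\<Gamma> > 0" "x > 0" and n: "n \<ge> 1" and "real m \<le> L * real n" "real q \<le> L * real n"
  shows "(sqrt ((8 + 2 * \<kappa>) * ((1 / real n)\<^sup>2 * \<Gamma>\<^sup>2 * (real m / x\<^sup>2))) + 1 / real n * (\<Gamma> / x)
       + 1 / real n * sqrt (12 * ((2 * \<Gamma> / x)\<^sup>2 * real q))) / x \<le> schur_error \<kappa> \<Gamma> L x n"
proof -
  have r: "(1 / real n)\<^sup>2 * real r \<le> L * (1 / real n)" if "real r \<le> L * real n" for r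
    using n that by (simp add: field_simps power2_eq_square)
  have "(8 + 2 * \<kappa>) * ((1 / real n)\<^sup>2 * \<Gamma>\<^sup>2 * (real m / x\<^sup>2)) = (8 + 2 * \<kappa>) * (\<Gamma>\<^sup>2 / x\<^sup>2) * ((1 / real n)\<^sup>2 * real m)"
    by simp
  also have "\<dots> \<le> (8 + 2 * \<kappa>) * (\<Gamma>\<^sup>2 / x\<^sup>2) * (L * (1 / real n))"
    by (intro mult_left_mono r) (use assms in auto)
  finally have 1: "sqrt ((8 + 2 * \<kappa>) * ((1 / real n)\<^sup>2 * \<Gamma>\<^sup>2 * (real m / x\<^sup>2))) \<le>
      sqrt ((8 + 2 * \<kappa>) * (\<Gamma>\<^sup>2 * L / x\<^sup>2) * (1 / real n))"
    by (simp add: mult_ac)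
  have "1 / real n * sqrt (12 * ((2 * \<Gamma> / x)\<^sup>2 * real q)) = sqrt ((1 / real n)\<^sup>2 * (12 * ((2 * \<Gamma> / x)\<^sup>2 * real q)))"
    by (simp add: real_sqrt_mult)
  also have "(1 / real n)\<^sup>2 * (12 * ((2 * \<Gamma> / x)\<^sup>2 * real q)) = 12 * (2 * \<Gamma> / x)\<^sup>2 * ((1 / real n)\<^sup>2 * real q)"
    by simp
  also have "sqrt \<dots> \<le> sqrt (12 * (2 * \<Gamma> / x)\<^sup>2 * (L * (1 / real n)))"
    by (intro real_sqrt_le_mono mult_left_mono r) (use assms in auto)
  finally have 2: "1 / real n * sqrt (12 * ((2 * \<Gamma> / x)\<^sup>2 * real q)) \<le> sqrt (12 * ((2 * \<Gamma> / x)\<^sup>2 * L) * (1 / real n))"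
    by (simp add: mult_ac)
  show ?thesis
    unfolding schur_error_def using 1 2 \<open>x > 0\<close> by (intro divide_right_mono add_mono) (auto simp: mult.commute)
qed

text \<open>\<open>expectation_diag_approx\<close> for the array expresses the means for
  \<open>Q\<close> through those for the co-resolvent, and for the transpose the converse. The means
  thus solve the system up to \<open>schur_error\<close>, and \<open>fixed_point_stability\<close>
  costs a factor 2. The condition on \<open>x\<close> bounds both marginal sums of the weights
  \<open>\<gamma>^2 / n\<close> by \<open>x / 2\<close>.\<close>

lemma deterministic_equivalent_mean:
  fixes \<gamma> Zn :: "nat \<Rightarrow> nat \<Rightarrow> _"
  assumes arr: "random_array_moments M n p Zn \<kappa>" "random_array_moments M p n (\<lambda>j i. Zn i j) \<kappa>"
    and \<kappa>: "\<kappa> \<ge> 0" and \<Gamma>: "\<Gamma> > 0" and n: "n \<ge> 1" and L: "L \<ge> 1" "real p \<le> L * real n" and x: "x > 2 * \<Gamma> * L"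
    and \<gamma>: "\<And>i j. i < n \<Longrightarrow> j < p \<Longrightarrow> (\<gamma> i j)\<^sup>2 \<le> \<Gamma>"
    and sol: "diag_equiv_solution n p \<gamma> T Tt"
  shows "\<And>j. j < p \<Longrightarrow> cmod (complex_of_real (\<integral>\<omega>. green (1 / real n) x p n (\<lambda>j i. \<gamma> i j * Zn i j \<omega>) j j \<partial>M)
      - T j (- complex_of_real x)) \<le> 2 * schur_error \<kappa> \<Gamma> L x n"
    and "\<And>i. i < n \<Longrightarrow> cmod (complex_of_real (\<integral>\<omega>. green (1 / real n) x n p (\<lambda>i j. \<gamma> i j * Zn i j \<omega>) i i \<partial>M)
      - Tt i (- complex_of_real x)) \<le> 2 * schur_error \<kappa> \<Gamma> L x n"
proof -
  interpret A: random_array_moments M n p Zn \<kappa>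
    by (rule arr)
  interpret A': random_array_moments M p n "\<lambda>j i. Zn i j" \<kappa>
    by (rule arr)
  have xp: "x > 0"
    by (rule order.strict_trans2[OF _ less_imp_le[OF x]]) (use \<Gamma> L in auto)
  have k: "1 / real n \<ge> 0"
    by simp
  define a where "a j = (\<integral>\<omega>. green (1 / real n) x p n (\<lambda>j i. \<gamma> i j * Zn i j \<omega>) j j \<partial>M)" for j
  define b where "b i = (\<integral>\<omega>. green (1 / real n) x n p (\<lambda>i j. \<gamma> i j * Zn i j \<omega>) i i \<partial>M)" for i
  define \<epsilon> where "\<epsilon> = schur_error \<kappa> \<Gamma> L x n"
  have n': "real n \<le> L * real n"
    using L(1) by (simp add: mult_le_cancel_right1)
  have ea: "\<bar>a j - 1 / (x * (1 + (\<Sum>i<n. (\<gamma> i j)\<^sup>2 / real n * b i)))\<bar> \<le> \<epsilon>" if "j < p" for j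
    using order_trans[OF A.expectation_diag_approx[OF k xp \<Gamma> that \<gamma>] schur_error_bound[OF \<kappa> \<Gamma> xp n n' L(2)]]
    by (simp add: a_def b_def \<epsilon>_def sum_distrib_left)
  have eb: "\<bar>b i - 1 / (x * (1 + (\<Sum>j<p. (\<gamma> i j)\<^sup>2 / real n * a j)))\<bar> \<le> \<epsilon>" if "i < n" for i
    using order_trans[OF A'.expectation_diag_approx[OF k xp \<Gamma> that, of "\<lambda>j i. \<gamma> i j"] schur_error_bound[OF \<kappa> \<Gamma> xp n L(2) n']] \<gamma>
    by (simp add: a_def b_def \<epsilon>_def sum_distrib_left)
  have "0 \<le> \<epsilon>"
    \<comment> \<open>Row index 0 exists since \<open>n \<ge> 1\<close>, and an absolute value
      bounded by \<open>\<epsilon>\<close> forces \<open>\<epsilon> \<ge> 0\<close>; columns could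
      be absent.\<close>
    using eb[of 0] n by (intro order_trans[OF abs_ge_zero eb[of 0]]) simp
  obtain \<tau> \<theta> where pos: "\<And>j. j < p \<Longrightarrow> 0 \<le> \<tau> j" "\<And>i. i < n \<Longrightarrow> 0 \<le> \<theta> i"
    and T: "\<And>j. j < p \<Longrightarrow> T j (- complex_of_real x) = complex_of_real (\<tau> j)"
      "\<And>i. i < n \<Longrightarrow> Tt i (- complex_of_real x) = complex_of_real (\<theta> i)"
    and fp: "\<And>j. j < p \<Longrightarrow> \<tau> j = 1 / (x * (1 + (\<Sum>i<n. (\<gamma> i j)\<^sup>2 / real n * \<theta> i)))"
      "\<And>i. i < n \<Longrightarrow> \<theta> i = 1 / (x * (1 + (\<Sum>j<p. (\<gamma> i j)\<^sup>2 / real n * \<tau> j)))"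
    using diag_equiv_solution_real[OF sol xp] by blast
  have a0: "0 \<le> a j" if "j < p" for j
    unfolding a_def using green_diag_bounds(1)[OF k xp that] by (intro integral_nonneg_AE) auto
  have b0: "0 \<le> b i" if "i < n" for i
    unfolding b_def using green_diag_bounds(1)[OF k xp that] by (intro integral_nonneg_AE) auto
  have w: "(\<gamma> i j)\<^sup>2 / real n \<le> \<Gamma> / real n" if "i < n" "j < p" for i j
    using \<gamma>[OF that] by (intro divide_right_mono) auto
  have w1: "(\<Sum>i<n. (\<gamma> i j)\<^sup>2 / real n) \<le> x / 2" if "j < p" for j
  proof -
    have "(\<Sum>i<n. (\<gamma> i j)\<^sup>2 / real n) \<le> (\<Sum>i<n. \<Gamma> / real n)"
      using w that by (intro sum_mono) auto
    also have "\<dots> = \<Gamma> * 1"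
      using n by simp
    also have "\<dots> \<le> \<Gamma> * L"
      using L \<Gamma> by (intro mult_left_mono) auto
    finally show ?thesis
      using x by simp
  qed
  have w2: "(\<Sum>j<p. (\<gamma> i j)\<^sup>2 / real n) \<le> x / 2" if "i < n" for i
  proof -
    have "(\<Sum>j<p. (\<gamma> i j)\<^sup>2 / real n) \<le> (\<Sum>j<p. \<Gamma> / real n)"
      using w that by (intro sum_mono) auto
    also have "\<dots> = \<Gamma> * (real p / real n)"
      by simp
    also have "\<dots> \<le> \<Gamma> * L"
      using L(2) \<Gamma> n by (intro mult_left_mono) (auto simp: field_simps)
    finally show ?thesis
      using x by simp
  qed
  have "\<bar>a j - \<tau> j\<bar> \<le> 2 * \<epsilon>" if "j < p" for j
    by (rule fixed_point_stability(1)[where w = "\<lambda>i j. (\<gamma> i j)\<^sup>2 / real n", OF xp _ w1 w2 a0 pos(1) b0 pos(2) ea eb fp \<open>0 \<le> \<epsilon>\<close> that]) auto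
  moreover have "\<bar>b i - \<theta> i\<bar> \<le> 2 * \<epsilon>" if "i < n" for i
    by (rule fixed_point_stability(2)[where w = "\<lambda>i j. (\<gamma> i j)\<^sup>2 / real n", OF xp _ w1 w2 a0 pos(1) b0 pos(2) ea eb fp \<open>0 \<le> \<epsilon>\<close> that]) auto
  ultimately show
    "\<And>j. j < p \<Longrightarrow> cmod (complex_of_real (\<integral>\<omega>. green (1 / real n) x p n (\<lambda>j i. \<gamma> i j * Zn i j \<omega>) j j \<partial>M)
      - T j (- complex_of_real x)) \<le> 2 * schur_error \<kappa> \<Gamma> L x n"
    "\<And>i. i < n \<Longrightarrow> cmod (complex_of_real (\<integral>\<omega>. green (1 / real n) x n p (\<lambda>i j. \<gamma> i j * Zn i j \<omega>) i i \<partial>M)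
      - Tt i (- complex_of_real x)) \<le> 2 * schur_error \<kappa> \<Gamma> L x n"
    by (simp_all add: T a_def[symmetric] b_def[symmetric] \<epsilon>_def[symmetric] flip: of_real_diff)
qed

lemma power4_le_powr:
  assumes "\<delta> > 0"
  shows "(t::real) ^ 4 \<le> 1 + \<bar>t\<bar> powr (4 + \<delta>)"
proof (cases "\<bar>t\<bar> \<le> 1")
  case True
  then have "\<bar>t\<bar> ^ 4 \<le> 1"
    by (intro power_le_one) auto
  then show ?thesis
    by (simp add: power_even_abs add_increasing2)
next
  case False
  then have "\<bar>t\<bar> powr 4 \<le> \<bar>t\<bar> powr (4 + \<delta>)"
    using assms by (intro powr_mono) auto
  moreover have "\<bar>t\<bar> powr 4 = t ^ 4"
    using False by (subst powr_numeral) (auto simp: power_even_abs)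
  ultimately show ?thesis
    by simp
qed

theorem theorem3p1:
  fixes M :: "'w measure"
    and p :: "nat \<Rightarrow> nat" and c :: real
    and \<gamma> :: "nat \<Rightarrow> nat \<Rightarrow> nat \<Rightarrow> real"
    and Z :: "nat \<Rightarrow> nat \<Rightarrow> nat \<Rightarrow> 'w \<Rightarrow> real"
    and law :: "real measure"
    and \<delta> \<gamma>max :: real
    and T Tt :: "nat \<Rightarrow> nat \<Rightarrow> complex \<Rightarrow> complex"
    and z :: complex
  assumes "prob_space M"
    and "c > 0" and "(\<lambda>n. real (p n) / real n) \<longlonglongrightarrow> c"
    and indep: "\<And>n. n \<ge> 1 \<Longrightarrow>
      prob_space.indep_vars M (\<lambda>_. borel) (\<lambda>(i, j). Z n i j) ({..<n} \<times> {..<p n})"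
    and ident: "\<And>n i j. n \<ge> 1 \<Longrightarrow> i < n \<Longrightarrow> j < p n \<Longrightarrow> distr M borel (Z n i j) = law"
    and centered: "\<And>n i j. n \<ge> 1 \<Longrightarrow> i < n \<Longrightarrow> j < p n \<Longrightarrow>
      integrable M (Z n i j) \<and> prob_space.expectation M (Z n i j) = 0"
    and unit_variance: "\<And>n i j. n \<ge> 1 \<Longrightarrow> i < n \<Longrightarrow> j < p n \<Longrightarrow>
      prob_space.variance M (Z n i j) = 1"
    and "\<delta> > 0"
    and moment: "\<And>n i j. n \<ge> 1 \<Longrightarrow> i < n \<Longrightarrow> j < p n \<Longrightarrow>
      integrable M (\<lambda>\<omega>. \<bar>Z n i j \<omega>\<bar> powr (4 + \<delta>))"
    and "\<gamma>max > 0"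
    and profile: "\<And>n i j. n \<ge> 1 \<Longrightarrow> i < n \<Longrightarrow> j < p n \<Longrightarrow> \<bar>\<gamma> n i j\<bar> < \<gamma>max"
    and solution: "\<And>n. n \<ge> 1 \<Longrightarrow> diag_equiv_solution n (p n) (\<gamma> n) (T n) (Tt n)"
    and "z \<notin> \<real>\<^sub>\<ge>\<^sub>0"
  shows
    "mat_family_equiv M p
       (\<lambda>n \<omega>. diag_part (Q n (p n) (\<gamma> n) (\<lambda>i j. Z n i j \<omega>) z))
       (\<lambda>n \<omega>. mat_diag (p n) (\<lambda>j. T n j z))
     \<and> mat_family_equiv M p
       (\<lambda>n \<omega>. diag_part (mat_deriv (Q n (p n) (\<gamma> n) (\<lambda>i j. Z n i j \<omega>)) z))
       (\<lambda>n \<omega>. mat_deriv (\<lambda>w. mat_diag (p n) (\<lambda>j. T n j w)) z)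
     \<and> mat_family_equiv M (\<lambda>n. n)
       (\<lambda>n \<omega>. diag_part (Q_tilde n (p n) (\<gamma> n) (\<lambda>i j. Z n i j \<omega>) z))
       (\<lambda>n \<omega>. mat_diag n (\<lambda>i. Tt n i z))
     \<and> mat_family_equiv M (\<lambda>n. n)
       (\<lambda>n \<omega>. diag_part (mat_deriv (Q_tilde n (p n) (\<gamma> n) (\<lambda>i j. Z n i j \<omega>)) z))
       (\<lambda>n \<omega>. mat_deriv (\<lambda>w. mat_diag n (\<lambda>i. Tt n i w)) z)"
proof -
  interpret prob_space M
    by fact
  \<comment> \<open>Taken from the common law, hence one fourth-moment bound for all
    \<open>n\<close>, \<open>i\<close> and \<open>j\<close>.\<close>
  define \<kappa> where "\<kappa> = (\<integral>t. t ^ 4 \<partial>law)"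
  define \<Gamma> where "\<Gamma> = \<gamma>max\<^sup>2"
  \<comment> \<open>Eventually \<open>p n \<le> 2 * c * n\<close>, while the 1 gives
    \<open>n \<le> L * n\<close>; one constant then bounds both dimensions.\<close>
  define L where "L = max 1 (2 * c)"
  have \<kappa>: "\<kappa> \<ge> 0"
    unfolding \<kappa>_def by (intro integral_nonneg_AE) auto
  have \<Gamma>: "\<Gamma> > 0"
    using \<open>\<gamma>max > 0\<close> by (simp add: \<Gamma>_def)
  have L: "L \<ge> 1" "2 * \<Gamma> * L > 0"
    using \<Gamma> by (auto simp: L_def)
  have \<gamma>: "(\<gamma> n i j)\<^sup>2 \<le> \<Gamma>" if "n \<ge> 1" "i < n" "j < p n" for n i j
    using profile[OF that] power_mono[of "\<bar>\<gamma> n i j\<bar>" \<gamma>max 2] by (simp add: \<Gamma>_def)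
  have Zm: "Z n i j \<in> borel_measurable M" if "n \<ge> 1" "i < n" "j < p n" for n i j
    using centered[OF that] by auto
  have Zvar: "expectation (\<lambda>\<omega>. (Z n i j \<omega>)\<^sup>2) = 1" if "n \<ge> 1" "i < n" "j < p n" for n i j
    using unit_variance[OF that] centered[OF that] by simp
  have Zint4: "integrable M (\<lambda>\<omega>. Z n i j \<omega> ^ 4)" if "n \<ge> 1" "i < n" "j < p n" for n i j
  proof (rule Bochner_Integration.integrable_bound)
    show "integrable M (\<lambda>\<omega>. 1 + \<bar>Z n i j \<omega>\<bar> powr (4 + \<delta>))"
      using moment[OF that] by simp
    show "(\<lambda>\<omega>. Z n i j \<omega> ^ 4) \<in> borel_measurable M"
      using Zm[OF that] by measurable
    show "AE \<omega> in M. norm (Z n i j \<omega> ^ 4) \<le> norm (1 + \<bar>Z n i j \<omega>\<bar> powr (4 + \<delta>))"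
    proof (rule AE_I2)
      fix \<omega>
      have "norm (Z n i j \<omega> ^ 4) = Z n i j \<omega> ^ 4"
        by simp
      also have "\<dots> \<le> 1 + \<bar>Z n i j \<omega>\<bar> powr (4 + \<delta>)"
        by (rule power4_le_powr) fact
      also have "\<dots> \<le> norm \<dots>"
        by simp
      finally show "norm (Z n i j \<omega> ^ 4) \<le> norm (1 + \<bar>Z n i j \<omega>\<bar> powr (4 + \<delta>))" .
    qed
  qed
  have Z4: "expectation (\<lambda>\<omega>. Z n i j \<omega> ^ 4) \<le> \<kappa>" if "n \<ge> 1" "i < n" "j < p n" for n i j
    unfolding \<kappa>_def ident[OF that, symmetric] using Zm[OF that] by (simp add: integral_distr)
  have arr: "random_array_moments M n (p n) (Z n) \<kappa>" if "n \<ge> 1" for n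
    by unfold_locales (use that indep Zvar Zint4 Z4 centered in auto)
  have arr': "random_array_moments M (p n) n (\<lambda>j i. Z n i j) \<kappa>" if "n \<ge> 1" for n
  proof unfold_locales
    have "indep_vars (\<lambda>_. borel) (\<lambda>l. (\<lambda>(i, j). Z n i j) ((\<lambda>(j, i). (i, j)) l)) ({..<p n} \<times> {..<n})"
      by (rule indep_vars_reindex[OF indep[OF that]]) (auto simp: inj_on_def)
    then show "indep_vars (\<lambda>_. borel) (\<lambda>(i, j). Z n j i) ({..<p n} \<times> {..<n})"
      by (simp add: case_prod_unfold)
  qed (use that Zvar Zint4 Z4 centered in auto)
  have "\<forall>\<^sub>F n in sequentially. c / 2 < real (p n) / real n" "\<forall>\<^sub>F n in sequentially. real (p n) / real n < 2 * c"
    by (rule order_tendstoD[OF \<open>(\<lambda>n. real (p n) / real n) \<longlonglongrightarrow> c\<close>], use \<open>c > 0\<close> in simp)+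
  then have ratio: "\<forall>\<^sub>F n in sequentially. n \<ge> 1 \<and> c / 2 * real n \<le> real (p n) \<and> p n > 0 \<and> real (p n) \<le> 2 * c * real n"
    using eventually_ge_at_top[of 1]
  proof eventually_elim
    case (elim n)
    then have "c / 2 * real n < real (p n)" "real (p n) < 2 * c * real n"
      by (auto simp: field_simps)
    moreover have "c / 2 * real n > 0"
      using elim \<open>c > 0\<close> by simp
    ultimately show ?case
      using elim by auto
  qed
  have mean: "\<forall>\<^sub>F n in sequentially.
      (\<forall>j<p n. cmod (complex_of_real (\<integral>\<omega>. green (1 / real n) x (p n) n (\<lambda>j i. \<gamma> n i j * Z n i j \<omega>) j j \<partial>M)
        - T n j (- complex_of_real x)) \<le> 2 * schur_error \<kappa> \<Gamma> L x n) \<and>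
      (\<forall>i<n. cmod (complex_of_real (\<integral>\<omega>. green (1 / real n) x n (p n) (\<lambda>i j. \<gamma> n i j * Z n i j \<omega>) i i \<partial>M)
        - Tt n i (- complex_of_real x)) \<le> 2 * schur_error \<kappa> \<Gamma> L x n)"
    if x: "x > 2 * \<Gamma> * L" for x
    using ratio
  proof eventually_elim
    case (elim n)
    then have n: "n \<ge> 1" and pL: "real (p n) \<le> L * real n"
      by (auto simp: L_def intro: order_trans mult_right_mono)
    show ?case
      using deterministic_equivalent_mean[OF arr[OF n] arr'[OF n] \<kappa> \<Gamma> n L(1) pL x \<gamma>[OF n] solution[OF n]] by blast
  qed
  have err: "(\<lambda>n. 2 * schur_error \<kappa> \<Gamma> L x n) \<longlonglongrightarrow> 0" if "x > 2 * \<Gamma> * L" for x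
  proof -
    have "x > 0"
      using that L(2) by linarith
    from tendsto_mult_left[OF schur_error_tendsto[OF this], of 2] show ?thesis
      by simp
  qed
  have zs: "z \<in> slit"
    using \<open>z \<notin> \<real>\<^sub>\<ge>\<^sub>0\<close> by simp
  have st: "stieltjes_class (T n j)" if "n \<ge> 1" "j < p n" for n j
    using solution[OF that(1)] that(2) by (simp add: diag_equiv_solution_def)
  have st': "stieltjes_class (Tt n i)" if "n \<ge> 1" "i < n" for n i
    using solution[OF that(1)] that(2) by (simp add: diag_equiv_solution_def)
  have dims: "\<forall>\<^sub>F n in sequentially. c / 2 * real n \<le> real (p n) \<and> n > 0 \<and> real n \<le> 1 * real n"
    using ratio by eventually_elim auto
  have dims': "\<forall>\<^sub>F n in sequentially. 1 * real n \<le> real n \<and> p n > 0 \<and> real (p n) \<le> 2 * c * real n"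
    using ratio by eventually_elim auto
  have approx: "\<exists>\<delta>. \<delta> \<longlonglongrightarrow> 0 \<and> (\<forall>\<^sub>F n in sequentially. \<forall>j<p n.
      cmod (complex_of_real (\<integral>\<omega>. green (1 / real n) x (p n) n (\<lambda>j i. \<gamma> n i j * Z n i j \<omega>) j j \<partial>M)
        - T n j (- complex_of_real x)) \<le> \<delta> n)" if "x > 2 * \<Gamma> * L" for x
    using err[OF that] mean[OF that] by (intro exI[of _ "\<lambda>n. 2 * schur_error \<kappa> \<Gamma> L x n"]) (auto elim: eventually_mono)
  have approx': "\<exists>\<delta>. \<delta> \<longlonglongrightarrow> 0 \<and> (\<forall>\<^sub>F n in sequentially. \<forall>i<n.
      cmod (complex_of_real (\<integral>\<omega>. green (1 / real n) x n (p n) (\<lambda>i j. \<gamma> n i j * Z n i j \<omega>) i i \<partial>M)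
        - Tt n i (- complex_of_real x)) \<le> \<delta> n)" if "x > 2 * \<Gamma> * L" for x
    using err[OF that] mean[OF that] by (intro exI[of _ "\<lambda>n. 2 * schur_error \<kappa> \<Gamma> L x n"]) (auto elim: eventually_mono)
  have half: "c / 2 > 0"
    using \<open>c > 0\<close> by simp
  have one: "(1 :: real) > 0"
    by simp
  \<comment> \<open>The two orientations exchange the roles of \<open>n\<close> and
    \<open>p\<close>. For \<open>Q\<close> the size is \<open>p n \<ge> (c / 2) n\<close> with
    \<open>n\<close> columns; for the co-resolvent the size is \<open>n\<close> with
    \<open>p n \<le> 2 c n\<close> columns.\<close>
  note QT = mat_family_equiv_resolvent[where M = M and m = p and q = "\<lambda>n. n" and W = "\<lambda>n j i. Z n i j" and t = T
      and \<gamma> = "\<lambda>n j i. \<gamma> n i j" and \<kappa> = \<kappa> and ?c1.0 = "c / 2" and ?c2.0 = 1 and ?x0.0 = "2 * \<Gamma> * L" and z = z]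
  note QtT = mat_family_equiv_resolvent[where M = M and m = "\<lambda>n. n" and q = p and W = Z and t = Tt
      and \<gamma> = \<gamma> and \<kappa> = \<kappa> and ?c1.0 = 1 and ?c2.0 = "2 * c" and ?x0.0 = "2 * \<Gamma> * L" and z = z]
  show ?thesis
    unfolding Q_eq_resolvent_gram Q_tilde_eq_resolvent_gram
  proof (intro conjI)
    show "mat_family_equiv M p
        (\<lambda>n \<omega>. diag_part (resolvent (gram (1 / real n) (p n) n (\<lambda>j i. \<gamma> n i j * Z n i j \<omega>)) z))
        (\<lambda>n \<omega>. mat_diag (p n) (\<lambda>j. T n j z))"
      by (rule QT(1)) (fact arr' half dims st approx L(2) zs)+
    show "mat_family_equiv M p
        (\<lambda>n \<omega>. diag_part (mat_deriv (resolvent (gram (1 / real n) (p n) n (\<lambda>j i. \<gamma> n i j * Z n i j \<omega>))) z))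
        (\<lambda>n \<omega>. mat_deriv (\<lambda>w. mat_diag (p n) (\<lambda>j. T n j w)) z)"
      by (rule QT(2)) (fact arr' half dims st approx L(2) zs)+
    show "mat_family_equiv M (\<lambda>n. n)
        (\<lambda>n \<omega>. diag_part (resolvent (gram (1 / real n) n (p n) (\<lambda>i j. \<gamma> n i j * Z n i j \<omega>)) z))
        (\<lambda>n \<omega>. mat_diag n (\<lambda>i. Tt n i z))"
      by (rule QtT(1)) (fact arr one dims' st' approx' L(2) zs)+
    show "mat_family_equiv M (\<lambda>n. n)
        (\<lambda>n \<omega>. diag_part (mat_deriv (resolvent (gram (1 / real n) n (p n) (\<lambda>i j. \<gamma> n i j * Z n i j \<omega>))) z))
        (\<lambda>n \<omega>. mat_deriv (\<lambda>w. mat_diag n (\<lambda>i. Tt n i w)) z)"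
      by (rule QtT(2)) (fact arr one dims' st' approx' L(2) zs)+
  qed
qed

end
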